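(* Assume the Riemann Hypothesis and let $c>0$ be fixed. Then the per-prime $\zeta$-footprint on the layer occupancy is $\ll p^{-1/4}(\log p)^2$; that is, $$\frac{\mathrm{RMS}_X(N-\langle N\rangle)}{\sqrt X/\log X}\ll X^{-1/4}(\log X)^2\qquad (X\to\infty),$$ for primes $p\asymp X$.
   Context: For $x\ge2$ and the critical window $h=c\sqrt x$, let $N(x)$ be the number of primes in the window $(x,x+h]$ (the layer count) and let $\langle N\rangle(x)=\int_x^{x+h}\frac{dt}{\log t}$ be its expected value. Put $\mathrm{RMS}_X(N-\langle N\rangle):=\bigl(\frac1X\int_X^{2X}(N(x)-\langle N\rangle(x))^2\,dx\bigr)^{1/2}$. The per-prime $\zeta$-footprint at scale $X$ is the root-mean-square fluctuation $\mathrm{RMS}_X(N-\langle N\rangle)$ divided by the layer occupancy, which is of order $\sqrt X/\log X$. *)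

theory Defs
  imports
    "HOL-Complex_Analysis.Complex_Analysis"
    "HOL-Computational_Algebra.Primes"
    "HOL-Library.Landau_Symbols"
begin

text \<open>
  Only the critical strip matters for the Riemann Hypothesis, so the zeta function is
  taken here on the half-plane \<open>Re s > 0\<close>: it is the analytic continuation of the
  Dirichlet series to \<open>Re s > 0\<close>, \<open>s \<noteq> 1\<close>. The last clause fixes the junk value off
  this domain, which makes the description unique (lemma \<open>zeta_unique_existence\<close> below).
\<close>

definition zeta_domain :: "complex set" where
  "zeta_domain = {s. Re s > 0} - {1}"

definition is_zeta :: "(complex \<Rightarrow> complex) \<Rightarrow> bool" where
  "is_zeta f \<longleftrightarrow>
     f holomorphic_on zeta_domain \<and>
     (\<forall>s. Re s > 1 \<longrightarrow> (\<lambda>n. of_nat (Suc n) powr (- s)) sums f s) \<and>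
     (\<forall>s. s \<notin> zeta_domain \<longrightarrow> f s = 0)"

definition zeta :: "complex \<Rightarrow> complex" where
  "zeta = (THE f. is_zeta f)"

definition Riemann_Hypothesis :: bool where
  "Riemann_Hypothesis \<longleftrightarrow> (\<forall>s. 0 < Re s \<and> Re s < 1 \<and> zeta s = 0 \<longrightarrow> Re s = 1 / 2)"

definition zeta_term :: "nat \<Rightarrow> complex \<Rightarrow> complex" where
  "zeta_term n s = of_nat (Suc n) powr (- s)
     - (of_nat (Suc (Suc n)) powr (1 - s) - of_nat (Suc n) powr (1 - s)) / (1 - s)"

lemma norm_zeta_term_le:
  assumes "Re s > 0" "s \<noteq> 1"
  shows "norm (zeta_term n s) \<le> norm s * real (Suc n) powr (- Re s - 1)"
proof -
  define N where "N = real (Suc n)"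
  have N: "N > 0" by (simp add: N_def)
  define S where "S = (of_real ` {N..N+1} :: complex set)"
  define B where "B = norm s * N powr (- Re s - 1)"
  have cvx: "convex S"
    unfolding S_def by (intro convex_linear_image linear_of_real convex_real_interval)
  have ends: "of_real N \<in> S" "of_real (N + 1) \<in> S"
    using imageI[of N "{N..N+1}" of_real] imageI[of "N + 1" "{N..N+1}" of_real]
    unfolding S_def by simp_all
  have S: "w \<notin> \<real>\<^sub>\<le>\<^sub>0" "w \<noteq> 0" if "w \<in> S" for w
    using that N by (auto simp: S_def complex_nonpos_Reals_iff)
  have small: "norm (of_real N powr (- s) - w powr (- s)) \<le> B" if w: "w \<in> S" for w
  proof -
    have "norm (of_real N powr (- s) - w powr (- s)) \<le> B * norm (of_real N - w)"
    proof (rule field_differentiable_bound[OF cvx _ _ ends(1) w])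
      fix z assume z: "z \<in> S"
      show "((\<lambda>z. z powr (- s)) has_field_derivative (- s) * z powr (- s - 1)) (at z within S)"
        using has_field_derivative_powr[OF S(1)[OF z], of "- s"]
        by (rule has_field_derivative_at_within)
      obtain r where r: "z = of_real r" "N \<le> r" using z by (auto simp: S_def)
      have "norm (z powr (- s - 1)) = r powr (- Re s - 1)"
        using r N by (subst norm_powr_real_powr) auto
      also have "\<dots> \<le> N powr (- Re s - 1)"
        using r N assms by (intro powr_mono2') auto
      finally show "norm ((- s) * z powr (- s - 1)) \<le> B"
        by (simp add: B_def norm_mult mult_left_mono)
    qed
    also have "\<dots> \<le> B * 1"
    proof (rule mult_left_mono)
      obtain r where r: "w = of_real r" "N \<le> r" "r \<le> N + 1" using w by (auto simp: S_def)
      have "norm (of_real N - w) = \<bar>N - r\<bar>"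
        unfolding r(1) of_real_diff[symmetric] norm_of_real ..
      thus "norm (of_real N - w) \<le> 1" using r by simp
    qed (simp add: B_def)
    finally show ?thesis by simp
  qed
  define F where "F = (\<lambda>w::complex. of_real N powr (- s) * w - w powr (1 - s) / (1 - s))"
  have "norm (F (of_real (N + 1)) - F (of_real N)) \<le> B * norm (of_real (N + 1) - of_real N :: complex)"
  proof (rule field_differentiable_bound[OF cvx _ _ ends(2) ends(1)])
    fix z assume z: "z \<in> S"
    have pow: "((\<lambda>z. z powr (1 - s)) has_field_derivative (1 - s) * z powr (1 - s - 1)) (at z within S)"
      using has_field_derivative_powr[OF S(1)[OF z], of "1 - s"]
      by (rule has_field_derivative_at_within)
    have "(F has_field_derivative
             (of_real N powr (- s) * 1 - ((1 - s) * z powr (1 - s - 1)) / (1 - s))) (at z within S)"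
      unfolding F_def
      by (rule DERIV_diff[OF DERIV_cmult[OF DERIV_ident] DERIV_cdivide[OF pow]])
    thus "(F has_field_derivative (of_real N powr (- s) - z powr (- s))) (at z within S)"
      using assms by simp
    show "norm (of_real N powr (- s) - z powr (- s)) \<le> B" by (rule small[OF z])
  qed
  moreover have "F (of_real (N + 1)) - F (of_real N) = zeta_term n s"
  proof -
    define u v :: complex where "u = of_nat (Suc n)" and "v = of_nat (Suc (Suc n))"
    have uv: "of_real (N + 1) = v" "of_real N = u" "v = u + 1"
      by (simp_all add: N_def u_def v_def)
    have "F v - F u = u powr (- s) * (v - u) - (v powr (1 - s) - u powr (1 - s)) / (1 - s)"
      unfolding F_def uv(2) by (simp only: diff_divide_distrib right_diff_distrib) simp
    also have "v - u = 1" by (simp add: uv(3))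
    finally show ?thesis
      unfolding uv(1,2) zeta_term_def u_def[symmetric] v_def[symmetric] by simp
  qed
  ultimately show ?thesis by (simp add: B_def N_def)
qed

lemma summable_Suc_powr: "a > 0 \<Longrightarrow> summable (\<lambda>n. real (Suc n) powr (- a - 1))"
  using summable_real_powr_iff[of "- a - 1"]
  by (subst summable_Suc_iff[of "\<lambda>n. real n powr (- a - 1)"]) auto

lemma open_zeta_domain: "open zeta_domain"
  unfolding zeta_domain_def by (intro open_Diff open_halfspace_Re_gt) auto

lemma connected_zeta_domain: "connected zeta_domain"
  unfolding zeta_domain_def
  by (intro connected_open_delete open_halfspace_Re_gt convex_connected convex_halfspace_Re_gt)
     auto

lemma suminf_zeta_term_holomorphic:
  "(\<lambda>s. \<Sum>n. zeta_term n s) holomorphic_on zeta_domain"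
proof (rule holomorphic_uniform_sequence[OF open_zeta_domain,
      where f = "\<lambda>n s. \<Sum>i<n. zeta_term i s"])
  show "(\<lambda>s. \<Sum>i<n. zeta_term i s) holomorphic_on zeta_domain" for n
    unfolding zeta_term_def zeta_domain_def by (intro holomorphic_intros) auto
next
  fix z assume z: "z \<in> zeta_domain"
  define e where "e = Re z / 2"
  have e: "e > 0" using z by (simp add: e_def zeta_domain_def)
  obtain d0 where d0: "d0 > 0" "cball z d0 \<subseteq> zeta_domain"
    using open_zeta_domain z by (meson open_contains_cball)
  define d where "d = min d0 e"
  have d: "d > 0" "cball z d \<subseteq> zeta_domain" "d \<le> e"
    using d0 e by (auto simp: d_def)
  have "uniform_limit (cball z d) (\<lambda>n s. \<Sum>i<n. zeta_term i s) (\<lambda>s. \<Sum>n. zeta_term n s) sequentially"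
  proof (rule Weierstrass_m_test)
    show "summable (\<lambda>n. (norm z + d) * real (Suc n) powr (- e - 1))"
      by (intro summable_mult summable_Suc_powr e)
    fix n s assume s: "s \<in> cball z d"
    hence "s \<in> zeta_domain" using d by auto
    hence "norm (zeta_term n s) \<le> norm s * real (Suc n) powr (- Re s - 1)"
      by (intro norm_zeta_term_le) (auto simp: zeta_domain_def)
    also have "\<dots> \<le> (norm z + d) * real (Suc n) powr (- e - 1)"
    proof (intro mult_mono powr_mono)
      have "norm (s - z) \<le> d" using s by (simp add: dist_norm norm_minus_commute)
      thus "norm s \<le> norm z + d" using norm_triangle_sub[of s z] by linarith
      have "\<bar>Re (z - s)\<bar> \<le> d"
        using s abs_Re_le_cmod[of "z - s"] by (simp add: dist_norm)
      hence "Re s \<ge> Re z - e" using d by auto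
      thus "- Re s - 1 \<le> - e - 1" by (simp add: e_def)
    qed (use d in auto)
    finally show "norm (zeta_term n s) \<le> (norm z + d) * real (Suc n) powr (- e - 1)" .
  qed
  with d show "\<exists>d>0. cball z d \<subseteq> zeta_domain \<and>
      uniform_limit (cball z d) (\<lambda>n s. \<Sum>i<n. zeta_term i s) (\<lambda>s. \<Sum>n. zeta_term n s) sequentially"
    by (intro exI[of _ d] conjI)
qed

lemma dirichlet_series_sums:
  assumes "Re s > 1"
  shows "(\<lambda>n. of_nat (Suc n) powr (- s)) sums (1 / (s - 1) + (\<Sum>n. zeta_term n s))"
proof -
  have s: "s \<noteq> 1" using assms by auto
  have "summable (\<lambda>n. zeta_term n s)"
  proof (rule summable_comparison_test')
    show "summable (\<lambda>n. norm s * real (Suc n) powr (- Re s - 1))"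
      using assms by (intro summable_mult summable_Suc_powr) auto
    show "norm (zeta_term n s) \<le> norm s * real (Suc n) powr (- Re s - 1)" if "n \<ge> 0" for n
      using assms s by (intro norm_zeta_term_le) auto
  qed
  hence 1: "(\<lambda>n. zeta_term n s) sums (\<Sum>n. zeta_term n s)" by (rule summable_sums)
  have lim: "(\<lambda>n. of_nat (Suc n) powr (1 - s) :: complex) \<longlonglongrightarrow> 0"
  proof (rule tendsto_norm_zero_cancel)
    have "(\<lambda>n. real (Suc n) powr (1 - Re s)) \<longlonglongrightarrow> 0"
      using assms
      by (intro tendsto_neg_powr filterlim_compose[OF filterlim_real_sequentially filterlim_Suc]) auto
    moreover have "norm (of_nat (Suc n) powr (1 - s) :: complex) = real (Suc n) powr (1 - Re s)" for n
      by (subst norm_powr_real_powr) auto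
    ultimately show "(\<lambda>n. norm (of_nat (Suc n) powr (1 - s) :: complex)) \<longlonglongrightarrow> 0" by simp
  qed
  have "(\<lambda>n. (of_nat (Suc (Suc n)) powr (1 - s) - of_nat (Suc n) powr (1 - s)) / (1 - s))
          sums ((0 - of_nat (Suc 0) powr (1 - s)) / (1 - s))"
    by (intro sums_divide telescope_sums lim)
  from sums_add[OF 1 this]
  have "(\<lambda>n. of_nat (Suc n) powr (- s))
          sums ((\<Sum>n. zeta_term n s) + (0 - of_nat (Suc 0) powr (1 - s)) / (1 - s))"
    by (simp add: zeta_term_def)
  moreover have "(0 - of_nat (Suc 0) powr (1 - s)) / (1 - s) = 1 / (s - 1)"
    using s by (simp add: divide_simps)
  ultimately show ?thesis unfolding add.commute[of "1 / (s - 1)"] by (simp only:)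
qed

lemma is_zeta_unique:
  assumes g: "is_zeta g" and h: "is_zeta h"
  shows "g = h"
proof
  fix s
  show "g s = h s"
  proof (cases "s \<in> zeta_domain")
    case True
    have *: "{s. Re s > 1} \<subseteq> zeta_domain" "2 \<in> {s. Re s > 1}"
      by (auto simp: zeta_domain_def)
    show ?thesis
    proof (rule analytic_continuation_open[of "{s. Re s > 1}" zeta_domain g h s])
      show "g z = h z" if "z \<in> {s. Re s > 1}" for z
        using that g h unfolding is_zeta_def by (auto intro: sums_unique2)
      show "{s. Re s > 1} \<noteq> {}" using * by blast
    qed (use g h True * in
          \<open>auto simp: is_zeta_def open_zeta_domain connected_zeta_domain open_halfspace_Re_gt\<close>)
  next
    case False
    thus ?thesis using g h by (simp add: is_zeta_def)
  qed
qed

lemma zeta_unique_existence: "\<exists>!f. is_zeta f"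
proof (rule ex_ex1I)
  define f where
    "f = (\<lambda>s. if s \<in> zeta_domain then 1 / (s - 1) + (\<Sum>n. zeta_term n s) else 0)"
  have "(\<lambda>s. 1 / (s - 1) + (\<Sum>n. zeta_term n s)) holomorphic_on zeta_domain"
    by (intro holomorphic_intros suminf_zeta_term_holomorphic) (auto simp: zeta_domain_def)
  hence "f holomorphic_on zeta_domain"
    by (rule holomorphic_transform) (auto simp: f_def)
  moreover have "s \<in> zeta_domain" if "Re s > 1" for s
    using that by (auto simp: zeta_domain_def)
  ultimately have "is_zeta f"
    unfolding is_zeta_def using dirichlet_series_sums by (auto simp: f_def)
  thus "\<exists>f. is_zeta f" by (rule exI[of is_zeta f])
qed (rule is_zeta_unique)

lemma is_zeta_zeta: "is_zeta zeta"
  unfolding zeta_def by (rule theI'[OF zeta_unique_existence])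

definition layer_count :: "real \<Rightarrow> real \<Rightarrow> nat" where
  "layer_count c x = card {p::nat. prime p \<and> x < real p \<and> real p \<le> x + c * sqrt x}"

definition expected_count :: "real \<Rightarrow> real \<Rightarrow> real" where
  "expected_count c x = integral {x..x + c * sqrt x} (\<lambda>t. 1 / ln t)"

definition RMS :: "(real \<Rightarrow> real) \<Rightarrow> real \<Rightarrow> real" where
  "RMS f X = sqrt (1 / X * integral {X..2 * X} (\<lambda>x. (f x)\<^sup>2))"

definition zeta_footprint :: "real \<Rightarrow> real \<Rightarrow> real" where
  "zeta_footprint c X =
     RMS (\<lambda>x. real (layer_count c x) - expected_count c x) X / (sqrt X / ln X)"

end

theory Submission
  imports Defs "HOL-Probability.Probability" "HOL-Number_Theory.Prime_Powers" "HOL-Real_Asymp.Real_Asymp"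
begin

text \<open>
  For \<open>x\<close> near \<open>X\<close> the window \<open>(x, x + c sqrt x]\<close> has relative length \<open>\<delta> \<approx> c / sqrt X\<close>. The bound for
  its prime count comes from a mean square estimate, of Selberg's type, for
  \<open>\<psi>(x + c sqrt x) - \<psi>(x) - c sqrt x\<close>: on average over \<open>[X, 2X]\<close> its square is \<open>\<lesssim> sqrt X (log X)^4\<close>
  (\<open>RH_psi_window_mean_square\<close>). Proper prime powers add \<open>O((log X)^2)\<close> in such a window
  (\<open>layer_count_approx_psi\<close>), and the weight \<open>log p\<close> is constant there up to a negligible error, so
  the root mean square of \<open>N - \<langle>N\<rangle>\<close> is \<open>\<lesssim> X^(1/4) log X\<close>. Division by \<open>sqrt X / log X\<close> gives the
  claim.

  In the variable \<open>v = log x\<close> the error \<open>D(v) = \<psi>(e^v) - e^v\<close> has the Laplace transform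
  \<open>- (1 + Z'/Z(s)) / s\<close> with \<open>Z(s) = (s - 1) \<zeta>(s)\<close>, and the increment of \<open>D\<close> over a shift \<open>\<tau>\<close> has this
  transform times \<open>e^(\<tau> s) - 1\<close>. Under the Riemann Hypothesis the transform continues to
  \<open>Re s > 1/2\<close>, because \<open>Z\<close> has no zero there; on the line \<open>Re s = 1\<close>, about which the hypothesis is
  silent, this is the classical theorem of Hadamard and de la Vallee Poussin
  (\<open>zeta_nonzero_1_line\<close>). Plancherel's inequality on the line \<open>Re s = 1/2 + a\<close> (\<open>plancherel_inequality_shifted_line\<close>) then bounds the mean
  square of the increment by the integral of \<open>|(e^(\<tau> s) - 1) / s|^2 |1 + Z'/Z(s)|^2\<close>. For \<open>\<tau> \<le> \<delta>\<close>
  the first factor is at most of order \<open>min(\<delta>, 1/|t|)^2\<close>. In the second one \<open>Z'/Z\<close> is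
  \<open>\<lesssim> log (|t| + 4) / a\<close>: \<open>Z\<close> has \<open>O(log (|t| + 4))\<close> zeros near \<open>s\<close>, and none is closer than \<open>a\<close>
  (\<open>logderiv_bound_by_zero_distance\<close>). The integral is therefore \<open>\<lesssim> \<delta> (log 1/\<delta>)^2 / a^2\<close>, and
  \<open>a = 1 / log X\<close> bounds the integral of \<open>(D(v + \<tau>) - D(v))^2\<close> over \<open>[log X, log X + 2]\<close>
  by \<open>X \<delta> (log X)^4\<close>, up to a constant, for every constant shift \<open>\<tau> \<le> \<delta>\<close>.

  The window itself is a shift by \<open>\<theta>(v) = log (1 + c e^(-v/2))\<close>, which varies with \<open>v\<close>. An average over
  auxiliary constant shifts, due to Saffari and Vaughan, reduces it to constant shifts at the cost
  of a constant factor (\<open>variable_shift_mean_square\<close>).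
\<close>

section \<open>Logarithmic derivatives at a given distance from the zeros\<close>

text \<open>
  The map \<open>w \<mapsto> w / (2 M - w)\<close> sends the half-plane \<open>Re w < M\<close> into the unit disc and fixes 0, so
  this is the Schwarz lemma for the composition with \<open>g\<close>.
\<close>

lemma borel_caratheodory:
  fixes g :: "complex \<Rightarrow> complex"
  assumes r: "r > 0" and hol: "g holomorphic_on ball 0 r" and g0: "g 0 = 0"
    and Re: "\<And>z. norm z < r \<Longrightarrow> Re (g z) < M" and z: "norm z < r"
  shows "norm (g z) * (r - norm z) \<le> 2 * M * norm z"
proof -
  have M: "M > 0" using Re[of 0] g0 r by simp
  define \<phi> where "\<phi> = (\<lambda>w. g (of_real r * w) / (2 * of_real M - g (of_real r * w)))"
  have rw: "norm (of_real r * w) < r" if "norm w < 1" for w :: complex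
    using that r by (simp add: norm_mult)
  have less: "norm (g u) < norm (2 * of_real M - g u)" if "norm u < r" for u
  proof -
    have "Re (g u) < M" using Re that by blast
    hence "0 < M * (M - Re (g u))" using M by simp
    hence "(Re (g u))\<^sup>2 + (Im (g u))\<^sup>2 < (2 * M - Re (g u))\<^sup>2 + (Im (g u))\<^sup>2"
      by (simp add: power2_eq_square algebra_simps)
    thus ?thesis by (simp add: cmod_def)
  qed
  have nz: "2 * of_real M - g u \<noteq> 0" if "norm u < r" for u
    using less[OF that] by force
  have hol': "(\<lambda>w. g (of_real r * w)) holomorphic_on ball 0 1"
    by (rule holomorphic_on_compose_gen[OF _ hol, unfolded o_def])
       (use rw in \<open>auto intro!: holomorphic_intros\<close>)
  have "norm (\<phi> (z / of_real r)) \<le> norm (z / of_real r)"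
  proof (rule Schwarz_Lemma(1))
    show "\<phi> holomorphic_on ball 0 1" unfolding \<phi>_def
      by (intro holomorphic_intros hol') (use nz rw in auto)
    show "norm (\<phi> w) < 1" if "norm w < 1" for w
      using less[OF rw[OF that]] nz[OF rw[OF that]] by (simp add: \<phi>_def norm_divide divide_simps)
  qed (use g0 z r in \<open>auto simp: \<phi>_def norm_divide\<close>)
  hence "norm (g z) * r \<le> norm z * norm (2 * of_real M - g z)"
    using r nz[OF z] by (simp add: \<phi>_def norm_divide divide_simps mult.commute split: if_splits)
  also have "\<dots> \<le> norm z * (2 * M + norm (g z))"
    using norm_triangle_ineq4[of "2 * of_real M" "g z"] M by (intro mult_left_mono) auto
  finally show ?thesis by (simp add: algebra_simps)
qed

text \<open>
  A function without zeros has a holomorphic logarithm, whose real part is bounded by the growth of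
  the function. Borel-Caratheodory turns this into a bound of the logarithm itself, and Cauchy's
  inequality into a bound of its derivative.
\<close>

lemma logderiv_bound_zero_free:
  fixes f :: "complex \<Rightarrow> complex"
  assumes r: "0 < r1" "r1 < r2" and hol: "f holomorphic_on ball 0 r2"
    and nz: "\<And>w. norm w < r2 \<Longrightarrow> f w \<noteq> 0"
    and bd: "\<And>w. norm w < r2 \<Longrightarrow> norm (f w) < exp M * norm (f 0)" and z: "norm z \<le> r1"
  shows "norm (deriv f z / f z) \<le> 8 * M * r2 / (r2 - r1)\<^sup>2"
proof -
  obtain g where g: "g holomorphic_on ball 0 r2" "\<And>x. x \<in> ball 0 r2 \<Longrightarrow> exp (g x) = f x"
    using holomorphic_logarithm_exists[of "ball 0 r2" f 0] hol nz r by auto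
  define h where "h = (\<lambda>w. g w - g 0)"
  have hholo: "h holomorphic_on ball 0 r2" unfolding h_def by (intro holomorphic_intros g)
  have M: "M > 0" using bd[of 0] nz[of 0] r by (simp add: mult_less_cancel_right)
  have Re: "Re (h w) < M" if "norm w < r2" for w
  proof -
    have "exp (Re (g w)) < exp M * exp (Re (g 0))"
      using bd[OF that] g(2)[of w] g(2)[of 0] that r by (metis dist_0_norm mem_ball norm_exp_eq_Re norm_zero r(1) less_trans)
    thus ?thesis by (simp add: h_def flip: exp_add)
  qed
  define d where "d = (r2 - r1) / 2"
  have d: "d > 0" using r by (simp add: d_def)
  have sub: "norm w \<le> r1 + d" if "w \<in> cball z d" for w
    using that z norm_triangle_sub[of w z] by (simp add: dist_norm norm_minus_commute)
  have r1d: "r1 + d < r2" "r2 - (r1 + d) = d" using r by (auto simp: d_def field_simps)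
  have cball: "cball z d \<subseteq> ball 0 r2"
  proof
    fix w assume "w \<in> cball z d"
    from sub[OF this] show "w \<in> ball 0 r2" using r1d by simp
  qed
  hence ball: "ball z d \<subseteq> ball 0 r2" using ball_subset_cball by blast
  have "norm ((deriv ^^ 1) h z) \<le> fact 1 * (2 * M * r2 / d) / d ^ 1"
  proof (rule Cauchy_inequality)
    show "h holomorphic_on ball z d"
      by (rule holomorphic_on_subset[OF hholo ball])
    show "continuous_on (cball z d) h"
      by (rule holomorphic_on_imp_continuous_on[OF holomorphic_on_subset[OF hholo cball]])
    show "norm (h w) \<le> 2 * M * r2 / d" if "norm (z - w) = d" for w
    proof -
      have w: "norm w \<le> r1 + d" using sub[of w] that by (simp add: dist_norm)
      have "norm (h w) * d \<le> norm (h w) * (r2 - norm w)"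
        using w r1d by (intro mult_left_mono) auto
      also have "\<dots> \<le> 2 * M * norm w"
        by (rule borel_caratheodory) (use hholo Re w r1d r in \<open>auto simp: h_def\<close>)
      also have "\<dots> \<le> 2 * M * r2" using w r1d M by (intro mult_left_mono) auto
      finally show ?thesis using d by (simp add: field_simps)
    qed
  qed fact+
  also have "fact 1 * (2 * M * r2 / d) / d ^ 1 = 8 * M * r2 / (r2 - r1)\<^sup>2"
    by (simp add: d_def power2_eq_square)
  also have "(deriv ^^ 1) h z = deriv f z / f z"
  proof -
    have zin: "z \<in> ball 0 r2" using z r by simp
    have dg: "(g has_field_derivative deriv g z) (at z)"
      using g(1) zin by (simp add: holomorphic_derivI)
    have 1: "deriv h z = deriv g z"
      unfolding h_def by (rule DERIV_imp_deriv) (auto intro!: derivative_eq_intros dg)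
    have "((\<lambda>w. exp (g w)) has_field_derivative exp (g z) * deriv g z) (at z)"
      by (auto intro!: derivative_eq_intros dg)
    hence "(f has_field_derivative exp (g z) * deriv g z) (at z)"
      by (rule has_field_derivative_transform_within_open[of _ _ _ "ball 0 r2"]) (use g zin in auto)
    hence "deriv f z = f z * deriv g z" using g(2)[OF zin] by (simp add: DERIV_imp_deriv)
    thus ?thesis using 1 nz[of z] zin by simp
  qed
  finally show ?thesis .
qed

text \<open>
  Dividing by the Blaschke factor of \<open>\<rho>\<close> removes one zero and keeps the modulus on the circle of
  radius \<open>R\<close>, while the modulus at the centre grows by the factor \<open>R / |\<rho>|\<close>. Every zero in the disc of
  radius \<open>r\<close> therefore uses up \<open>ln (R / r)\<close> of the growth exponent \<open>M\<close>. This is Jensen's inequality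
  applied to one zero at a time, so multiplicities take care of themselves.
\<close>

lemma divide_out_zero:
  fixes f :: "complex \<Rightarrow> complex"
  assumes S: "open S" "cball 0 R \<subseteq> S" and hol: "f holomorphic_on S" and f0: "f 0 \<noteq> 0"
    and bd: "\<And>w. norm w = R \<Longrightarrow> norm (f w) \<le> exp M * norm (f 0)"
    and \<rho>: "f \<rho> = 0" "norm \<rho> < r" "r < R"
  obtains f1 where "f1 holomorphic_on S" "f1 0 \<noteq> 0"
    "\<And>w. f w * (of_real (R\<^sup>2) - cnj \<rho> * w) = of_real R * f1 w * (w - \<rho>)"
    "\<And>w. norm w = R \<Longrightarrow> norm (f1 w) \<le> exp (M - ln (R / r)) * norm (f1 0)"
    "\<And>w. norm w < R \<Longrightarrow> f1 w = 0 \<Longrightarrow> f w = 0"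
proof -
  define q where "q = (\<lambda>w. if w = \<rho> then deriv f \<rho> else (f w - f \<rho>) / (w - \<rho>))"
  define f1 where "f1 = (\<lambda>w. q w * (of_real (R\<^sup>2) - cnj \<rho> * w) / of_real R)"
  have R: "R > 0" "r > 0" "norm \<rho> < R" using \<rho> norm_ge_zero[of \<rho>] by linarith+
  have q: "f w = (w - \<rho>) * q w" for w using \<rho> by (auto simp: q_def)
  have qhol: "q holomorphic_on S" unfolding q_def by (rule pole_lemma_open[OF hol S(1)])
  have f1hol: "f1 holomorphic_on S" unfolding f1_def
    by (intro holomorphic_intros qhol) (use R in auto)
  have eq: "f w * (of_real (R\<^sup>2) - cnj \<rho> * w) = of_real R * f1 w * (w - \<rho>)" for w
    using R by (simp add: f1_def q[of w])
  have sph: "norm (f1 w) = norm (f w)" if "norm w = R" for w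
  proof -
    have "of_real (R\<^sup>2) = w * cnj w" using that by (metis complex_norm_square of_real_power)
    hence "norm (of_real (R\<^sup>2) - cnj \<rho> * w) = norm (w * cnj (w - \<rho>))"
      by (simp add: algebra_simps)
    also have "\<dots> = R * norm (w - \<rho>)"
      by (simp only: norm_mult complex_mod_cnj that)
    finally show ?thesis using R by (simp add: f1_def q[of w] norm_mult norm_divide)
  qed
  have "f1 0 * \<rho> = - of_real R * f 0"
    using R by (simp add: f1_def q[of 0] power2_eq_square)
  hence "norm (f1 0 * \<rho>) = norm (of_real R * f 0)" by simp
  hence z: "norm (f1 0) * norm \<rho> = R * norm (f 0)" using R by (simp add: norm_mult)
  hence "R * norm (f 0) \<le> norm (f1 0) * r" unfolding z[symmetric] using \<rho> by (intro mult_left_mono) auto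
  hence ge: "R / r * norm (f 0) \<le> norm (f1 0)" using R by (simp add: field_simps)
  have grow: "norm (f1 w) \<le> exp (M - ln (R / r)) * norm (f1 0)" if "norm w = R" for w
  proof -
    have "norm (f1 w) \<le> exp M * norm (f 0)" using sph bd that by simp
    also have "\<dots> = exp (M - ln (R / r)) * (R / r * norm (f 0))" using R by (simp add: exp_diff)
    also have "\<dots> \<le> exp (M - ln (R / r)) * norm (f1 0)" using ge by (intro mult_left_mono) auto
    finally show ?thesis .
  qed
  have zeros: "f w = 0" if w: "norm w < R" "f1 w = 0" for w
  proof -
    have "norm (cnj \<rho> * w) < R * R"
      unfolding norm_mult complex_mod_cnj using R w by (intro mult_strict_mono) auto
    hence "norm (cnj \<rho> * w) \<noteq> norm (of_real (R\<^sup>2) :: complex)"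
      by (simp add: power2_eq_square norm_mult)
    hence "of_real (R\<^sup>2) - cnj \<rho> * w \<noteq> 0" by auto
    thus ?thesis using w R by (auto simp: f1_def q[of w])
  qed
  have "f1 0 \<noteq> 0" using z f0 R by auto
  thus ?thesis using that[of f1] f1hol eq grow zeros by blast
qed

text \<open>
  The maximum modulus principle. At the centre it says that the growth exponent never becomes
  negative, which is what ends the removal of zeros.
\<close>

lemma growth_exponent_nonneg:
  fixes f :: "complex \<Rightarrow> complex"
  assumes R: "R > 0" and S: "cball 0 R \<subseteq> S" and hol: "f holomorphic_on S" and f0: "f 0 \<noteq> 0"
    and bd: "\<And>w. norm w = R \<Longrightarrow> norm (f w) \<le> exp M * norm (f 0)"
  shows "norm w \<le> R \<Longrightarrow> norm (f w) \<le> exp M * norm (f 0)" "M \<ge> 0"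
proof -
  have holc: "f holomorphic_on cball 0 R" using hol S by (rule holomorphic_on_subset)
  have *: "norm (f w) \<le> exp M * norm (f 0)" if "norm w \<le> R" for w
    by (rule maximum_modulus_frontier[of f "cball 0 R"])
       (use that R bd holc in \<open>auto intro: holomorphic_on_subset holomorphic_on_imp_continuous_on\<close>)
  from *[of 0] f0 R show "M \<ge> 0" by simp
  show "norm w \<le> R \<Longrightarrow> norm (f w) \<le> exp M * norm (f 0)" by (rule *)
qed

text \<open>
  The induction runs over the number of zeros that the growth exponent can still pay for. Removing
  the zero \<open>\<rho>\<close> changes \<open>f' / f\<close> by \<open>1 / (z - \<rho>)\<close>, which is at most \<open>1 / a\<close>, and by the
  logarithmic derivative of \<open>R\<^sup>2 - cnj \<rho> * z\<close>, which is at most \<open>1 / (R - r2)\<close>. When no zero is left,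
  the zero-free bound applies.
\<close>

lemma logderiv_bound_induct:
  fixes f :: "complex \<Rightarrow> complex"
  assumes r: "0 < r1" "r1 < r2" "r2 < R" and S: "open S" "cball 0 R \<subseteq> S" and a: "a > 0"
    and z: "norm z \<le> r1"
    and hol: "f holomorphic_on S" and f0: "f 0 \<noteq> 0"
    and bd: "\<And>w. norm w = R \<Longrightarrow> norm (f w) \<le> exp M * norm (f 0)"
    and zeros: "\<And>\<rho>. norm \<rho> < r2 \<Longrightarrow> f \<rho> = 0 \<Longrightarrow> a \<le> norm (z - \<rho>)"
    and M: "M \<le> real n * ln (R / r2)"
  shows "norm (deriv f z / f z) \<le> real n * (1 / a + 1 / (R - r2)) + 8 * (M + 1) * r2 / (r2 - r1)\<^sup>2"
proof -
  define \<kappa> where "\<kappa> = ln (R / r2)"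
  define B where "B = (\<lambda>M. 8 * (M + 1) * r2 / (r2 - r1)\<^sup>2)"
  have \<kappa>: "\<kappa> > 0" "exp \<kappa> = R / r2" using r by (simp_all add: \<kappa>_def)
  have Bmono: "B x \<le> B y" if "x \<le> y" for x y
    using that r by (auto simp: B_def intro!: divide_right_mono)
  have base: "norm (deriv f z / f z) \<le> B M"
    if "f holomorphic_on S" "f 0 \<noteq> 0" "\<And>w. norm w = R \<Longrightarrow> norm (f w) \<le> exp M * norm (f 0)"
      "\<And>\<rho>. norm \<rho> < r2 \<Longrightarrow> f \<rho> \<noteq> 0" for f M
    unfolding B_def
  proof (rule logderiv_bound_zero_free)
    have R: "R > 0" using r by simp
    show "f holomorphic_on ball 0 r2"
      by (rule holomorphic_on_subset[OF that(1)]) (use S r in force)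
    show "norm (f w) < exp (M + 1) * norm (f 0)" if "norm w < r2" for w
    proof -
      have "norm (f w) \<le> exp M * norm (f 0)"
        by (rule growth_exponent_nonneg(1)[OF R S(2) \<open>f holomorphic_on S\<close> \<open>f 0 \<noteq> 0\<close>])
           (use \<open>\<And>w. norm w = R \<Longrightarrow> norm (f w) \<le> exp M * norm (f 0)\<close> that r in auto)
      also have "\<dots> < exp (M + 1) * norm (f 0)" using \<open>f 0 \<noteq> 0\<close> by simp
      finally show ?thesis .
    qed
  qed (use r z that in auto)
  have "norm (deriv f z / f z) \<le> real n * (1 / a + 1 / (R - r2)) + B M"
    using hol f0 bd zeros M unfolding \<kappa>_def[symmetric]
  proof (induction n arbitrary: f M)
    case (0 f M)
    have "f \<rho> \<noteq> 0" if \<rho>: "norm \<rho> < r2" for \<rho>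
    proof
      assume f\<rho>: "f \<rho> = 0"
      obtain f1 where f1: "f1 holomorphic_on S" "f1 0 \<noteq> 0"
          "\<And>w. norm w = R \<Longrightarrow> norm (f1 w) \<le> exp (M - \<kappa>) * norm (f1 0)"
        unfolding \<kappa>_def using divide_out_zero[OF S 0(1-3) f\<rho> \<rho> r(3)] by metis
      have "M - \<kappa> \<ge> 0" by (rule growth_exponent_nonneg(2)[OF _ S(2) f1]) (use r in simp)
      thus False using 0(5) \<kappa> by simp
    qed
    thus ?case using base[OF 0(1-3)] by simp
  next
    case (Suc n f M)
    show ?case
    proof (cases "\<exists>\<rho>. norm \<rho> < r2 \<and> f \<rho> = 0")
      case False
      hence "norm (deriv f z / f z) \<le> B M" using base[of f M] Suc.prems by blast
      also have "\<dots> \<le> real (Suc n) * (1 / a + 1 / (R - r2)) + B M" using r a by simp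
      finally show ?thesis .
    next
      case True
      then obtain \<rho> where \<rho>: "norm \<rho> < r2" "f \<rho> = 0" by blast
      obtain f1 where f1: "f1 holomorphic_on S" "f1 0 \<noteq> 0"
          "\<And>w. f w * (of_real (R\<^sup>2) - cnj \<rho> * w) = of_real R * f1 w * (w - \<rho>)"
          "\<And>w. norm w = R \<Longrightarrow> norm (f1 w) \<le> exp (M - \<kappa>) * norm (f1 0)"
          "\<And>w. norm w < R \<Longrightarrow> f1 w = 0 \<Longrightarrow> f w = 0"
        unfolding \<kappa>_def using divide_out_zero[OF S Suc.prems(1-3) \<rho>(2,1) r(3)] by blast
      have IH: "norm (deriv f1 z / f1 z) \<le> real n * (1 / a + 1 / (R - r2)) + B (M - \<kappa>)"
      proof (rule Suc.IH[OF f1(1,2,4)])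
        show "a \<le> norm (z - u)" if "norm u < r2" "f1 u = 0" for u
          using Suc.prems(4)[of u] f1(5)[of u] that r by simp
      qed (use Suc.prems in \<open>auto simp: algebra_simps\<close>)
      have zS: "z \<in> S" using z r S by auto
      have zR: "norm z < R" using z r by simp
      have fz: "f z \<noteq> 0" using Suc.prems(4)[of z] a z r by auto
      have z\<rho>: "norm (z - \<rho>) \<ge> a" using Suc.prems(4)[of \<rho>] \<rho> by auto
      define b where "b = of_real (R\<^sup>2) - cnj \<rho> * z"
      have b: "norm b \<ge> R * (R - r2)"
      proof -
        have "norm (cnj \<rho> * z) \<le> r2 * R"
          unfolding norm_mult complex_mod_cnj using \<rho> zR r by (intro mult_mono) auto
        moreover have "norm (of_real (R\<^sup>2) :: complex) = R * R"
          by (simp add: power2_eq_square norm_mult)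
        ultimately show ?thesis unfolding b_def
          using norm_triangle_ineq2[of "of_real (R\<^sup>2)" "cnj \<rho> * z"] by (simp add: algebra_simps)
      qed
      have b0: "b \<noteq> 0"
      proof
        assume "b = 0"
        moreover have "R * (R - r2) > 0" using r by simp
        ultimately show False using b by simp
      qed
      have df: "(f has_field_derivative deriv f z) (at z)"
        and df1: "(f1 has_field_derivative deriv f1 z) (at z)"
        using Suc.prems(1) f1(1) S(1) zS by (auto intro: holomorphic_derivI)
      have "((\<lambda>w. f w * (of_real (R\<^sup>2) - cnj \<rho> * w)) has_field_derivative
              deriv f z * b - f z * cnj \<rho>) (at z)"
        unfolding b_def by (auto intro!: derivative_eq_intros df simp: algebra_simps)
      hence "((\<lambda>w. of_real R * f1 w * (w - \<rho>)) has_field_derivative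
              deriv f z * b - f z * cnj \<rho>) (at z)"
        by (simp only: f1(3))
      moreover have "((\<lambda>w. of_real R * f1 w * (w - \<rho>)) has_field_derivative
              of_real R * deriv f1 z * (z - \<rho>) + of_real R * f1 z) (at z)"
        by (auto intro!: derivative_eq_intros df1 simp: algebra_simps)
      ultimately have d: "deriv f z * b - f z * cnj \<rho> =
          of_real R * deriv f1 z * (z - \<rho>) + of_real R * f1 z"
        by (rule DERIV_unique)
      have e: "f z * b = of_real R * f1 z * (z - \<rho>)" using f1(3)[of z] by (simp add: b_def)
      have nz: "f1 z \<noteq> 0" "z - \<rho> \<noteq> 0" "(of_real R :: complex) \<noteq> 0" using e fz b0 by auto
      have "deriv f z / f z - cnj \<rho> / b = (deriv f z * b - f z * cnj \<rho>) / (f z * b)"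
        using fz b0 by (simp add: field_simps)
      also have "\<dots> = deriv f1 z / f1 z + 1 / (z - \<rho>)"
        unfolding d e using nz by (simp add: field_simps)
      finally have "deriv f z / f z = deriv f1 z / f1 z + 1 / (z - \<rho>) + cnj \<rho> / b"
        by (simp add: algebra_simps)
      hence "norm (deriv f z / f z) \<le> norm (deriv f1 z / f1 z) + norm (1 / (z - \<rho>)) + norm (cnj \<rho> / b)"
        by (metis norm_triangle_ineq norm_triangle_mono order_refl)
      also have "norm (1 / (z - \<rho>)) \<le> 1 / a" using z\<rho> a by (simp add: norm_divide frac_le)
      also have "norm (cnj \<rho> / b) \<le> R / (R * (R - r2))"
        unfolding norm_divide complex_mod_cnj using b \<rho> r by (intro frac_le) auto
      also have "\<dots> = 1 / (R - r2)" using r by simp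
      also note IH
      also have "B (M - \<kappa>) \<le> B M" using \<kappa> by (intro Bmono) auto
      finally show ?thesis by (simp add: algebra_simps add_divide_distrib)
    qed
  qed
  thus ?thesis by (simp add: B_def)
qed

text \<open>
  The constant depends on the three radii alone. At distance \<open>a\<close> from the zeros the bound is of order
  \<open>M / a\<close>; applying Borel-Caratheodory in the zero-free region would only give \<open>M / a\<^sup>2\<close>, which is
  too weak for the mean square.
\<close>

lemma logderiv_bound_by_zero_distance:
  assumes r: "0 < r1" "r1 < r2" "r2 < R"
  shows "\<exists>C>0. \<forall>(f :: complex \<Rightarrow> complex) S z0 z M a.
     open S \<longrightarrow> cball z0 R \<subseteq> S \<longrightarrow> f holomorphic_on S \<longrightarrow> f z0 \<noteq> 0 \<longrightarrow> 
     (\<forall>w. norm (w - z0) = R \<longrightarrow> norm (f w) \<le> exp M * norm (f z0)) \<longrightarrow>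
     norm (z - z0) \<le> r1 \<longrightarrow> a > 0 \<longrightarrow>
     (\<forall>\<rho>. norm (\<rho> - z0) < r2 \<longrightarrow> f \<rho> = 0 \<longrightarrow> a \<le> norm (z - \<rho>)) \<longrightarrow>
     norm (deriv f z / f z) \<le> C * (M + 1) * (1 / a + 1)"
proof -
  define \<kappa> where "\<kappa> = ln (R / r2)"
  define C1 where "C1 = (1 / \<kappa> + 1) * (1 + 1 / (R - r2))"
  define C2 where "C2 = 8 * r2 / (r2 - r1)\<^sup>2"
  have \<kappa>: "\<kappa> > 0" using r by (simp add: \<kappa>_def)
  have C: "C1 > 0" "C2 > 0" unfolding C1_def C2_def using \<kappa> r by (auto intro!: mult_pos_pos add_pos_pos)
  show ?thesis
  proof (intro exI[of _ "C1 + C2"] conjI allI impI)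
    fix f :: "complex \<Rightarrow> complex" and S z0 z M a
    assume *: "open S" "cball z0 R \<subseteq> S" "f holomorphic_on S" "f z0 \<noteq> 0"
      "\<forall>w. norm (w - z0) = R \<longrightarrow> norm (f w) \<le> exp M * norm (f z0)"
      "norm (z - z0) \<le> r1" "a > (0::real)"
      "\<forall>\<rho>. norm (\<rho> - z0) < r2 \<longrightarrow> f \<rho> = 0 \<longrightarrow> a \<le> norm (z - \<rho>)"
    define h where "h = (\<lambda>w. f (z0 + w))"
    define T where "T = (\<lambda>w. w - z0) ` S"
    have T: "open T" "cball 0 R \<subseteq> T" "\<And>w. w \<in> T \<Longrightarrow> z0 + w \<in> S"
    proof -
      show "open T" unfolding T_def using *(1) by (rule open_translation_subtract)
      show "cball 0 R \<subseteq> T"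
      proof
        fix w :: complex assume "w \<in> cball 0 R"
        hence "z0 + w \<in> S" using *(2) by (auto simp: dist_norm)
        hence "z0 + w - z0 \<in> T" unfolding T_def by (rule imageI)
        thus "w \<in> T" by simp
      qed
    qed (auto simp: T_def)
    have hol: "h holomorphic_on T" unfolding h_def
      by (rule holomorphic_on_compose_gen[OF _ *(3), unfolded o_def])
         (auto intro!: holomorphic_intros T)
    have bd: "norm (h w) \<le> exp M * norm (h 0)" if "norm w = R" for w
      using *(5)[rule_format, of "z0 + w"] that by (simp add: h_def)
    have h0: "h 0 \<noteq> 0" using * by (simp add: h_def)
    have M: "M \<ge> 0" by (rule growth_exponent_nonneg(2)[OF _ T(2) hol h0 bd]) (use r in auto)
    define n where "n = nat \<lceil>M / \<kappa>\<rceil>"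
    have n: "M \<le> real n * \<kappa>" "real n \<le> M / \<kappa> + 1"
    proof -
      have "M / \<kappa> \<le> real n" unfolding n_def by linarith
      thus "M \<le> real n * \<kappa>" using \<kappa> by (simp add: field_simps)
      have "M / \<kappa> \<ge> 0" using M \<kappa> by simp
      thus "real n \<le> M / \<kappa> + 1" unfolding n_def by linarith
    qed
    have "norm (deriv h (z - z0) / h (z - z0)) \<le>
            real n * (1 / a + 1 / (R - r2)) + 8 * (M + 1) * r2 / (r2 - r1)\<^sup>2"
    proof (rule logderiv_bound_induct[OF r T(1,2) *(7) *(6) hol h0 bd])
      show "a \<le> norm (z - z0 - \<rho>)" if "norm \<rho> < r2" "h \<rho> = 0" for \<rho>
        using *(8)[rule_format, of "z0 + \<rho>"] that by (simp add: h_def algebra_simps)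
    qed (use n in \<open>auto simp: \<kappa>_def\<close>)
    also have "real n * (1 / a + 1 / (R - r2)) \<le> ((M + 1) * (1 / \<kappa> + 1)) * ((1 / a + 1) * (1 + 1 / (R - r2)))"
    proof (rule mult_mono)
      have "M / \<kappa> + 1 \<le> (M + 1) * (1 / \<kappa> + 1)" using M \<kappa> by (simp add: field_simps)
      thus "real n \<le> (M + 1) * (1 / \<kappa> + 1)" using n by linarith
      show "1 / a + 1 / (R - r2) \<le> (1 / a + 1) * (1 + 1 / (R - r2))"
      proof -
        have "x + y \<le> (x + 1) * (1 + y)" if "x \<ge> 0" "y \<ge> 0" for x y :: real
          using that by (simp add: algebra_simps)
        thus ?thesis using *(7) r by simp
      qed
    qed (use M \<kappa> *(7) r in auto)
    also have "\<dots> = C1 * (M + 1) * (1 / a + 1)" by (simp only: C1_def mult_ac)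
    also have "8 * (M + 1) * r2 / (r2 - r1)\<^sup>2 = C2 * (M + 1) * 1" by (simp add: C2_def)
    also have "C2 * (M + 1) * 1 \<le> C2 * (M + 1) * (1 / a + 1)"
      using C M *(7) by (intro mult_left_mono) auto
    finally have fin: "norm (deriv h (z - z0) / h (z - z0)) \<le> (C1 + C2) * (M + 1) * (1 / a + 1)"
      by (simp add: algebra_simps)
    have zS: "z \<in> S" using *(2,6) r by (force simp: dist_norm norm_minus_commute)
    have "(h has_field_derivative deriv f z) (at (z - z0))"
    proof -
      have "(f has_field_derivative deriv f z) (at (z0 + (z - z0)))"
        using *(1,3) zS by (simp add: holomorphic_derivI)
      thus ?thesis unfolding h_def
        by (rule DERIV_chain2[where g = "\<lambda>w. z0 + w" and Db = 1, simplified]) (auto intro!: derivative_eq_intros)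
    qed
    hence "deriv h (z - z0) = deriv f z" by (rule DERIV_imp_deriv)
    thus "norm (deriv f z / f z) \<le> (C1 + C2) * (M + 1) * (1 / a + 1)" using fin by (simp add: h_def)
  qed (use C in auto)
qed

section \<open>The zeta function on and to the right of the line of absolute convergence\<close>

text \<open>
  The right-hand side has the properties that determine \<open>zeta\<close> uniquely.
\<close>

lemma zeta_eq_suminf:
  assumes "s \<in> zeta_domain"
  shows "zeta s = 1 / (s - 1) + (\<Sum>n. zeta_term n s)"
proof -
  define f where
    "f = (\<lambda>s. if s \<in> zeta_domain then 1 / (s - 1) + (\<Sum>n. zeta_term n s) else 0)"
  have "(\<lambda>s. 1 / (s - 1) + (\<Sum>n. zeta_term n s)) holomorphic_on zeta_domain"
    by (intro holomorphic_intros suminf_zeta_term_holomorphic) (auto simp: zeta_domain_def)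
  hence "f holomorphic_on zeta_domain"
    by (rule holomorphic_transform) (auto simp: f_def)
  moreover have "s \<in> zeta_domain" if "Re s > 1" for s
    using that by (auto simp: zeta_domain_def)
  ultimately have "is_zeta f"
    unfolding is_zeta_def using dirichlet_series_sums by (auto simp: f_def)
  hence "zeta = f" using is_zeta_zeta is_zeta_unique by blast
  hence "zeta s = f s" by (rule fun_cong)
  thus ?thesis using assms by (simp add: f_def)
qed

text \<open>
  The pole of \<open>zeta\<close> is cleared by the factor \<open>s - 1\<close>. The logarithmic derivative of the result is
  holomorphic wherever \<open>Re s > 0\<close> and \<open>zeta\<close> does not vanish, the point 1 included.
\<close>

definition zeta_reg :: "complex \<Rightarrow> complex" where
  "zeta_reg s = (if s = 1 then 1 else (s - 1) * zeta s)"

abbreviation zeta_logderiv :: "complex \<Rightarrow> complex" where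
  "zeta_logderiv s \<equiv> deriv zeta_reg s / zeta_reg s"

text \<open>
  Here \<open>zeta_reg s - 1\<close> is \<open>s - 1\<close> times the sum of all \<open>zeta_term n s\<close>, which is of order \<open>|s|\<close>. The
  estimate serves twice: near 1 it removes the singularity, and for large \<open>|s|\<close> it is the polynomial
  growth that limits the number of zeros.
\<close>

lemma zeta_reg_bound:
  assumes b: "b > 0"
  obtains C where "C > 0"
    "\<And>s. Re s \<ge> b \<Longrightarrow> norm (zeta_reg s - 1) \<le> C * norm (s - 1) * norm s"
proof -
  define C where "C = (\<Sum>n. real (Suc n) powr (- b - 1))"
  have sm: "summable (\<lambda>n. real (Suc n) powr (- b - 1))" using b by (rule summable_Suc_powr)
  have C: "C > 0" unfolding C_def by (rule suminf_pos[OF sm]) simp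
  have "norm (zeta_reg s - 1) \<le> C * norm (s - 1) * norm s" if s: "Re s \<ge> b" for s
  proof (cases "s = 1")
    case False
    hence dom: "s \<in> zeta_domain" using s b by (simp add: zeta_domain_def)
    have le: "norm (zeta_term n s) \<le> norm s * real (Suc n) powr (- b - 1)" for n
    proof -
      have "norm (zeta_term n s) \<le> norm s * real (Suc n) powr (- Re s - 1)"
        using s b False by (intro norm_zeta_term_le) auto
      also have "\<dots> \<le> norm s * real (Suc n) powr (- b - 1)"
        using s by (intro mult_left_mono powr_mono) auto
      finally show ?thesis .
    qed
    have "zeta_reg s - 1 = (s - 1) * (\<Sum>n. zeta_term n s)"
      using False by (simp add: zeta_reg_def zeta_eq_suminf[OF dom] distrib_left)
    moreover have "norm (\<Sum>n. zeta_term n s) \<le> (\<Sum>n. norm s * real (Suc n) powr (- b - 1))"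
      by (rule norm_suminf_le[OF le summable_mult[OF sm]])
    moreover have "\<dots> = norm s * C" unfolding C_def by (rule suminf_mult[OF sm])
    ultimately have "norm (zeta_reg s - 1) \<le> norm (s - 1) * (norm s * C)"
      by (simp only: norm_mult) (intro mult_left_mono, auto)
    thus ?thesis by (simp add: mult_ac)
  qed (simp add: zeta_reg_def)
  with C show ?thesis using that by blast
qed

lemma zeta_reg_holomorphic: "zeta_reg holomorphic_on {s. Re s > 0}"
proof (rule no_isolated_singularity'[where K = "{1}"])
  have "(\<lambda>s. (s - 1) * zeta s) holomorphic_on zeta_domain"
    using is_zeta_zeta unfolding is_zeta_def by (intro holomorphic_intros) auto
  hence "zeta_reg holomorphic_on zeta_domain"
    by (rule holomorphic_transform) (auto simp: zeta_reg_def zeta_domain_def)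
  thus "zeta_reg holomorphic_on {s. Re s > 0} - {1}" by (simp add: zeta_domain_def)
  show "(zeta_reg \<longlongrightarrow> zeta_reg z) (at z within {s. Re s > 0})" if "z \<in> {1}" for z
  proof -
    obtain C where C: "\<And>s. Re s \<ge> 1/2 \<Longrightarrow> norm (zeta_reg s - 1) \<le> C * norm (s - 1) * norm s"
      using zeta_reg_bound[of "1/2"] by auto
    have "((\<lambda>s. zeta_reg s - 1) \<longlongrightarrow> 0) (at 1)"
    proof (rule Lim_null_comparison)
      have "eventually (\<lambda>s::complex. s \<in> {s. Re s > 1/2}) (at 1)"
        by (rule eventually_at_in_open'[OF open_halfspace_Re_gt]) simp
      thus "eventually (\<lambda>s. norm (zeta_reg s - 1) \<le> C * norm (s - 1) * norm s) (at 1)"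
        by (rule eventually_mono) (auto intro: C)
      show "((\<lambda>s::complex. C * norm (s - 1) * norm s) \<longlongrightarrow> 0) (at 1)"
        by (auto intro!: tendsto_eq_intros)
    qed
    hence "(zeta_reg \<longlongrightarrow> 1) (at 1)" by (simp add: LIM_zero_iff)
    thus ?thesis using that by (auto simp: zeta_reg_def intro: tendsto_within_subset)
  qed
qed (auto simp: open_halfspace_Re_gt)

lemma zeta_reg_eq_0_iff: "zeta_reg s = 0 \<longleftrightarrow> s \<noteq> 1 \<and> zeta s = 0"
  by (simp add: zeta_reg_def)

lemma summable_ln_powr:
  assumes "\<sigma> > 1" shows "summable (\<lambda>n::nat. ln (real n) * real n powr (- \<sigma>))"
proof -
  define e where "e = (\<sigma> - 1) / 2"
  have e: "e > 0" "e - \<sigma> < -1" using assms by (simp_all add: e_def field_simps)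
  show ?thesis
  proof (rule summable_comparison_test')
    show "summable (\<lambda>n::nat. 1 / e * real n powr (e - \<sigma>))"
      by (intro summable_mult) (use e in \<open>simp add: summable_real_powr_iff\<close>)
    show "norm (ln (real n) * real n powr (- \<sigma>)) \<le> 1 / e * real n powr (e - \<sigma>)" if "n \<ge> 1" for n
    proof -
      have "ln (real n) \<le> real n powr e / e" using that e by (intro ln_powr_bound) auto
      hence "ln (real n) * real n powr (- \<sigma>) \<le> real n powr e / e * real n powr (- \<sigma>)"
        by (intro mult_right_mono) auto
      also have "\<dots> = 1 / e * real n powr (e - \<sigma>)"
        by (simp add: powr_diff powr_minus divide_simps)
      finally show ?thesis using that by (simp add: abs_mult)
    qed
  qed
qed

lemma norm_nat_powr: "norm (of_nat n powr (- s) :: complex) = real n powr (- Re s)"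
  by (cases "n = 0") (auto simp: norm_powr_real_powr)

lemma abs_summable_zeta:
  assumes "Re s > 1" shows "(\<lambda>n::nat. norm (of_nat n powr (- s) :: complex)) summable_on UNIV"
  unfolding norm_nat_powr using assms
  by (subst summable_on_UNIV_nonneg_real_iff) (auto simp: summable_real_powr_iff)

lemma abs_summable_mangoldt:
  assumes "Re s > 1" shows "(\<lambda>n::nat. norm (mangoldt n * of_nat n powr (- s) :: complex)) summable_on UNIV"
proof -
  have "summable (\<lambda>n. mangoldt n * real n powr (- Re s))"
    using mangoldt_nonneg mangoldt_le
    by (intro summable_comparison_test'[OF summable_ln_powr[OF assms], of 1])
       (auto simp: abs_mult intro!: mult_right_mono)
  thus ?thesis unfolding norm_mult norm_nat_powr norm_mangoldt
    by (subst summable_on_UNIV_nonneg_real_iff) (auto intro!: mult_nonneg_nonneg mangoldt_nonneg)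
qed

lemma zeta_has_sum:
  assumes "Re s > 1" shows "((\<lambda>n::nat. of_nat n powr (- s)) has_sum zeta s) UNIV"
proof -
  have "(\<lambda>n. of_nat (Suc n) powr (- s)) sums zeta s" using is_zeta_zeta assms by (simp add: is_zeta_def)
  hence "(\<lambda>n. of_nat n powr (- s)) sums zeta s" by (subst (asm) sums_Suc_iff) simp
  moreover have "summable (\<lambda>n::nat. norm (of_nat n powr (- s) :: complex))"
    unfolding norm_nat_powr using assms by (simp add: summable_real_powr_iff)
  ultimately show ?thesis by (rule norm_summable_imp_has_sum[rotated])
qed

lemma zeta_deriv_has_sum:
  assumes s: "Re s > 1"
  shows "((\<lambda>n::nat. of_real (ln (real n)) * of_nat n powr (- s)) has_sum - deriv zeta s) UNIV"
proof -
  define S where "S = {s. Re s > 1}"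
  have S: "open S" by (simp add: S_def open_halfspace_Re_gt)
  have "\<exists>g g'. \<forall>x \<in> S. ((\<lambda>n::nat. of_nat n powr (- x)) sums g x) \<and>
     ((\<lambda>n. - of_real (ln (real n)) * of_nat n powr (- x)) sums g' x) \<and> (g has_field_derivative g' x) (at x)"
  proof (rule series_and_derivative_comparison_local[OF S])
    show "((\<lambda>s::complex. of_nat n powr (- s)) has_field_derivative - of_real (ln (real n)) * of_nat n powr (- x)) (at x)"
      for n x
    proof (cases "n = 0")
      case False
      have "((\<lambda>s::complex. of_nat n powr (- s)) has_field_derivative
              (Ln (of_nat n) * of_nat n powr (- x)) * (-1)) (at x)"
        using False
        by (intro DERIV_chain2[OF has_field_derivative_powr_right]) (auto intro!: derivative_eq_intros)
      thus ?thesis using False by (simp add: Ln_of_nat)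
    qed auto
    show "\<exists>d h. 0 < d \<and> summable h \<and>
            (\<forall>\<^sub>F n in sequentially. \<forall>y\<in>ball x d \<inter> S. norm (of_nat n powr (- y) :: complex) \<le> h n)"
      if "x \<in> S" for x
    proof -
      define d where "d = (Re x - 1) / 2"
      have d: "d > 0" "1 + d = Re x - d" using that by (auto simp: d_def S_def field_simps)
      have "norm (of_nat n powr (- y) :: complex) \<le> real n powr (- (1 + d))"
        if "y \<in> ball x d" "n \<ge> 1" for y and n :: nat
      proof -
        have "\<bar>Re (x - y)\<bar> < d" using that abs_Re_le_cmod[of "x - y"] by (simp add: dist_norm)
        hence "Re y \<ge> 1 + d" using d by (simp add: abs_less_iff)
        thus ?thesis unfolding norm_nat_powr using that by (intro powr_mono) auto
      qed
      hence "\<forall>\<^sub>F n in sequentially. \<forall>y\<in>ball x d \<inter> S. norm (of_nat n powr (- y) :: complex) \<le> real n powr (- (1 + d))"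
        by (intro eventually_mono[OF eventually_ge_at_top[of 1]]) auto
      moreover have "summable (\<lambda>n. real n powr (- (1 + d)))" using d by (simp add: summable_real_powr_iff)
      ultimately show ?thesis using d by blast
    qed
  qed
  then obtain g g' where g: "\<And>x. x \<in> S \<Longrightarrow> (\<lambda>n::nat. of_nat n powr (- x)) sums g x"
     "\<And>x. x \<in> S \<Longrightarrow> (\<lambda>n. - of_real (ln (real n)) * of_nat n powr (- x)) sums g' x"
     "\<And>x. x \<in> S \<Longrightarrow> (g has_field_derivative g' x) (at x)" by blast
  have "g x = zeta x" if "x \<in> S" for x
    using sums_unique2[OF g(1)[OF that] has_sum_imp_sums[OF zeta_has_sum]] that by (simp add: S_def)
  moreover have sS: "s \<in> S" using s by (simp add: S_def)
  ultimately have "(zeta has_field_derivative g' s) (at s)"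
    using has_field_derivative_transform_within_open[OF g(3)[OF sS] S sS] by blast
  hence "deriv zeta s = g' s" by (rule DERIV_imp_deriv)
  hence "(\<lambda>n. of_real (ln (real n)) * of_nat n powr (- s)) sums - deriv zeta s"
    using sums_minus[OF g(2)[OF sS]] by simp
  moreover have "summable (\<lambda>n::nat. norm (of_real (ln (real n)) * of_nat n powr (- s) :: complex))"
    unfolding norm_mult norm_nat_powr norm_of_real
    by (rule summable_comparison_test'[OF summable_ln_powr[OF s], of 1]) (auto simp: abs_mult)
  ultimately show ?thesis by (rule norm_summable_imp_has_sum[rotated])
qed

definition mangoldt_series :: "complex \<Rightarrow> complex" where
  "mangoldt_series s = (\<Sum>\<^sub>\<infinity>n::nat. mangoldt n * of_nat n powr (- s))"

lemma mangoldt_series_has_sum: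
  "Re s > 1 \<Longrightarrow> ((\<lambda>n::nat. mangoldt n * of_nat n powr (- s)) has_sum mangoldt_series s) UNIV"
  unfolding mangoldt_series_def using abs_summable_mangoldt[of s]
  by (intro has_sum_infsum) (rule Infinite_Sum.abs_summable_summable)

text \<open>
  Both series converge absolutely, so their product is a sum over pairs \<open>(d, m)\<close>. Grouping it by
  \<open>n = d * m\<close> leaves the divisor sum of the von Mangoldt function, which is \<open>ln n\<close>.
\<close>

lemma mangoldt_series_times_zeta:
  assumes s: "Re s > 1"
  shows "mangoldt_series s * zeta s = - deriv zeta s"
proof -
  define f where "f = (\<lambda>(d,m). mangoldt d * of_nat d powr (- s) * of_nat m powr (- s) :: complex)"
  \<comment> \<open>The index 0 carries the value \<open>0 powr _ = 0\<close>; without it every divisor sum below is finite.\<close>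
  have one: "(g has_sum x) UNIV \<longleftrightarrow> (g has_sum x) {1..}" if "g 0 = 0" for g :: "nat \<Rightarrow> complex" and x
    by (rule has_sum_cong_neutral) (use that in \<open>auto simp: not_less_eq_eq\<close>)
  have A: "((\<lambda>n::nat. mangoldt n * of_nat n powr (- s)) has_sum mangoldt_series s) {1..}"
    using mangoldt_series_has_sum[OF s] by (subst (asm) one) auto
  have B: "((\<lambda>n::nat. of_nat n powr (- s)) has_sum zeta s) {1..}"
    using zeta_has_sum[OF s] by (subst (asm) one) auto
  have "(\<lambda>p. norm (f p)) summable_on ({1..} \<times> {1..})"
    unfolding Infinite_Sum.abs_summable_on_Sigma_iff f_def
    using summable_on_subset_banach[OF abs_summable_zeta[OF s], of "{1..}"]
      summable_on_subset_banach[OF abs_summable_mangoldt[OF s], of "{1..}"]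
    by (auto simp: norm_mult infsum_cmult_right' abs_mult infsum_nonneg
             intro!: summable_on_cmult_right summable_on_cmult_left)
  hence sm: "f summable_on ({1..} \<times> {1..})" by (rule Infinite_Sum.abs_summable_summable)
  have 1: "(f has_sum (mangoldt_series s * zeta s)) ({1..} \<times> {1..})"
  proof (rule has_sum_SigmaI[OF _ has_sum_cmult_left[OF A] sm])
    show "((\<lambda>y. f (x, y)) has_sum mangoldt x * of_nat x powr (- s) * zeta s) {1..}" for x
      unfolding f_def prod.case by (rule has_sum_cmult_right[OF B])
  qed
  define h where "h = (\<lambda>(n,d). mangoldt d * of_nat n powr (- s) :: complex)"
  have "(f has_sum (mangoldt_series s * zeta s)) ({1..} \<times> {1..}) \<longleftrightarrow>
        (h has_sum (mangoldt_series s * zeta s)) (Sigma {1..} (\<lambda>n. {d. d dvd n}))"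
  proof (rule has_sum_reindex_bij_witness[where j = "\<lambda>(d,m). (d * m, d)" and i = "\<lambda>(n,d). (d, n div d)"])
    show "h (case a of (d, m) \<Rightarrow> (d * m, d)) = f a" if "a \<in> {1..} \<times> {1..}" for a
      using that by (auto simp: h_def f_def powr_times_real of_nat_mult)
  qed (auto simp: Suc_le_eq dvd_def intro!: Nat.gr0I)
  hence 2: "(h has_sum (mangoldt_series s * zeta s)) (Sigma {1..} (\<lambda>n. {d. d dvd n}))" using 1 by simp
  have "((\<lambda>n. of_real (ln (real n)) * of_nat n powr (- s)) has_sum (mangoldt_series s * zeta s)) {1..}"
  proof (rule has_sum_SigmaD[OF 2])
    fix n :: nat assume n: "n \<in> {1..}"
    hence fin: "finite {d. d dvd n}" by auto
    have "(\<Sum>d | d dvd n. h (n, d)) = of_real (ln (real n)) * of_nat n powr (- s)"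
      using n by (simp add: h_def flip: sum_distrib_right mangoldt_sum)
    thus "((\<lambda>y. h (n, y)) has_sum of_real (ln (real n)) * of_nat n powr (- s)) {d. d dvd n}"
      using has_sum_finite[OF fin, of "\<lambda>d. h (n, d)"] by simp
  qed
  hence "((\<lambda>n. of_real (ln (real n)) * of_nat n powr (- s)) has_sum (mangoldt_series s * zeta s)) UNIV"
    by (subst one) auto
  thus ?thesis using zeta_deriv_has_sum[OF s] by (rule has_sum_unique)
qed

text \<open>
  Writing \<open>f s = (s - s0) ^ n * g s\<close> with \<open>g s0 \<noteq> 0\<close> shows that the residue of \<open>f' / f\<close> is the order
  \<open>n\<close> of the zero, and 0 at a point where \<open>f\<close> does not vanish.
\<close>

lemma logderiv_residue_at_zero:
  fixes f :: "complex \<Rightarrow> complex"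
  assumes hol: "f holomorphic_on S" and S: "open S" "connected S" and s0: "s0 \<in> S"
    and nz: "w \<in> S" "f w \<noteq> 0"
  obtains n :: nat where "((\<lambda>s. (s - s0) * (deriv f s / f s)) \<longlongrightarrow> of_nat n) (at s0)"
    "n = 0 \<longleftrightarrow> f s0 \<noteq> 0" "eventually (\<lambda>s. f s \<noteq> 0) (at s0)"
proof (cases "f s0 = 0")
  case False
  have cont: "isCont f s0" using holomorphic_on_imp_continuous_on[OF hol] s0
    by (simp add: continuous_on_eq_continuous_at[OF S(1)])
  have cont': "isCont (deriv f) s0"
    using holomorphic_on_imp_continuous_on[OF holomorphic_deriv[OF hol S(1)]] s0
    by (simp add: continuous_on_eq_continuous_at[OF S(1)])
  have "((\<lambda>s. (s - s0) * (deriv f s / f s)) \<longlongrightarrow> (s0 - s0) * (deriv f s0 / f s0)) (at s0)"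
    using cont cont' False unfolding isCont_def by (intro tendsto_intros)
  moreover have "eventually (\<lambda>s. f s \<noteq> 0) (at s0)"
    using cont False unfolding isCont_def by (rule tendsto_imp_eventually_ne)
  ultimately show ?thesis using that[of 0] False by simp
next
  case True
  have "\<not> f constant_on S" using True nz s0 unfolding constant_on_def by metis
  from holomorphic_factor_zero_nonconstant[OF hol S s0 True this]
  obtain g r n where g: "0 < n" "0 < r" "ball s0 r \<subseteq> S" "g holomorphic_on ball s0 r"
     "\<And>w. w \<in> ball s0 r \<Longrightarrow> f w = (w - s0)^n * g w" "\<And>w. w \<in> ball s0 r \<Longrightarrow> g w \<noteq> 0"
    by metis
  have ev: "eventually (\<lambda>s. s \<in> ball s0 r - {s0}) (at s0)"
    using g(2) by (intro eventually_at_in_open) auto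
  have eq: "(s - s0) * (deriv f s / f s) = of_nat n + (s - s0) * (deriv g s / g s)"
    if "s \<in> ball s0 r - {s0}" for s
  proof -
    have s: "s \<in> ball s0 r" "s - s0 \<noteq> 0" using that by auto
    have dg: "(g has_field_derivative deriv g s) (at s)" using g(4) s by (simp add: holomorphic_derivI)
    have "((\<lambda>w. (w - s0)^n * g w) has_field_derivative
        of_nat n * (s - s0) ^ (n - 1) * g s + (s - s0) ^ n * deriv g s) (at s)"
      by (auto intro!: derivative_eq_intros dg simp: algebra_simps)
    hence "(f has_field_derivative of_nat n * (s - s0) ^ (n - 1) * g s + (s - s0) ^ n * deriv g s) (at s)"
      by (rule has_field_derivative_transform_within_open[OF _ open_ball s(1)]) (simp add: g(5))
    hence "deriv f s = of_nat n * (s - s0) ^ (n - 1) * g s + (s - s0) ^ n * deriv g s"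
      by (rule DERIV_imp_deriv)
    moreover have "(s - s0) ^ n = (s - s0) * (s - s0) ^ (n - 1)" using g(1) by (cases n) auto
    moreover have "x * ((k * p * y + x * p * y') / (x * p * y)) = k + x * (y' / y)"
      if "x \<noteq> 0" "p \<noteq> 0" "y \<noteq> 0" for x p y y' k :: complex
      using that by (simp add: field_simps)
    ultimately show ?thesis using s g(6)[OF s(1)] by (simp add: g(5)[OF s(1)])
  qed
  have c0: "s0 \<in> ball s0 r" using g(2) by simp
  have cont: "isCont g s0" using holomorphic_on_imp_continuous_on[OF g(4)] c0
    by (simp only: continuous_on_eq_continuous_at[OF open_ball])
  have cont': "isCont (deriv g) s0"
    using holomorphic_on_imp_continuous_on[OF holomorphic_deriv[OF g(4) open_ball]] c0
    by (simp only: continuous_on_eq_continuous_at[OF open_ball])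
  have "((\<lambda>s. of_nat n + (s - s0) * (deriv g s / g s)) \<longlongrightarrow> of_nat n + (s0 - s0) * (deriv g s0 / g s0)) (at s0)"
    using cont cont' g(6)[OF c0] unfolding isCont_def by (intro tendsto_intros)
  hence "((\<lambda>s. (s - s0) * (deriv f s / f s)) \<longlongrightarrow> of_nat n) (at s0)"
    by (subst tendsto_cong[OF eventually_mono[OF ev eq]]) auto
  moreover have "eventually (\<lambda>s. f s \<noteq> 0) (at s0)"
    by (rule eventually_mono[OF ev]) (use g in auto)
  ultimately show ?thesis using that[of n] True g(1) by simp
qed

text \<open>
  The simple pole of the Dirichlet series at 1 appears explicitly and cancels against that of
  \<open>1 / (s - 1)\<close>.
\<close>

lemma zeta_reg_logderiv_eq:
  assumes s: "Re s > 1" and nz: "zeta s \<noteq> 0"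
  shows "zeta_logderiv s = 1 / (s - 1) - mangoldt_series s"
proof -
  have s1: "s \<noteq> 1" "s \<in> zeta_domain" using s by (auto simp: zeta_domain_def)
  have dz: "(zeta has_field_derivative deriv zeta s) (at s)"
    using is_zeta_zeta s1 unfolding is_zeta_def by (auto intro: holomorphic_derivI open_zeta_domain)
  have "((\<lambda>s. (s - 1) * zeta s) has_field_derivative zeta s + (s - 1) * deriv zeta s) (at s)"
    by (auto intro!: derivative_eq_intros dz)
  hence "(zeta_reg has_field_derivative zeta s + (s - 1) * deriv zeta s) (at s)"
    by (rule has_field_derivative_transform_within_open[OF _ open_zeta_domain s1(2)])
       (auto simp: zeta_reg_def zeta_domain_def)
  hence "deriv zeta_reg s = zeta s + (s - 1) * deriv zeta s" by (rule DERIV_imp_deriv)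
  moreover have "deriv zeta s = - mangoldt_series s * zeta s" using mangoldt_series_times_zeta[OF s] by simp
  ultimately have "deriv zeta_reg s = zeta s * (1 - (s - 1) * mangoldt_series s)"
    by (simp add: algebra_simps)
  thus ?thesis using s1 nz by (simp add: zeta_reg_def diff_divide_distrib)
qed

text \<open>
  The terms \<open>1 / n\<^sup>2\<close> with \<open>n \<ge> 2\<close> are at most \<open>1 / (n - 1/2) - 1 / (n + 1/2)\<close>, and these
  differences add up to \<open>2 / 3\<close>. They cannot cancel the first term 1.
\<close>

lemma zeta_lower_bound_2_line:
  assumes s: "Re s = 2" shows "norm (zeta s) \<ge> 1 / 3"
proof -
  define g where "g = (\<lambda>n. - 1 / (real n + 3 / 2))"
  have "(\<lambda>n. of_nat (Suc n) powr (- s)) sums zeta s" using is_zeta_zeta s by (simp add: is_zeta_def)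
  hence 1: "(\<lambda>n. of_nat (Suc (Suc n)) powr (- s)) sums (zeta s - 1)" by (subst sums_Suc_iff) simp
  have "g \<longlonglongrightarrow> 0" unfolding g_def by real_asymp
  hence 2: "(\<lambda>n. g (Suc n) - g n) sums (0 - g 0)" by (rule telescope_sums)
  have "norm (zeta s - 1) \<le> 0 - g 0"
  proof (rule norm_sums_le[OF 1 2])
    fix n
    have "norm (of_nat (Suc (Suc n)) powr (- s) :: complex) = 1 / (real n + 2)\<^sup>2"
      unfolding norm_nat_powr s by (simp add: powr_minus powr_numeral field_simps)
    also have "\<dots> \<le> 1 / ((real n + 3 / 2) * (real n + 5 / 2))"
    proof -
      have "(real n + 3 / 2) * (real n + 5 / 2) \<le> (real n + 2)\<^sup>2"
        by (simp add: power2_eq_square algebra_simps)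
      thus ?thesis by (intro divide_left_mono mult_pos_pos zero_less_power) auto
    qed
    also have "\<dots> = g (Suc n) - g n"
    proof -
      have "1 / (x * (x + 1)) = - 1 / (x + 1) - (- 1 / x)" if "x > 0" for x :: real
        using that by (simp add: field_simps)
      from this[of "real n + 3 / 2"] show ?thesis by (simp add: g_def algebra_simps)
    qed
    finally show "norm (of_nat (Suc (Suc n)) powr (- s) :: complex) \<le> g (Suc n) - g n" .
  qed
  hence "norm (1 - zeta s) \<le> 2 / 3" by (simp add: g_def norm_minus_commute)
  thus ?thesis using norm_triangle_ineq2[of 1 "1 - zeta s"] by simp
qed

lemma zeta_reg_at_1: "zeta_reg 1 = 1"
  by (simp add: zeta_reg_def)

lemma Re_mangoldt_series_sums:
  assumes "Re s > 1"
  shows "(\<lambda>n::nat. mangoldt n * real n powr (- Re s) * cos (Im s * ln (real n))) sums Re (mangoldt_series s)"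
proof -
  have "(\<lambda>n::nat. Re (mangoldt n * of_nat n powr (- s))) sums Re (mangoldt_series s)"
    using has_sum_imp_sums[OF mangoldt_series_has_sum[OF assms]] by (rule sums_Re)
  moreover have "Re (mangoldt n * of_nat n powr (- s)) = mangoldt n * real n powr (- Re s) * cos (Im s * ln (real n))"
    for n :: nat
  proof (cases "n = 0")
    case False
    have "(mangoldt n * of_nat n powr (- s) :: complex) = of_real (mangoldt n) * exp (- s * of_real (ln (real n)))"
      using False by (simp add: powr_def Ln_of_nat)
    also have "Re \<dots> = mangoldt n * Re (exp (- s * of_real (ln (real n))))" by simp
    also have "Re (exp (- s * of_real (ln (real n)))) = real n powr (- Re s) * cos (Im s * ln (real n))"
      using False by (simp add: Re_exp powr_def)
    finally show ?thesis by simp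
  qed simp
  ultimately show ?thesis by (simp only:)
qed

lemma norm_mangoldt_series_le:
  assumes "Re s \<ge> \<sigma>" "\<sigma> > 1"
  shows "norm (mangoldt_series s) \<le> Re (mangoldt_series (of_real \<sigma>))"
proof (rule norm_sums_le)
  show "(\<lambda>n::nat. mangoldt n * of_nat n powr (- s)) sums mangoldt_series s"
    by (rule has_sum_imp_sums[OF mangoldt_series_has_sum]) (use assms in auto)
  show "(\<lambda>n::nat. mangoldt n * real n powr (- \<sigma>)) sums Re (mangoldt_series (of_real \<sigma>))"
    using Re_mangoldt_series_sums[of "of_real \<sigma>"] assms by simp
  show "norm (mangoldt n * of_nat n powr (- s) :: complex) \<le> mangoldt n * real n powr (- \<sigma>)" for n
  proof (cases "n = 0")
    case False
    thus ?thesis unfolding norm_mult norm_nat_powr norm_mangoldt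
      using assms by (intro mult_left_mono powr_mono) (auto simp: mangoldt_nonneg)
  qed simp
qed

text \<open>
  The coefficients \<open>3 + 4 cos x + cos 2x = 2 (1 + cos x)\<^sup>2\<close> are non-negative, and so is the von Mangoldt
  function.
\<close>

lemma Re_mangoldt_series_mertens:
  assumes "\<sigma> > 1"
  shows "3 * Re (mangoldt_series (of_real \<sigma>)) + 4 * Re (mangoldt_series (Complex \<sigma> t))
         + Re (mangoldt_series (Complex \<sigma> (2 * t))) \<ge> 0"
proof -
  have "(\<lambda>n::nat. 3 * (mangoldt n * real n powr (- \<sigma>)) + 4 * (mangoldt n * real n powr (- \<sigma>) * cos (t * ln (real n)))
      + mangoldt n * real n powr (- \<sigma>) * cos (2 * t * ln (real n))) sums 
      (3 * Re (mangoldt_series (of_real \<sigma>)) + 4 * Re (mangoldt_series (Complex \<sigma> t))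
         + Re (mangoldt_series (Complex \<sigma> (2 * t))))" (is "?f sums _")
    using Re_mangoldt_series_sums[of "of_real \<sigma>"] Re_mangoldt_series_sums[of "Complex \<sigma> t"]
      Re_mangoldt_series_sums[of "Complex \<sigma> (2 * t)"] assms
    by (intro sums_add sums_mult) simp_all
  moreover have "?f n \<ge> 0" for n
  proof -
    define x where "x = t * ln (real n)"
    have "?f n = mangoldt n * real n powr (- \<sigma>) * (3 + 4 * cos x + cos (2 * x))"
      by (simp add: x_def algebra_simps)
    also have "3 + 4 * cos x + cos (2 * x) = 2 * (1 + cos x)\<^sup>2"
      unfolding cos_double_cos by (simp add: power2_eq_square algebra_simps)
    finally show ?thesis by (simp add: mangoldt_nonneg)
  qed
  ultimately show ?thesis using sums_le[of "\<lambda>_. 0" ?f 0] sums_zero by blast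
qed

lemma zeta_reg_logderiv_residue:
  assumes "Re s0 > 0"
  obtains n :: nat where "((\<lambda>s. (s - s0) * zeta_logderiv s) \<longlongrightarrow> of_nat n) (at s0)"
    "n = 0 \<longleftrightarrow> zeta_reg s0 \<noteq> 0" "eventually (\<lambda>s. zeta_reg s \<noteq> 0) (at s0)"
proof (rule logderiv_residue_at_zero[OF zeta_reg_holomorphic])
  show "connected {s. Re s > 0}" by (intro convex_connected convex_halfspace_Re_gt)
  show "zeta_reg 1 \<noteq> 0" by (simp add: zeta_reg_at_1)
qed (use assms that in \<open>auto intro: open_halfspace_Re_gt\<close>)

text \<open>
  At a zero the function \<open>zeta_logderiv\<close> would have a pole, but it equals \<open>1 / (s - 1)\<close> minus the
  Dirichlet series, which stays bounded near every point with \<open>Re s > 1\<close>.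
\<close>

lemma zeta_nonzero_right:
  assumes s0: "Re s0 > 1" shows "zeta s0 \<noteq> 0"
proof -
  obtain n :: nat where n: "((\<lambda>s. (s - s0) * zeta_logderiv s) \<longlongrightarrow> of_nat n) (at s0)"
    "n = 0 \<longleftrightarrow> zeta_reg s0 \<noteq> 0" "eventually (\<lambda>s. zeta_reg s \<noteq> 0) (at s0)"
    using zeta_reg_logderiv_residue[of s0] s0 by auto
  define \<sigma> where "\<sigma> = (1 + Re s0) / 2"
  have \<sigma>: "1 < \<sigma>" "\<sigma> < Re s0" using s0 by (auto simp: \<sigma>_def)
  define K where "K = 1 / (\<sigma> - 1) + Re (mangoldt_series (of_real \<sigma>))"
  have ev: "eventually (\<lambda>s. s \<in> {s. Re s > \<sigma>}) (at s0)"
    by (rule eventually_at_in_open'[OF open_halfspace_Re_gt]) (use \<sigma> in simp)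
  have "((\<lambda>s. (s - s0) * zeta_logderiv s) \<longlongrightarrow> 0) (at s0)"
  proof (rule Lim_null_comparison)
    show "eventually (\<lambda>s. norm ((s - s0) * zeta_logderiv s) \<le> norm (s - s0) * K) (at s0)"
      using ev n(3)
    proof eventually_elim
      case (elim s)
      have s: "Re s > 1" "zeta s \<noteq> 0" using elim \<sigma> by (auto simp: zeta_reg_eq_0_iff)
      have "Re (s - 1) \<le> norm (s - 1)" by (rule complex_Re_le_cmod)
      hence "norm (s - 1) \<ge> \<sigma> - 1" using elim by simp
      hence "norm (1 / (s - 1)) \<le> 1 / (\<sigma> - 1)" using \<sigma> by (simp add: norm_divide frac_le)
      moreover have "norm (mangoldt_series s) \<le> Re (mangoldt_series (of_real \<sigma>))"
        using elim \<sigma> by (intro norm_mangoldt_series_le) auto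
      ultimately have "norm (1 / (s - 1) - mangoldt_series s) \<le> K"
        unfolding K_def using norm_triangle_ineq4 order_trans add_mono by metis
      thus ?case unfolding zeta_reg_logderiv_eq[OF s] norm_mult by (intro mult_left_mono) auto
    qed
    show "((\<lambda>s. norm (s - s0) * K) \<longlongrightarrow> 0) (at s0)" by (auto intro!: tendsto_eq_intros)
  qed
  hence "n = 0" using tendsto_unique[OF _ n(1)] by force
  thus ?thesis using n(2) s0 by (auto simp: zeta_reg_eq_0_iff)
qed

text \<open>
  As \<open>\<sigma>\<close> tends to 1 from the right, the real part of the Dirichlet series behaves like
  \<open>1 / (\<sigma> - 1)\<close> times the order of
  the pole of \<open>zeta\<close> at \<open>1 + \<i> t\<close> minus the order of its zero there.
\<close>

lemma mangoldt_series_residue: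
  obtains n :: nat where
    "((\<lambda>\<sigma>. (\<sigma> - 1) * Re (mangoldt_series (Complex \<sigma> t))) \<longlongrightarrow> (if t = 0 then 1 else 0) - real n) (at_right 1)"
    "n = 0 \<longleftrightarrow> zeta_reg (Complex 1 t) \<noteq> 0"
proof -
  define s0 where "s0 = Complex 1 t"
  obtain n :: nat where n: "((\<lambda>s. (s - s0) * zeta_logderiv s) \<longlongrightarrow> of_nat n) (at s0)"
    "n = 0 \<longleftrightarrow> zeta_reg s0 \<noteq> 0"
    using zeta_reg_logderiv_residue[of s0] by (auto simp: s0_def)
  have "filterlim (\<lambda>\<sigma>. Complex \<sigma> t) (at s0) (at_right 1)"
    unfolding filterlim_at s0_def
    by (auto intro!: tendsto_intros eventually_mono[OF eventually_at_right_less[of 1]] simp: tendsto_complex_iff)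
  note lim = filterlim_compose[OF n(1) this]
  have "((\<lambda>\<sigma>::real. of_real (\<sigma> - 1) / (of_real \<sigma> - 1 + \<i> * of_real t)) \<longlongrightarrow> (if t = 0 then 1 else 0)) (at_right 1)"
  proof (cases "t = 0")
    case True
    have "eventually (\<lambda>\<sigma>::real. of_real (\<sigma> - 1) / (of_real \<sigma> - 1 + \<i> * of_real t) = 1) (at_right 1)"
      using eventually_at_right_less[of 1] by eventually_elim (auto simp: True)
    thus ?thesis using True by (simp add: tendsto_eventually)
  next
    case False
    have "((\<lambda>\<sigma>::real. of_real (\<sigma> - 1) / (of_real \<sigma> - 1 + \<i> * of_real t)) \<longlongrightarrow> 0) (at_right 1)"
      using False by (auto intro!: tendsto_eq_intros)
    thus ?thesis using False by simp
  qed
  from tendsto_diff[OF this lim]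
  have "((\<lambda>\<sigma>::real. of_real (\<sigma> - 1) / (of_real \<sigma> - 1 + \<i> * of_real t) - 
     (Complex \<sigma> t - s0) * zeta_logderiv (Complex \<sigma> t)) \<longlongrightarrow>
       (if t = 0 then 1 else 0) - of_nat n) (at_right 1)" .
  moreover have "eventually (\<lambda>\<sigma>. of_real (\<sigma> - 1) / (of_real \<sigma> - 1 + \<i> * of_real t) - 
     (Complex \<sigma> t - s0) * zeta_logderiv (Complex \<sigma> t) =
       of_real (\<sigma> - 1) * mangoldt_series (Complex \<sigma> t)) (at_right 1)"
    using eventually_at_right_less[of 1]
  proof eventually_elim
    case (elim \<sigma>)
    have c: "Complex \<sigma> t = of_real \<sigma> + \<i> * of_real t" by (simp add: complex_eq_iff)
    have d: "Complex \<sigma> t - s0 = of_real (\<sigma> - 1)" by (simp add: complex_eq_iff s0_def)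
    have "zeta (Complex \<sigma> t) \<noteq> 0" using zeta_nonzero_right elim by simp
    thus ?case using elim unfolding d by (subst zeta_reg_logderiv_eq) (auto simp: c algebra_simps)
  qed
  ultimately have "((\<lambda>\<sigma>. of_real (\<sigma> - 1) * mangoldt_series (Complex \<sigma> t)) \<longlongrightarrow>
       (if t = 0 then 1 else 0) - of_nat n) (at_right 1)"
    by (subst (asm) tendsto_cong)
  from tendsto_Re[OF this]
  have "((\<lambda>\<sigma>. (\<sigma> - 1) * Re (mangoldt_series (Complex \<sigma> t))) \<longlongrightarrow> (if t = 0 then 1 else 0) - real n) (at_right 1)"
    by (cases "t = 0") simp_all
  thus ?thesis using n(2) that by (simp add: s0_def)
qed

text \<open>
  If \<open>1 + \<i> t\<close> is a zero of order \<open>n \<ge> 1\<close> and \<open>1 + 2 \<i> t\<close> one of order \<open>m \<ge> 0\<close>, then \<open>\<sigma> - 1\<close> times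
  the Mertens combination tends to \<open>3 - 4 n - m < 0\<close>, although it is never negative.
\<close>

lemma zeta_nonzero_1_line:
  assumes "Re s = 1" "s \<noteq> 1" shows "zeta s \<noteq> 0"
proof
  assume z: "zeta s = 0"
  define t where "t = Im s"
  have s: "s = Complex 1 t" using assms by (simp add: t_def complex_eq_iff)
  have t: "t \<noteq> 0" using assms by (auto simp: s complex_eq_iff)
  obtain m :: nat where m:
    "((\<lambda>\<sigma>. (\<sigma> - 1) * Re (mangoldt_series (Complex \<sigma> (2 * t)))) \<longlongrightarrow> (if 2 * t = 0 then 1 else 0) - real m) (at_right 1)"
    by (rule mangoldt_series_residue)
  obtain n :: nat where n:
    "((\<lambda>\<sigma>. (\<sigma> - 1) * Re (mangoldt_series (Complex \<sigma> t))) \<longlongrightarrow> (if t = 0 then 1 else 0) - real n) (at_right 1)"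
    "n = 0 \<longleftrightarrow> zeta_reg (Complex 1 t) \<noteq> 0"
    by (rule mangoldt_series_residue)
  have "zeta_reg (Complex 1 t) = 0" using z assms(2) unfolding s[symmetric] zeta_reg_eq_0_iff by simp
  hence n0: "n \<noteq> 0" using n(2) by simp
  obtain k :: nat where k:
    "((\<lambda>\<sigma>. (\<sigma> - 1) * Re (mangoldt_series (Complex \<sigma> 0))) \<longlongrightarrow> (if (0::real) = 0 then 1 else 0) - real k) (at_right 1)"
    "k = 0 \<longleftrightarrow> zeta_reg (Complex 1 0) \<noteq> 0"
    by (rule mangoldt_series_residue)
  have "Complex 1 0 = 1" by (simp add: complex_eq_iff)
  hence k0: "k = 0" using k(2) zeta_reg_at_1 by simp
  have "((\<lambda>\<sigma>. 3 * ((\<sigma> - 1) * Re (mangoldt_series (Complex \<sigma> 0))) + 4 * ((\<sigma> - 1) * Re (mangoldt_series (Complex \<sigma> t)))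
       + (\<sigma> - 1) * Re (mangoldt_series (Complex \<sigma> (2 * t)))) \<longlongrightarrow>
       3 * ((if (0::real) = 0 then 1 else 0) - real k) + 4 * ((if t = 0 then 1 else 0) - real n)
         + ((if 2 * t = 0 then 1 else 0) - real m)) (at_right 1)"
    by (intro tendsto_add tendsto_mult tendsto_const k(1) n(1) m(1))
  moreover have "eventually (\<lambda>\<sigma>. 3 * ((\<sigma> - 1) * Re (mangoldt_series (Complex \<sigma> 0))) + 
      4 * ((\<sigma> - 1) * Re (mangoldt_series (Complex \<sigma> t)))
       + (\<sigma> - 1) * Re (mangoldt_series (Complex \<sigma> (2 * t))) \<ge> 0) (at_right 1)"
    using eventually_at_right_less[of 1]
  proof eventually_elim
    case (elim \<sigma>)
    have "0 \<le> (\<sigma> - 1) * (3 * Re (mangoldt_series (of_real \<sigma>)) + 4 * Re (mangoldt_series (Complex \<sigma> t))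
         + Re (mangoldt_series (Complex \<sigma> (2 * t))))"
      using elim by (intro mult_nonneg_nonneg Re_mangoldt_series_mertens) auto
    thus ?case by (simp add: algebra_simps complex_of_real_def)
  qed
  ultimately have "0 \<le> 3 * ((if (0::real) = 0 then 1 else 0) - real k) + 4 * ((if t = 0 then 1 else 0) - real n)
         + ((if 2 * t = 0 then 1 else 0) - real m)"
    by (rule tendsto_lowerbound) simp
  hence "4 * real n \<le> 3" using t k0 by simp
  thus False using n0 by simp
qed

section \<open>The logarithmic derivative under the Riemann Hypothesis\<close>

text \<open>
  The hypothesis speaks of the open critical strip. On the line \<open>Re s = 1\<close> and to the right of it the
  non-vanishing is unconditional.
\<close>

lemma RH_zeta_reg_nonzero:
  assumes Riemann_Hypothesis "Re s > 1 / 2"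
  shows "zeta_reg s \<noteq> 0"
proof -
  consider "Re s < 1" | "Re s = 1" | "Re s > 1" by linarith
  thus ?thesis
  proof cases
    case 1
    have "zeta s \<noteq> 0"
    proof
      assume "zeta s = 0"
      hence "Re s = 1 / 2" using 1 assms(2) assms(1)[unfolded Riemann_Hypothesis_def, rule_format, of s] by simp
      thus False using assms(2) by simp
    qed
    thus ?thesis by (simp add: zeta_reg_eq_0_iff)
  qed (use zeta_nonzero_1_line zeta_nonzero_right in \<open>auto simp: zeta_reg_eq_0_iff\<close>)
qed

text \<open>
  For \<open>t = Im s\<close> take concentric discs around \<open>2 + \<i> t\<close> of radii \<open>3/2 < 7/4 < 15/8\<close>. The smallest one
  reaches the critical line, and the largest one stays in \<open>Re s \<ge> 1/8\<close>, where \<open>zeta_reg\<close> grows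
  quadratically, so that the growth exponent is of order \<open>ln (|t| + 4)\<close>. All zeros in question have
  \<open>Re \<rho> \<le> 1/2\<close>, hence distance at least \<open>Re s - 1/2\<close> from \<open>s\<close>.
\<close>

lemma RH_zeta_reg_logderiv_bound:
  assumes RH: Riemann_Hypothesis
  obtains C where "C > 0"
    "\<And>s. 1 / 2 < Re s \<Longrightarrow> Re s \<le> 2 \<Longrightarrow>
       norm (zeta_logderiv s) \<le> C * ln (\<bar>Im s\<bar> + 4) / (Re s - 1 / 2)"
proof -
  obtain K where K: "K > 0" and bound: "\<And>(f :: complex \<Rightarrow> complex) S z0 z M a.
     open S \<Longrightarrow> cball z0 (15/8) \<subseteq> S \<Longrightarrow> f holomorphic_on S \<Longrightarrow> f z0 \<noteq> 0 \<Longrightarrow>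
     (\<forall>w. norm (w - z0) = 15/8 \<longrightarrow> norm (f w) \<le> exp M * norm (f z0)) \<Longrightarrow>
     norm (z - z0) \<le> 3/2 \<Longrightarrow> a > 0 \<Longrightarrow>
     (\<forall>\<rho>. norm (\<rho> - z0) < 7/4 \<longrightarrow> f \<rho> = 0 \<longrightarrow> a \<le> norm (z - \<rho>)) \<Longrightarrow>
     norm (deriv f z / f z) \<le> K * (M + 1) * (1 / a + 1)"
    using logderiv_bound_by_zero_distance[of "3/2" "7/4" "15/8"] by auto
  obtain C1 where C1: "C1 > 0"
    "\<And>s. Re s \<ge> 1/8 \<Longrightarrow> norm (zeta_reg s - 1) \<le> C1 * norm (s - 1) * norm s"
    using zeta_reg_bound[of "1/8"] by auto
  define L where "L = ln (3 * (1 + C1))"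
  have L: "L > 0" using C1(1) by (simp add: L_def)
  have "norm (zeta_logderiv s) \<le> (5 / 2 * K * (L + 3)) * ln (\<bar>Im s\<bar> + 4) / (Re s - 1 / 2)"
    if s: "1 / 2 < Re s" "Re s \<le> 2" for s
  proof -
    define t where "t = Im s"
    define z0 where "z0 = Complex 2 t"
    define T where "T = \<bar>t\<bar> + 4"
    define a where "a = Re s - 1 / 2"
    have a: "a > 0" "a \<le> 3 / 2" using s by (auto simp: a_def)
    have T: "T \<ge> 4" by (simp add: T_def)
    have lnT: "ln T \<ge> 1"
    proof -
      have "exp 1 \<le> T" using T exp_le by linarith
      thus ?thesis using T by (subst ln_ge_iff) auto
    qed
    define M where "M = ln (3 * ((1 + C1) * T\<^sup>2))"
    have M: "M = L + 2 * ln T"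
      unfolding M_def L_def mult.assoc[symmetric]
      using T C1(1) by (subst ln_mult) (auto simp: ln_realpow)
    have eM: "exp M = 3 * ((1 + C1) * T\<^sup>2)" using T C1(1) by (simp add: M_def)
    have near: "1 / 8 \<le> Re w \<and> norm w \<le> T \<and> norm (w - 1) \<le> T" if "norm (w - z0) \<le> 15/8" for w
    proof -
      have "\<bar>Re (w - z0)\<bar> \<le> 15/8" using that abs_Re_le_cmod order_trans by blast
      hence "Re w \<ge> 1 / 8" unfolding z0_def minus_complex.sel complex.sel by linarith
      moreover have "norm z0 \<le> 2 + \<bar>t\<bar>" using cmod_le[of z0] by (simp add: z0_def)
      moreover have "norm (z0 - 1) \<le> 1 + \<bar>t\<bar>" using cmod_le[of "z0 - 1"] by (simp add: z0_def)
      moreover have "norm w \<le> norm (w - z0) + norm z0" using norm_triangle_ineq[of "w - z0" z0] by simp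
      moreover have "norm (w - 1) \<le> norm (w - z0) + norm (z0 - 1)"
        using norm_triangle_ineq[of "w - z0" "z0 - 1"] by simp
      ultimately show ?thesis using that by (simp add: T_def z0_def)
    qed
    have "norm (zeta_logderiv s) \<le> K * (M + 1) * (1 / a + 1)"
    proof (rule bound)
      show "open {s. Re s > 0}" by (rule open_halfspace_Re_gt)
      show "cball z0 (15 / 8) \<subseteq> {s. Re s > 0}"
      proof
        fix w assume "w \<in> cball z0 (15/8)"
        hence "norm (w - z0) \<le> 15/8" by (simp add: dist_norm norm_minus_commute)
        from near[OF this] show "w \<in> {s. Re s > 0}" by simp
      qed
      show "zeta_reg holomorphic_on {s. Re s > 0}" by (rule zeta_reg_holomorphic)
      show "zeta_reg z0 \<noteq> 0" by (rule RH_zeta_reg_nonzero[OF RH]) (simp add: z0_def)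
      show "\<forall>w. norm (w - z0) = 15 / 8 \<longrightarrow> norm (zeta_reg w) \<le> exp M * norm (zeta_reg z0)"
      proof (intro allI impI)
        fix w assume "norm (w - z0) = 15 / 8"
        hence w: "1 / 8 \<le> Re w" "norm w \<le> T" "norm (w - 1) \<le> T" using near[of w] by auto
        have "norm (zeta_reg w) \<le> 1 + norm (zeta_reg w - 1)"
          using norm_triangle_ineq[of 1 "zeta_reg w - 1"] by simp
        also have "norm (zeta_reg w - 1) \<le> C1 * norm (w - 1) * norm w" by (rule C1(2)[OF w(1)])
        also have "C1 * norm (w - 1) * norm w \<le> C1 * T * T"
          using w C1(1) T by (intro mult_mono) auto
        also have "1 + C1 * T * T \<le> (1 + C1) * T\<^sup>2"
          using T mult_mono[of 1 T 1 T] by (simp add: power2_eq_square algebra_simps)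
        also have "(1 + C1) * T\<^sup>2 = exp M * (1 * (1 / 3))" by (simp add: eM)
        also have "1 * (1 / 3) \<le> norm (z0 - 1) * norm (zeta z0)"
        proof (rule mult_mono)
          show "1 \<le> norm (z0 - 1)" using complex_Re_le_cmod[of "z0 - 1"] by (simp add: z0_def)
          show "1 / 3 \<le> norm (zeta z0)" by (rule zeta_lower_bound_2_line) (simp add: z0_def)
        qed auto
        also have "norm (z0 - 1) * norm (zeta z0) = norm (zeta_reg z0)"
          by (simp add: zeta_reg_def norm_mult z0_def complex_eq_iff)
        finally show "norm (zeta_reg w) \<le> exp M * norm (zeta_reg z0)" by (simp add: mult_left_mono)
      qed
      have "s - z0 = of_real (Re s - 2)" by (simp add: z0_def t_def complex_eq_iff)
      hence "norm (s - z0) = \<bar>Re s - 2\<bar>" by (metis norm_of_real)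
      thus "norm (s - z0) \<le> 3 / 2" using s by simp
      show "\<forall>\<rho>. norm (\<rho> - z0) < 7 / 4 \<longrightarrow> zeta_reg \<rho> = 0 \<longrightarrow> a \<le> norm (s - \<rho>)"
      proof (intro allI impI)
        fix \<rho> assume "norm (\<rho> - z0) < 7 / 4" "zeta_reg \<rho> = 0"
        hence "Re \<rho> \<le> 1 / 2" using RH_zeta_reg_nonzero[OF RH, of \<rho>] by force
        thus "a \<le> norm (s - \<rho>)" using complex_Re_le_cmod[of "s - \<rho>"] by (simp add: a_def)
      qed
    qed (rule a)
    also have "\<dots> \<le> K * ((L + 3) * ln T) * (5 / 2 / a)"
    proof (intro mult_mono)
      have "L * 1 \<le> L * ln T" using L lnT by (intro mult_left_mono) auto
      thus "M + 1 \<le> (L + 3) * ln T" using lnT unfolding M by (simp add: algebra_simps)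
      show "1 / a + 1 \<le> 5 / 2 / a" using a by (simp add: field_simps)
    qed (use K L lnT a M in auto)
    also have "K * ((L + 3) * ln T) * (5 / 2 / a) = (5 / 2 * K * (L + 3)) * ln T / a" by simp
    finally show ?thesis by (simp only: T_def t_def a_def)
  qed
  thus ?thesis using that[of "5 / 2 * K * (L + 3)"] K L by simp
qed

section \<open>A Plancherel inequality for analytically continued Laplace transforms\<close>

text \<open>
  The bell widens as the parameter \<open>\<kappa>\<close> decreases: both the damping of high frequencies and the cutoff
  in the variable \<open>v\<close> tend to 1 as \<open>\<kappa>\<close> tends to 0.
\<close>

abbreviation gauss :: "real \<Rightarrow> real \<Rightarrow> real" where
  "gauss \<kappa> v \<equiv> exp (- (\<kappa> * v)\<^sup>2 / 2)"

lemma fourier_gaussian: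
  assumes \<kappa>: "\<kappa> > 0"
  shows "integrable lborel (\<lambda>v. gauss \<kappa> v)" (is ?int)
    and "(\<integral>v. of_real (gauss \<kappa> v) * cis (v * w) \<partial>lborel) = of_real (2 * pi * normal_density 0 \<kappa> w)"
proof -
  have "(\<lambda>v. gauss \<kappa> v) = (\<lambda>v. sqrt (2 * pi) / \<kappa> * normal_density 0 (1 / \<kappa>) v)"
    using \<kappa> by (auto simp: normal_density_def real_sqrt_mult real_sqrt_divide power_mult_distrib power_divide)
  thus ?int using \<kappa> by (simp only:) (intro integrable_mult_right integrable_normal_density, simp)
  define \<tau> where "\<tau> = w / \<kappa>"
  have "of_real (exp (- \<tau>\<^sup>2 / 2)) = (\<integral>x. iexp (\<tau> * x) \<partial>std_normal_distribution)"
    using char_std_normal_distribution by (simp add: char_def fun_eq_iff)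
  also have "\<dots> = (\<integral>x. std_normal_density x *\<^sub>R iexp (\<tau> * x) \<partial>lborel)"
    by (subst integral_density) auto
  also have "\<dots> = \<bar>\<kappa>\<bar> *\<^sub>R (\<integral>v. std_normal_density (0 + \<kappa> * v) *\<^sub>R iexp (\<tau> * (0 + \<kappa> * v)) \<partial>lborel)"
    using \<kappa> by (intro lborel_integral_real_affine) auto
  also have "(\<integral>v. std_normal_density (0 + \<kappa> * v) *\<^sub>R iexp (\<tau> * (0 + \<kappa> * v)) \<partial>lborel) =
      (\<integral>v. of_real (1 / sqrt (2 * pi)) * (of_real (gauss \<kappa> v) * cis (v * w)) \<partial>lborel)"
    using \<kappa> by (intro Bochner_Integration.integral_cong)
       (auto simp: std_normal_density_def \<tau>_def cis_conv_exp scaleR_conv_of_real mult_ac)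
  finally have "of_real (exp (- \<tau>\<^sup>2 / 2)) = of_real (\<kappa> / sqrt (2 * pi)) * (\<integral>v. of_real (gauss \<kappa> v) * cis (v * w) \<partial>lborel)"
    using \<kappa> by (simp add: scaleR_conv_of_real)
  hence "(\<integral>v. of_real (gauss \<kappa> v) * cis (v * w) \<partial>lborel) = of_real (sqrt (2 * pi) / \<kappa> * exp (- \<tau>\<^sup>2 / 2))"
    using \<kappa> by (simp add: field_simps)
  also have "sqrt (2 * pi) / \<kappa> * exp (- \<tau>\<^sup>2 / 2) = 2 * pi * normal_density 0 \<kappa> w"
  proof -
    have "sqrt (2 * pi) * sqrt (2 * pi) = 2 * pi" by simp
    hence "2 * pi / sqrt (2 * pi) = sqrt (2 * pi)" by (simp add: divide_eq_eq)
    moreover have "2 * pi * normal_density 0 \<kappa> w = 2 * pi / sqrt (2 * pi) / \<kappa> * exp (- \<tau>\<^sup>2 / 2)"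
      using \<kappa> by (simp add: normal_density_def real_sqrt_mult \<tau>_def power_divide)
    ultimately show ?thesis by simp
  qed
  finally show "(\<integral>v. of_real (gauss \<kappa> v) * cis (v * w) \<partial>lborel) = of_real (2 * pi * normal_density 0 \<kappa> w)" .
qed

text \<open>
  For \<open>k v t = cis (v * t)\<close> this is the multiplication formula for Fourier transforms.
\<close>

lemma integral_kernel_swap:
  fixes H K :: "real \<Rightarrow> complex" and k :: "real \<Rightarrow> real \<Rightarrow> complex"
  assumes H: "integrable lborel H" and K: "integrable lborel K"
    and k[measurable]: "(\<lambda>(v, t). k v t) \<in> borel_measurable (lborel \<Otimes>\<^sub>M lborel)"
    and le: "\<And>v t. norm (k v t) \<le> 1"
  shows "(\<integral>v. K v * (\<integral>t. H t * k v t \<partial>lborel) \<partial>lborel) = (\<integral>t. H t * (\<integral>v. K v * k v t \<partial>lborel) \<partial>lborel)"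
    and "integrable lborel (\<lambda>v. K v * (\<integral>t. H t * k v t \<partial>lborel))"
proof -
  have [measurable]: "H \<in> borel_measurable borel" "K \<in> borel_measurable borel" using H K by auto
  have kv[measurable]: "(\<lambda>t. k v t) \<in> borel_measurable borel" for v
    using measurable_Pair2[OF k, of v] by simp
  have inner: "integrable lborel (\<lambda>t. K v * (H t * k v t))" for v
    by (rule Bochner_Integration.integrable_bound[OF integrable_mult_right[OF H, of "K v"]])
       (use le in \<open>auto simp: norm_mult mult_left_le mult_left_mono\<close>)
  have int: "integrable (lborel \<Otimes>\<^sub>M lborel) (case_prod (\<lambda>v t. K v * (H t * k v t)))"
  proof (rule lborel_pair.Fubini_integrable)
    show "integrable lborel (\<lambda>v. \<integral>t. norm (case (v, t) of (v, t) \<Rightarrow> K v * (H t * k v t)) \<partial>lborel)"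
    proof (rule Bochner_Integration.integrable_bound)
      show "integrable lborel (\<lambda>v. norm (K v) * (\<integral>t. norm (H t) \<partial>lborel))"
        using K by (intro integrable_mult_left integrable_norm)
      show "AE v in lborel. norm (\<integral>t. norm (case (v, t) of (v, t) \<Rightarrow> K v * (H t * k v t)) \<partial>lborel) \<le> 
               norm (norm (K v) * (\<integral>t. norm (H t) \<partial>lborel))"
      proof (rule AE_I2)
        fix v
        have "(\<integral>t. norm (K v * (H t * k v t)) \<partial>lborel) \<le> (\<integral>t. norm (K v) * norm (H t) \<partial>lborel)"
        proof (rule integral_mono[OF integrable_norm[OF inner]])
          show "integrable lborel (\<lambda>t. norm (K v) * norm (H t))"
            using H by (intro integrable_mult_right integrable_norm)
        qed (use le in \<open>auto simp: norm_mult mult_left_le mult_left_mono\<close>)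
        thus "norm (\<integral>t. norm (case (v, t) of (v, t) \<Rightarrow> K v * (H t * k v t)) \<partial>lborel) \<le> 
               norm (norm (K v) * (\<integral>t. norm (H t) \<partial>lborel))" by simp
      qed
    qed simp
  qed (use inner in auto)
  have "(\<integral>v. K v * (\<integral>t. H t * k v t \<partial>lborel) \<partial>lborel) = (\<integral>v. (\<integral>t. K v * (H t * k v t) \<partial>lborel) \<partial>lborel)"
    by simp
  also have "\<dots> = (\<integral>t. (\<integral>v. K v * (H t * k v t) \<partial>lborel) \<partial>lborel)"
    by (rule lborel_pair.Fubini_integral[OF int, symmetric])
  also have "\<dots> = (\<integral>t. (\<integral>v. H t * (K v * k v t) \<partial>lborel) \<partial>lborel)" by (simp add: mult_ac)
  also have "\<dots> = (\<integral>t. H t * (\<integral>v. K v * k v t \<partial>lborel) \<partial>lborel)" by simp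
  finally show "(\<integral>v. K v * (\<integral>t. H t * k v t \<partial>lborel) \<partial>lborel) = (\<integral>t. H t * (\<integral>v. K v * k v t \<partial>lborel) \<partial>lborel)" .
  show "integrable lborel (\<lambda>v. K v * (\<integral>t. H t * k v t \<partial>lborel))"
    using lborel_pair.integrable_fst'[OF int] by simp
qed

lemma nn_integral_normal_density: "\<kappa> > 0 \<Longrightarrow> (\<integral>\<^sup>+u. ennreal (normal_density t \<kappa> u) \<partial>lborel) = 1"
  by (subst nn_integral_eq_integral) (auto simp: normal_density_nonneg)

text \<open>
  Schur's test: \<open>2 |H t| |H u| \<le> |H t|\<^sup>2 + |H u|\<^sup>2\<close>, and the kernel has integral \<open>2 * pi\<close> in each of its
  two variables.
\<close>

lemma schur_gaussian_bound:
  fixes H :: "real \<Rightarrow> complex"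
  assumes H[measurable]: "H \<in> borel_measurable borel" and \<kappa>: "\<kappa> > 0"
  shows "(\<integral>\<^sup>+t. \<integral>\<^sup>+u. ennreal (norm (H t) * norm (H u) * (2 * pi * normal_density t \<kappa> u)) \<partial>lborel \<partial>lborel)
     \<le> ennreal (2 * pi) * (\<integral>\<^sup>+t. ennreal ((norm (H t))\<^sup>2) \<partial>lborel)"
proof -
  let ?I = "\<integral>\<^sup>+t. ennreal ((norm (H t))\<^sup>2) \<partial>lborel"
  have N[measurable]: "(\<lambda>(t, u). normal_density t \<kappa> u) \<in> borel_measurable (borel \<Otimes>\<^sub>M borel)"
    unfolding normal_density_def by measurable
  have sym: "normal_density t \<kappa> u = normal_density u \<kappa> t" for t u
    by (simp add: normal_density_def power2_commute)
  have "(\<integral>\<^sup>+t. \<integral>\<^sup>+u. ennreal (norm (H t) * norm (H u) * (2 * pi * normal_density t \<kappa> u)) \<partial>lborel \<partial>lborel)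
    \<le> (\<integral>\<^sup>+t. \<integral>\<^sup>+u. (ennreal (pi * (norm (H t))\<^sup>2) * ennreal (normal_density t \<kappa> u) + 
           ennreal (pi * (norm (H u))\<^sup>2) * ennreal (normal_density t \<kappa> u)) \<partial>lborel \<partial>lborel)"
  proof (intro nn_integral_mono)
    fix t u
    have "2 * (norm (H t) * norm (H u)) \<le> (norm (H t))\<^sup>2 + (norm (H u))\<^sup>2"
      using sum_squares_bound[of "norm (H t)" "norm (H u)"] by simp
    hence "(pi * normal_density t \<kappa> u) * (2 * (norm (H t) * norm (H u))) \<le> 
           (pi * normal_density t \<kappa> u) * ((norm (H t))\<^sup>2 + (norm (H u))\<^sup>2)"
      by (intro mult_left_mono) auto
    thus "ennreal (norm (H t) * norm (H u) * (2 * pi * normal_density t \<kappa> u)) \<le>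
      ennreal (pi * (norm (H t))\<^sup>2) * ennreal (normal_density t \<kappa> u) + 
           ennreal (pi * (norm (H u))\<^sup>2) * ennreal (normal_density t \<kappa> u)"
      by (simp add: algebra_simps flip: ennreal_mult ennreal_plus)
  qed
  also have "\<dots> = (\<integral>\<^sup>+t. \<integral>\<^sup>+u. ennreal (pi * (norm (H t))\<^sup>2) * ennreal (normal_density t \<kappa> u) \<partial>lborel \<partial>lborel)
      + (\<integral>\<^sup>+t. \<integral>\<^sup>+u. ennreal (pi * (norm (H u))\<^sup>2) * ennreal (normal_density t \<kappa> u) \<partial>lborel \<partial>lborel)"
    by (subst nn_integral_add[symmetric]) (auto simp: nn_integral_add)
  also have "(\<integral>\<^sup>+t. \<integral>\<^sup>+u. ennreal (pi * (norm (H u))\<^sup>2) * ennreal (normal_density t \<kappa> u) \<partial>lborel \<partial>lborel) =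
     (\<integral>\<^sup>+u. \<integral>\<^sup>+t. ennreal (pi * (norm (H u))\<^sup>2) * ennreal (normal_density t \<kappa> u) \<partial>lborel \<partial>lborel)"
    by (rule lborel_pair.Fubini') measurable
  also have "\<dots> = (\<integral>\<^sup>+u. ennreal (pi * (norm (H u))\<^sup>2) \<partial>lborel)"
    by (subst sym) (simp add: nn_integral_cmult nn_integral_normal_density[OF \<kappa>])
  also have "(\<integral>\<^sup>+t. \<integral>\<^sup>+u. ennreal (pi * (norm (H t))\<^sup>2) * ennreal (normal_density t \<kappa> u) \<partial>lborel \<partial>lborel) = 
      (\<integral>\<^sup>+u. ennreal (pi * (norm (H u))\<^sup>2) \<partial>lborel)"
    by (simp add: nn_integral_cmult nn_integral_normal_density[OF \<kappa>])
  also have "(\<integral>\<^sup>+u. ennreal (pi * (norm (H u))\<^sup>2) \<partial>lborel) = ennreal pi * ?I"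
    by (simp add: ennreal_mult' nn_integral_cmult)
  also have "ennreal pi * ?I + ennreal pi * ?I = ennreal (2 * pi) * ?I"
    unfolding mult_2[of pi] by (subst ennreal_plus) (auto simp: distrib_right)
  finally show ?thesis .
qed

text \<open>
  One half of Plancherel's theorem. The Gaussian cutoff makes every interchange of integrals
  legitimate and turns the mean square of the transform into a quadratic form in \<open>H\<close> with a Gaussian
  kernel, to which Schur's test applies.
\<close>

lemma fourier_gaussian_mean_square:
  fixes H :: "real \<Rightarrow> complex"
  assumes H: "integrable lborel H" and \<kappa>: "\<kappa> > 0"
  shows "(\<integral>\<^sup>+v. ennreal ((norm (\<integral>t. H t * cis (v * t) \<partial>lborel))\<^sup>2 * gauss \<kappa> v) \<partial>lborel)
      \<le> ennreal (2 * pi) * (\<integral>\<^sup>+t. ennreal ((norm (H t))\<^sup>2) \<partial>lborel)"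
proof -
  define Hf where "Hf = (\<lambda>v. \<integral>t. H t * cis (v * t) \<partial>lborel)"
  define W where "W = (\<lambda>v. gauss \<kappa> v)"
  have [measurable]: "H \<in> borel_measurable borel" using H by auto
  have [measurable]: "cis \<in> borel_measurable borel" 
    by (intro borel_measurable_continuous_onI continuous_intros)
  have [measurable]: "W \<in> borel_measurable borel" unfolding W_def by measurable
  have W: "integrable lborel (\<lambda>v. complex_of_real (W v))"
    using fourier_gaussian(1)[OF \<kappa>] by (simp add: W_def)
  have K1: "integrable lborel (\<lambda>v. of_real (W v) * Hf v)"
    unfolding Hf_def by (rule integral_kernel_swap(2)[OF H W]) auto
  have cH: "integrable lborel (\<lambda>t. cnj (H t))" using H by simp
  have cnjHf: "cnj (Hf v) = (\<integral>t. cnj (H t) * cis (- (v * t)) \<partial>lborel)" for v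
    unfolding Hf_def Bochner_Integration.integral_cnj[symmetric] by (simp add: cis_cnj)
  have K2: "integrable lborel (\<lambda>v. of_real (W v) * Hf v * cnj (Hf v))"
    unfolding cnjHf by (rule integral_kernel_swap(2)[OF cH K1]) auto
  have sq: "of_real (W v) * Hf v * cnj (Hf v) = of_real ((norm (Hf v))\<^sup>2 * W v)" for v
    by (simp only: of_real_mult complex_norm_square mult_ac)
  have intr: "integrable lborel (\<lambda>v. (norm (Hf v))\<^sup>2 * W v)"
    using K2 unfolding sq complex_of_real_integrable_eq .
  have inner: "(\<integral>v. of_real (W v) * Hf v * cis (- (v * t)) \<partial>lborel) =
               (\<integral>u. H u * of_real (2 * pi * normal_density t \<kappa> u) \<partial>lborel)" for t
  proof -
    have WI: "integrable lborel (\<lambda>v. of_real (W v) * cis (- (v * t)))"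
      by (rule Bochner_Integration.integrable_bound[OF W]) (auto simp: norm_mult)
    have "(\<integral>v. of_real (W v) * Hf v * cis (- (v * t)) \<partial>lborel) = 
          (\<integral>v. (of_real (W v) * cis (- (v * t))) * (\<integral>u. H u * cis (v * u) \<partial>lborel) \<partial>lborel)"
      by (simp add: Hf_def mult_ac)
    also have "\<dots> = (\<integral>u. H u * (\<integral>v. (of_real (W v) * cis (- (v * t))) * cis (v * u) \<partial>lborel) \<partial>lborel)"
      by (rule integral_kernel_swap(1)[OF H WI]) auto
    also have "(\<lambda>u. \<integral>v. (of_real (W v) * cis (- (v * t))) * cis (v * u) \<partial>lborel) =
               (\<lambda>u. \<integral>v. of_real (W v) * cis (v * (u - t)) \<partial>lborel)"
      by (simp add: cis_mult algebra_simps)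
    also have "\<dots> = (\<lambda>u. of_real (2 * pi * normal_density 0 \<kappa> (u - t)))"
      unfolding W_def by (subst fourier_gaussian(2)[OF \<kappa>]) (rule refl)
    also have "\<dots> = (\<lambda>u. of_real (2 * pi * normal_density t \<kappa> u))"
      by (simp add: normal_density_def)
    finally show ?thesis .
  qed
  have "complex_of_real (\<integral>v. (norm (Hf v))\<^sup>2 * W v \<partial>lborel) = (\<integral>v. of_real (W v) * Hf v * cnj (Hf v) \<partial>lborel)"
    unfolding sq by (rule integral_complex_of_real[symmetric])
  also have "\<dots> = (\<integral>v. (of_real (W v) * Hf v) * (\<integral>t. cnj (H t) * cis (- (v * t)) \<partial>lborel) \<partial>lborel)"
    by (simp only: cnjHf)
  also have "\<dots> = (\<integral>t. cnj (H t) * (\<integral>v. (of_real (W v) * Hf v) * cis (- (v * t)) \<partial>lborel) \<partial>lborel)"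
    by (rule integral_kernel_swap(1)[OF cH K1]) auto
  also have "\<dots> = (\<integral>t. cnj (H t) * (\<integral>u. H u * of_real (2 * pi * normal_density t \<kappa> u) \<partial>lborel) \<partial>lborel)"
    by (simp only: inner)
  finally have eq: "complex_of_real (\<integral>v. (norm (Hf v))\<^sup>2 * W v \<partial>lborel) = \<dots>" .
  have norm_le: "ennreal (norm (integral\<^sup>L lborel f)) \<le> (\<integral>\<^sup>+x. ennreal (norm (f x)) \<partial>lborel)" 
    for f :: "real \<Rightarrow> complex"
    by (cases "integrable lborel f") (auto simp: integral_norm_bound_ennreal not_integrable_integral_eq)
  have "(\<integral>\<^sup>+v. ennreal ((norm (Hf v))\<^sup>2 * W v) \<partial>lborel) = ennreal (\<integral>v. (norm (Hf v))\<^sup>2 * W v \<partial>lborel)"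
    by (rule nn_integral_eq_integral[OF intr]) (auto simp: W_def)
  also have "\<dots> \<le> ennreal (norm (complex_of_real (\<integral>v. (norm (Hf v))\<^sup>2 * W v \<partial>lborel)))"
    by (intro ennreal_leI) simp
  also have "\<dots> \<le> (\<integral>\<^sup>+t. ennreal (norm (cnj (H t) * (\<integral>u. H u * of_real (2 * pi * normal_density t \<kappa> u) \<partial>lborel))) \<partial>lborel)"
    unfolding eq by (rule norm_le)
  also have "\<dots> \<le> (\<integral>\<^sup>+t. \<integral>\<^sup>+u. ennreal (norm (H t) * norm (H u) * (2 * pi * normal_density t \<kappa> u)) \<partial>lborel \<partial>lborel)"
  proof (rule nn_integral_mono)
    fix t
    have "ennreal (norm (cnj (H t) * (\<integral>u. H u * of_real (2 * pi * normal_density t \<kappa> u) \<partial>lborel))) =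
          ennreal (norm (H t)) * ennreal (norm (\<integral>u. H u * of_real (2 * pi * normal_density t \<kappa> u) \<partial>lborel))"
      by (simp add: norm_mult ennreal_mult)
    also have "\<dots> \<le> ennreal (norm (H t)) * (\<integral>\<^sup>+u. ennreal (norm (H u * of_real (2 * pi * normal_density t \<kappa> u))) \<partial>lborel)"
      by (intro mult_left_mono norm_le) auto
    also have "\<dots> = (\<integral>\<^sup>+u. ennreal (norm (H t)) * ennreal (norm (H u * of_real (2 * pi * normal_density t \<kappa> u))) \<partial>lborel)"
      by (rule nn_integral_cmult[symmetric]) measurable
    also have "\<dots> = (\<integral>\<^sup>+u. ennreal (norm (H t) * norm (H u) * (2 * pi * normal_density t \<kappa> u)) \<partial>lborel)"
      by (simp add: norm_mult mult_ac flip: ennreal_mult)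
    finally show "ennreal (norm (cnj (H t) * (\<integral>u. H u * of_real (2 * pi * normal_density t \<kappa> u) \<partial>lborel))) \<le> \<dots>" .
  qed
  also have "\<dots> \<le> ennreal (2 * pi) * (\<integral>\<^sup>+t. ennreal ((norm (H t))\<^sup>2) \<partial>lborel)"
    by (rule schur_gaussian_bound[OF _ \<kappa>]) measurable
  finally show ?thesis by (simp add: Hf_def W_def)
qed

text \<open>
  On a convex domain \<open>P\<close> has a primitive \<open>Q\<close>, and the integral over \<open>|t| \<le> n\<close> of either line is a
  difference of values of \<open>Q\<close>. The two integrals differ by the variation of \<open>Q\<close> along the horizontal
  edges at height \<open>n\<close> and \<open>-n\<close>, where the Gaussian decay makes \<open>P\<close> small.
\<close>

lemma vertical_integral_shift:
  fixes P :: "complex \<Rightarrow> complex"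
  assumes S: "open S" "convex S" and hol: "P holomorphic_on S" and le: "\<sigma>1 \<le> \<sigma>0"
    and sub: "\<And>s. \<sigma>1 \<le> Re s \<Longrightarrow> Re s \<le> \<sigma>0 \<Longrightarrow> s \<in> S"
    and \<epsilon>: "\<epsilon> > 0"
    and bd: "\<And>s. \<sigma>1 \<le> Re s \<Longrightarrow> Re s \<le> \<sigma>0 \<Longrightarrow> norm (P s) \<le> B * gauss \<epsilon> (Im s)"
  shows "(\<integral>t. P (Complex \<sigma>0 t) \<partial>lborel) = (\<integral>t. P (Complex \<sigma>1 t) \<partial>lborel)"
    and "integrable lborel (\<lambda>t. P (Complex \<sigma>1 t))"
proof -
  obtain Q where Q: "\<And>s. s \<in> S \<Longrightarrow> (Q has_field_derivative P s) (at s within S)"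
    using holomorphic_convex_primitive'[OF S(2,1) hol] by blast
  have Q': "(Q has_field_derivative P s) (at s)" if "s \<in> S" for s
    using Q[OF that] at_within_open[OF that S(1)] by simp
  have contP: "continuous_on S P" by (rule holomorphic_on_imp_continuous_on[OF hol])
  have cont: "continuous_on UNIV (\<lambda>t. P (Complex \<sigma> t))" if "\<sigma>1 \<le> \<sigma>" "\<sigma> \<le> \<sigma>0" for \<sigma>
    by (rule continuous_on_compose2[OF contP])
       (use that sub in \<open>auto simp: Complex_eq intro!: continuous_intros\<close>)
  have int: "integrable lborel (\<lambda>t. P (Complex \<sigma> t))" if "\<sigma>1 \<le> \<sigma>" "\<sigma> \<le> \<sigma>0" for \<sigma>
  proof (rule Bochner_Integration.integrable_bound)
    show "integrable lborel (\<lambda>t. B * gauss \<epsilon> t)"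
      by (intro integrable_mult_right fourier_gaussian(1) \<epsilon>)
    show "(\<lambda>t. P (Complex \<sigma> t)) \<in> borel_measurable lborel"
      using borel_measurable_continuous_onI[OF cont[OF that]] by simp
    show "AE t in lborel. norm (P (Complex \<sigma> t)) \<le> norm (B * gauss \<epsilon> t)"
    proof (rule AE_I2)
      fix t
      have "norm (P (Complex \<sigma> t)) \<le> B * gauss \<epsilon> t" using bd[of "Complex \<sigma> t"] that by simp
      also have "\<dots> \<le> norm (B * gauss \<epsilon> t)" by simp
      finally show "norm (P (Complex \<sigma> t)) \<le> norm (B * gauss \<epsilon> t)" .
    qed
  qed
  show "integrable lborel (\<lambda>t. P (Complex \<sigma>1 t))" using int[of \<sigma>1] le by simp
  define I where "I = (\<lambda>\<sigma> n. \<integral>t. indicator {- real n..real n} t *\<^sub>R P (Complex \<sigma> t) \<partial>lborel)"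
  have I: "\<i> * I \<sigma> n = Q (Complex \<sigma> (real n)) - Q (Complex \<sigma> (- real n))"
    if "\<sigma>1 \<le> \<sigma>" "\<sigma> \<le> \<sigma>0" for \<sigma> n
  proof -
    have "((\<lambda>t. P (Complex \<sigma> t) * \<i>) has_integral Q (Complex \<sigma> (real n)) - Q (Complex \<sigma> (- real n))) {- real n..real n}"
    proof (rule fundamental_theorem_of_calculus)
      fix t :: real
      have "((\<lambda>t. Complex \<sigma> t) has_vector_derivative \<i>) (at t within {- real n..real n})"
        unfolding Complex_eq by (auto intro!: derivative_eq_intros)
      from field_vector_diff_chain_within[OF this, of Q "P (Complex \<sigma> t)"]
      show "((\<lambda>t. Q (Complex \<sigma> t)) has_vector_derivative P (Complex \<sigma> t) * \<i>) (at t within {- real n..real n})"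
        using has_field_derivative_at_within[OF Q'[OF sub]] that by (simp add: o_def mult.commute)
    qed simp
    hence 1: "integral {- real n..real n} (\<lambda>t. P (Complex \<sigma> t) * \<i>) = Q (Complex \<sigma> (real n)) - Q (Complex \<sigma> (- real n))"
      by (rule integral_unique)
    have "set_integrable lborel {- real n..real n} (\<lambda>t. P (Complex \<sigma> t))"
      by (rule set_integrable_subset[of _ UNIV]) (use int[OF that] in \<open>auto simp: set_integrable_def\<close>)
    from set_borel_integral_eq_integral(2)[OF this]
    have "I \<sigma> n = integral {- real n..real n} (\<lambda>t. P (Complex \<sigma> t))"
      by (simp add: I_def set_lebesgue_integral_def)
    thus ?thesis using 1 by (simp add: mult.commute)
  qed
  have lim: "(\<lambda>n. I \<sigma> n) \<longlonglongrightarrow> (\<integral>t. P (Complex \<sigma> t) \<partial>lborel)" if "\<sigma>1 \<le> \<sigma>" "\<sigma> \<le> \<sigma>0" for \<sigma>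
    unfolding I_def
  proof (rule integral_dominated_convergence[where w = "\<lambda>t. norm (P (Complex \<sigma> t))"])
    have [measurable]: "(\<lambda>t. P (Complex \<sigma> t)) \<in> borel_measurable lborel" using int[OF that] by simp
    show "(\<lambda>t. P (Complex \<sigma> t)) \<in> borel_measurable lborel" by measurable
    show "(\<lambda>t. indicat_real {- real n..real n} t *\<^sub>R P (Complex \<sigma> t)) \<in> borel_measurable lborel" for n by measurable
    show "AE t in lborel. (\<lambda>n. indicat_real {- real n..real n} t *\<^sub>R P (Complex \<sigma> t)) \<longlonglongrightarrow> P (Complex \<sigma> t)"
    proof (rule AE_I2)
      fix t :: real
      have "eventually (\<lambda>n. indicat_real {- real n..real n} t *\<^sub>R P (Complex \<sigma> t) = P (Complex \<sigma> t)) sequentially"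
        using eventually_ge_at_top[of "nat \<lceil>\<bar>t\<bar>\<rceil>"]
      proof eventually_elim
        case (elim n)
        hence "\<bar>t\<bar> \<le> real n" by linarith
        thus ?case by (simp add: abs_le_iff)
      qed
      thus "(\<lambda>n. indicat_real {- real n..real n} t *\<^sub>R P (Complex \<sigma> t)) \<longlonglongrightarrow> P (Complex \<sigma> t)"
        by (rule tendsto_eventually)
    qed
    show "AE t in lborel. norm (indicat_real {- real n..real n} t *\<^sub>R P (Complex \<sigma> t)) \<le> norm (P (Complex \<sigma> t))" for n
      by (auto simp: indicator_def)
  qed (use int[OF that] in auto)
  have edge: "norm (Q (Complex \<sigma>0 t) - Q (Complex \<sigma>1 t)) \<le> B * gauss \<epsilon> t * (\<sigma>0 - \<sigma>1)" for t
  proof -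
    define T where "T = {s. \<sigma>1 \<le> Re s} \<inter> {s. Re s \<le> \<sigma>0} \<inter> {s. Im s \<le> t} \<inter> {s. Im s \<ge> t}"
    have "norm (Q (Complex \<sigma>0 t) - Q (Complex \<sigma>1 t)) \<le> B * gauss \<epsilon> t * norm (Complex \<sigma>0 t - Complex \<sigma>1 t)"
    proof (rule field_differentiable_bound[where S = T and f' = P])
      show "convex T" unfolding T_def
        by (intro convex_Int convex_halfspace_Re_ge convex_halfspace_Re_le convex_halfspace_Im_le convex_halfspace_Im_ge)
      show "(Q has_field_derivative P z) (at z within T)" if "z \<in> T" for z
        using Q' sub that by (auto simp: T_def intro: has_field_derivative_at_within)
      show "norm (P z) \<le> B * gauss \<epsilon> t" if "z \<in> T" for z
        using bd[of z] that by (auto simp: T_def)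
    qed (use le in \<open>auto simp: T_def\<close>)
    also have "norm (Complex \<sigma>0 t - Complex \<sigma>1 t) = \<sigma>0 - \<sigma>1" using le by (simp add: cmod_def)
    finally show ?thesis .
  qed
  have g0: "(\<lambda>n::nat. gauss \<epsilon> (real n)) \<longlonglongrightarrow> 0" using \<epsilon> by real_asymp
  have "(\<lambda>n. \<i> * I \<sigma>0 n - \<i> * I \<sigma>1 n) \<longlonglongrightarrow> 0"
  proof (rule Lim_null_comparison)
    show "\<forall>\<^sub>F n in sequentially. norm (\<i> * I \<sigma>0 n - \<i> * I \<sigma>1 n) \<le> 2 * (B * gauss \<epsilon> (real n) * (\<sigma>0 - \<sigma>1))"
    proof (rule always_eventually, rule allI)
      fix n
      have "norm (\<i> * I \<sigma>0 n - \<i> * I \<sigma>1 n) = norm ((Q (Complex \<sigma>0 (real n)) - Q (Complex \<sigma>1 (real n)))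
            - (Q (Complex \<sigma>0 (- real n)) - Q (Complex \<sigma>1 (- real n))))"
        unfolding I[OF le order_refl] I[OF order_refl le] by (simp add: algebra_simps)
      also have "\<dots> \<le> norm (Q (Complex \<sigma>0 (real n)) - Q (Complex \<sigma>1 (real n))) + 
            norm (Q (Complex \<sigma>0 (- real n)) - Q (Complex \<sigma>1 (- real n)))" by (rule norm_triangle_ineq4)
      also have "\<dots> \<le> B * gauss \<epsilon> (real n) * (\<sigma>0 - \<sigma>1) + B * gauss \<epsilon> (- real n) * (\<sigma>0 - \<sigma>1)"
        by (intro add_mono edge)
      finally show "norm (\<i> * I \<sigma>0 n - \<i> * I \<sigma>1 n) \<le> 2 * (B * gauss \<epsilon> (real n) * (\<sigma>0 - \<sigma>1))" by (simp add: mult_ac)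
    qed
    show "(\<lambda>n. 2 * (B * gauss \<epsilon> (real n) * (\<sigma>0 - \<sigma>1))) \<longlonglongrightarrow> 0"
      using tendsto_mult_left[OF tendsto_mult_right[OF tendsto_mult_left[OF g0, of B], of "\<sigma>0 - \<sigma>1"], of 2] by simp
  qed
  moreover have "(\<lambda>n. \<i> * I \<sigma>0 n - \<i> * I \<sigma>1 n) \<longlonglongrightarrow> 
      \<i> * (\<integral>t. P (Complex \<sigma>0 t) \<partial>lborel) - \<i> * (\<integral>t. P (Complex \<sigma>1 t) \<partial>lborel)"
    using le by (intro tendsto_intros lim) auto
  ultimately have "\<i> * (\<integral>t. P (Complex \<sigma>0 t) \<partial>lborel) - \<i> * (\<integral>t. P (Complex \<sigma>1 t) \<partial>lborel) = 0"
    using LIMSEQ_unique by blast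
  thus "(\<integral>t. P (Complex \<sigma>0 t) \<partial>lborel) = (\<integral>t. P (Complex \<sigma>1 t) \<partial>lborel)" by simp
qed

text \<open>
  Fourier inversion for the convolution of \<open>g\<close> with a Gaussian, where absolute convergence holds
  however slowly the transform of \<open>g\<close> decays.
\<close>

lemma gaussian_convolution_fourier:
  fixes g :: "real \<Rightarrow> real" and Fg :: "real \<Rightarrow> complex"
  assumes g: "integrable lborel g" and \<epsilon>: "\<epsilon> > 0"
    and Fg: "\<And>t. Fg t = (\<integral>u. of_real (g u) * cis (- (t * u)) \<partial>lborel)"
  shows "(\<integral>t. of_real (gauss \<epsilon> t) * cis (v * t) * Fg t \<partial>lborel) =
     of_real (2 * pi * (\<integral>y. g (v - \<epsilon> * y) * std_normal_density y \<partial>lborel))"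
proof -
  define K where "K = (\<lambda>t. of_real (gauss \<epsilon> t) * cis (v * t))"
  have [measurable]: "cis \<in> borel_measurable borel" 
    by (intro borel_measurable_continuous_onI continuous_intros)
  have W: "integrable lborel (\<lambda>t. complex_of_real (gauss \<epsilon> t))"
    using fourier_gaussian(1)[OF \<epsilon>] by simp
  have K: "integrable lborel K" unfolding K_def
    by (rule Bochner_Integration.integrable_bound[OF W]) (auto simp: norm_mult)
  have H: "integrable lborel (\<lambda>u. complex_of_real (g u))" using g by simp
  have "(\<integral>t. K t * Fg t \<partial>lborel) = (\<integral>u. of_real (g u) * (\<integral>t. K t * cis (- (t * u)) \<partial>lborel) \<partial>lborel)"
    unfolding Fg by (rule integral_kernel_swap(1)[OF H K]) auto
  also have "(\<lambda>u. \<integral>t. K t * cis (- (t * u)) \<partial>lborel) = (\<lambda>u. \<integral>t. of_real (gauss \<epsilon> t) * cis (t * (v - u)) \<partial>lborel)"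
  proof -
    have "K t * cis (- (t * u)) = of_real (gauss \<epsilon> t) * cis (t * (v - u))" for t u
      unfolding K_def mult.assoc cis_mult by (simp add: algebra_simps)
    thus ?thesis by simp
  qed
  also have "\<dots> = (\<lambda>u. of_real (2 * pi * normal_density 0 \<epsilon> (v - u)))"
    by (subst fourier_gaussian(2)[OF \<epsilon>]) (rule refl)
  also have "(\<integral>u. of_real (g u) * of_real (2 * pi * normal_density 0 \<epsilon> (v - u)) \<partial>lborel) =
      complex_of_real (\<integral>u. g u * (2 * pi * normal_density 0 \<epsilon> (v - u)) \<partial>lborel)"
    unfolding of_real_mult[symmetric] by (rule integral_complex_of_real)
  also have "(\<integral>u. g u * (2 * pi * normal_density 0 \<epsilon> (v - u)) \<partial>lborel) =
      \<bar>- \<epsilon>\<bar> *\<^sub>R (\<integral>y. g (v + (- \<epsilon>) * y) * (2 * pi * normal_density 0 \<epsilon> (v - (v + (- \<epsilon>) * y))) \<partial>lborel)"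
    using \<epsilon> by (intro lborel_integral_real_affine) auto
  also have "\<dots> = (\<integral>y. \<epsilon> * (g (v + (- \<epsilon>) * y) * (2 * pi * normal_density 0 \<epsilon> (v - (v + (- \<epsilon>) * y)))) \<partial>lborel)"
    using \<epsilon> by simp
  also have "\<dots> = (\<integral>y. 2 * pi * (g (v - \<epsilon> * y) * std_normal_density y) \<partial>lborel)"
    using \<epsilon> by (intro Bochner_Integration.integral_cong) 
      (auto simp: normal_density_def real_sqrt_mult power_mult_distrib)
  also have "\<dots> = 2 * pi * (\<integral>y. g (v - \<epsilon> * y) * std_normal_density y \<partial>lborel)" by simp
  finally show ?thesis by (simp only: K_def)
qed

lemma gaussian_convolution_tendsto:
  fixes g :: "real \<Rightarrow> real"
  assumes [measurable]: "g \<in> borel_measurable borel" and bd: "\<And>u. \<bar>g u\<bar> \<le> A" and cont: "isCont g v"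
    and e: "e \<longlonglongrightarrow> 0"
  shows "(\<lambda>n. \<integral>y. g (v - e n * y) * std_normal_density y \<partial>lborel) \<longlonglongrightarrow> g v"
proof -
  have "(\<lambda>n. \<integral>y. g (v - e n * y) * std_normal_density y \<partial>lborel) \<longlonglongrightarrow> (\<integral>y. g v * std_normal_density y \<partial>lborel)"
  proof (rule integral_dominated_convergence[where w = "\<lambda>y. A * std_normal_density y"])
    show "AE y in lborel. (\<lambda>n. g (v - e n * y) * std_normal_density y) \<longlonglongrightarrow> g v * std_normal_density y"
    proof (rule AE_I2)
      fix y
      have "(\<lambda>n. v - e n * y) \<longlonglongrightarrow> v - 0 * y" by (intro tendsto_intros e)
      hence "(\<lambda>n. v - e n * y) \<longlonglongrightarrow> v" by simp
      from isCont_tendsto_compose[OF cont this]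
      show "(\<lambda>n. g (v - e n * y) * std_normal_density y) \<longlonglongrightarrow> g v * std_normal_density y"
        by (intro tendsto_intros)
    qed
    show "AE y in lborel. norm (g (v - e n * y) * std_normal_density y) \<le> A * std_normal_density y" for n
      using bd by (auto simp: abs_mult intro!: mult_right_mono)
  qed auto
  thus ?thesis by simp
qed

text \<open>
  The Laplace transform of \<open>f\<close> converges on the line \<open>Re s = \<sigma>0\<close>; on the line \<open>Re s = \<sigma>1\<close> only its
  analytic continuation \<open>F\<close> is known. The entire factor \<open>exp (\<epsilon>\<^sup>2 (s - \<sigma>0)\<^sup>2 / 2)\<close> makes \<open>F\<close> decay like
  a Gaussian in vertical direction. On the line \<open>\<sigma>0\<close> it amounts to a Gaussian smoothing of
  \<open>f v * exp (- \<sigma>0 v)\<close>, the integral may be moved to the line \<open>\<sigma>1\<close>, and there the mean square is bounded by that of \<open>F\<close>. As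
  \<open>\<epsilon>\<close> tends to 0, Fatou's lemma removes the smoothing at the points of continuity of \<open>f\<close>.
\<close>

theorem plancherel_inequality_shifted_line:
  fixes f :: "real \<Rightarrow> real" and F :: "complex \<Rightarrow> complex"
  assumes S: "open S" "convex S" and hol: "F holomorphic_on S" and le: "\<sigma>1 \<le> \<sigma>0"
    and sub: "\<And>s. \<sigma>1 \<le> Re s \<Longrightarrow> Re s \<le> \<sigma>0 \<Longrightarrow> s \<in> S"
    and bdF: "\<And>s. \<sigma>1 \<le> Re s \<Longrightarrow> Re s \<le> \<sigma>0 \<Longrightarrow> norm (F s) \<le> B"
    and meas[measurable]: "f \<in> borel_measurable borel"
    and bdf: "\<And>v. \<bar>f v * exp (- (\<sigma>0 * v))\<bar> \<le> A"
    and int: "integrable lborel (\<lambda>v. f v * exp (- (\<sigma>0 * v)))"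
    and cont: "AE v in lborel. isCont f v"
    and F: "\<And>t. F (Complex \<sigma>0 t) = (\<integral>v. of_real (f v) * exp (- (Complex \<sigma>0 t * of_real v)) \<partial>lborel)"
  shows "(\<integral>\<^sup>+v. ennreal ((f v)\<^sup>2 * exp (- (2 * \<sigma>1 * v))) \<partial>lborel)
     \<le> ennreal (1 / (2 * pi)) * (\<integral>\<^sup>+t. ennreal ((norm (F (Complex \<sigma>1 t)))\<^sup>2) \<partial>lborel)"
proof -
  define g where "g = (\<lambda>v. f v * exp (- (\<sigma>0 * v)))"
  define d where "d = \<sigma>0 - \<sigma>1"
  define J where "J = (\<integral>\<^sup>+t. ennreal ((norm (F (Complex \<sigma>1 t)))\<^sup>2) \<partial>lborel)"
  define h where "h = (\<lambda>\<epsilon> v. \<integral>y. g (v - \<epsilon> * y) * std_normal_density y \<partial>lborel)"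
  have g[measurable]: "g \<in> borel_measurable borel" unfolding g_def by measurable
  have B: "B \<ge> 0" by (rule order_trans[OF norm_ge_zero bdF[of "of_real \<sigma>0"]]) (use le in auto)
  have key: "(\<integral>\<^sup>+v. ennreal ((h \<epsilon> v)\<^sup>2 * exp (2 * d * v) * gauss \<epsilon> v) \<partial>lborel)
      \<le> ennreal (exp (\<epsilon>\<^sup>2 * d\<^sup>2) / (2 * pi)) * J" if \<epsilon>: "\<epsilon> > 0" for \<epsilon>
  proof -
    define H where "H = (\<lambda>t. F (Complex \<sigma>1 t) * exp (of_real (\<epsilon>\<^sup>2 / 2) * (Complex (- d) t)\<^sup>2))"
    have normexp: "norm (exp (of_real (\<epsilon>\<^sup>2 / 2) * (Complex x t)\<^sup>2)) = exp (\<epsilon>\<^sup>2 / 2 * x\<^sup>2) * gauss \<epsilon> t" for x t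
    proof -
      have "Re (of_real (\<epsilon>\<^sup>2 / 2) * (Complex x t)\<^sup>2) = \<epsilon>\<^sup>2 / 2 * x\<^sup>2 + (- (\<epsilon> * t)\<^sup>2 / 2)"
        by (simp add: power2_eq_square field_simps)
      thus ?thesis by (simp only: norm_exp_eq_Re exp_add)
    qed
    have shift: "(2 * pi * h \<epsilon> v) = exp (- (v * d)) * (\<integral>t. H t * cis (v * t) \<partial>lborel)"
      and intH: "integrable lborel (\<lambda>t. H t * cis (v * t))" for v
    proof -
      define P where "P = (\<lambda>s. F s * exp (of_real (\<epsilon>\<^sup>2 / 2) * (s - of_real \<sigma>0)\<^sup>2) * exp (of_real v * (s - of_real \<sigma>0)))"
      have P0: "P (Complex \<sigma>0 t) = of_real (gauss \<epsilon> t) * cis (v * t) * F (Complex \<sigma>0 t)" for t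
      proof -
        have "Complex \<sigma>0 t - of_real \<sigma>0 = \<i> * of_real t" by (simp add: complex_eq_iff)
        moreover have "of_real (\<epsilon>\<^sup>2 / 2) * (\<i> * of_real t)\<^sup>2 = complex_of_real (- (\<epsilon> * t)\<^sup>2 / 2)"
          by (simp add: power_mult_distrib)
        moreover have "exp (complex_of_real x) = of_real (exp x)" for x by (rule exp_of_real)
        ultimately show ?thesis unfolding P_def by (simp only: cis_conv_exp) (simp add: mult_ac)
      qed
      have P1: "P (Complex \<sigma>1 t) = of_real (exp (- (v * d))) * (H t * cis (v * t))" for t
      proof -
        have e: "Complex \<sigma>1 t - of_real \<sigma>0 = Complex (- d) t" by (simp add: complex_eq_iff d_def)
        have "of_real v * Complex (- d) t = of_real (- (v * d)) + \<i> * of_real (v * t)"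
          by (simp add: complex_eq_iff)
        hence "exp (of_real v * Complex (- d) t) = of_real (exp (- (v * d))) * cis (v * t)"
          by (simp only: exp_add exp_of_real cis_conv_exp)
        thus ?thesis unfolding P_def H_def e by simp
      qed
      have bdP: "norm (P s) \<le> (B * exp (\<epsilon>\<^sup>2 / 2 * d\<^sup>2) * exp (\<bar>v\<bar> * d)) * gauss \<epsilon> (Im s)"
        if s: "\<sigma>1 \<le> Re s" "Re s \<le> \<sigma>0" for s
      proof -
        define x where "x = \<sigma>0 - Re s"
        have x: "0 \<le> x" "x \<le> d" using s by (auto simp: x_def d_def)
        have e: "s - of_real \<sigma>0 = Complex (- x) (Im s)" by (simp add: complex_eq_iff x_def)
        have "norm (P s) = norm (F s) * (exp (\<epsilon>\<^sup>2 / 2 * (- x)\<^sup>2) * gauss \<epsilon> (Im s)) * exp (- (v * x))"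
          unfolding P_def e norm_mult normexp by (simp add: norm_exp_eq_Re)
        also have "\<dots> \<le> B * (exp (\<epsilon>\<^sup>2 / 2 * d\<^sup>2) * gauss \<epsilon> (Im s)) * exp (\<bar>v\<bar> * d)"
        proof (intro mult_mono)
          have "- (v * x) \<le> \<bar>v\<bar> * x" using x mult_right_mono[of "- v" "\<bar>v\<bar>" x] by simp
          also have "\<dots> \<le> \<bar>v\<bar> * d" using x by (intro mult_left_mono) auto
          finally show "exp (- (v * x)) \<le> exp (\<bar>v\<bar> * d)" by simp
          show "exp (\<epsilon>\<^sup>2 / 2 * (- x)\<^sup>2) \<le> exp (\<epsilon>\<^sup>2 / 2 * d\<^sup>2)"
            using x by (auto intro!: mult_left_mono power_mono)
        qed (use bdF[OF s] B in auto)
        finally show ?thesis by (simp add: mult_ac)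
      qed
      have holP: "P holomorphic_on S" unfolding P_def by (intro holomorphic_intros hol)
      note vs = vertical_integral_shift[OF S holP le sub \<epsilon> bdP]
      have "of_real (2 * pi * h \<epsilon> v) = (\<integral>t. P (Complex \<sigma>0 t) \<partial>lborel)"
        unfolding P0 h_def
      proof (rule gaussian_convolution_fourier[OF _ \<epsilon>, symmetric])
        show "integrable lborel g" using int by (simp add: g_def)
        fix t
        have "F (Complex \<sigma>0 t) = (\<integral>v. of_real (f v) * exp (- (Complex \<sigma>0 t * of_real v)) \<partial>lborel)" by (rule F)
        also have "(\<lambda>v. of_real (f v) * exp (- (Complex \<sigma>0 t * of_real v))) = (\<lambda>v. of_real (g v) * cis (- (t * v)))"
        proof
          fix v
          have "- (Complex \<sigma>0 t * of_real v) = of_real (- (\<sigma>0 * v)) + \<i> * of_real (- (t * v))"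
            by (simp add: complex_eq_iff)
          hence "exp (- (Complex \<sigma>0 t * of_real v)) = of_real (exp (- (\<sigma>0 * v))) * cis (- (t * v))"
            by (simp only: exp_add exp_of_real cis_conv_exp)
          thus "of_real (f v) * exp (- (Complex \<sigma>0 t * of_real v)) = of_real (g v) * cis (- (t * v))"
            by (simp add: g_def)
        qed
        finally show "F (Complex \<sigma>0 t) = (\<integral>u. of_real (g u) * cis (- (t * u)) \<partial>lborel)" .
      qed
      also have "\<dots> = (\<integral>t. P (Complex \<sigma>1 t) \<partial>lborel)" by (rule vs(1))
      also have "\<dots> = exp (- (v * d)) * (\<integral>t. H t * cis (v * t) \<partial>lborel)" unfolding P1 by simp
      finally show "(2 * pi * h \<epsilon> v) = exp (- (v * d)) * (\<integral>t. H t * cis (v * t) \<partial>lborel)" .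
      show "integrable lborel (\<lambda>t. H t * cis (v * t))"
      proof -
        have "integrable lborel (\<lambda>t. of_real (exp (v * d)) * P (Complex \<sigma>1 t))"
          by (intro integrable_mult_right vs(2))
        moreover have "of_real (exp (v * d)) * P (Complex \<sigma>1 t) = H t * cis (v * t)" for t
          unfolding P1 mult.assoc[symmetric] of_real_mult[symmetric] exp_add[symmetric] by simp
        ultimately show ?thesis by (simp only:)
      qed
    qed
    have H: "integrable lborel H" using intH[of 0] by simp
    have sq: "(h \<epsilon> v)\<^sup>2 * exp (2 * d * v) = 1 / (2 * pi)\<^sup>2 * (norm (\<integral>t. H t * cis (v * t) \<partial>lborel))\<^sup>2" for v
    proof -
      have "norm (complex_of_real (2 * pi * h \<epsilon> v)) = exp (- (v * d)) * norm (\<integral>t. H t * cis (v * t) \<partial>lborel)"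
        unfolding shift[of v] by (simp add: norm_mult)
      hence "(2 * pi * \<bar>h \<epsilon> v\<bar>)\<^sup>2 = (exp (- (v * d)))\<^sup>2 * (norm (\<integral>t. H t * cis (v * t) \<partial>lborel))\<^sup>2"
        unfolding power_mult_distrib[symmetric] by (simp add: norm_mult abs_mult)
      hence 1: "(2 * pi)\<^sup>2 * (h \<epsilon> v)\<^sup>2 * (exp (v * d))\<^sup>2 = ((exp (- (v * d)))\<^sup>2 * (exp (v * d))\<^sup>2) * (norm (\<integral>t. H t * cis (v * t) \<partial>lborel))\<^sup>2"
        by (simp add: power_mult_distrib)
      have 2: "(exp (- (v * d)))\<^sup>2 * (exp (v * d))\<^sup>2 = 1"
        by (simp add: exp_minus flip: power_mult_distrib)
      have 3: "(exp (v * d))\<^sup>2 = exp (2 * d * v)" by (simp add: mult_ac flip: exp_double)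
      have 4: "(2 * pi)\<^sup>2 * ((h \<epsilon> v)\<^sup>2 * exp (2 * d * v)) = (norm (\<integral>t. H t * cis (v * t) \<partial>lborel))\<^sup>2"
        using 1 unfolding 2 unfolding 3 by simp
      have "y = 1 / c * x" if "c * y = x" "c \<noteq> 0" for c x y :: real
        using that by auto
      from this[OF 4] show ?thesis by simp
    qed
    have "(\<integral>\<^sup>+v. ennreal ((h \<epsilon> v)\<^sup>2 * exp (2 * d * v) * gauss \<epsilon> v) \<partial>lborel) =
      (\<integral>\<^sup>+v. ennreal (1 / (2 * pi)\<^sup>2) * ennreal ((norm (\<integral>t. H t * cis (v * t) \<partial>lborel))\<^sup>2 * gauss \<epsilon> v) \<partial>lborel)"
      unfolding sq by (simp add: mult.assoc flip: ennreal_mult)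
    also have "\<dots> = ennreal (1 / (2 * pi)\<^sup>2) * (\<integral>\<^sup>+v. ennreal ((norm (\<integral>t. H t * cis (v * t) \<partial>lborel))\<^sup>2 * gauss \<epsilon> v) \<partial>lborel)"
    proof (rule nn_integral_cmult)
      have [measurable]: "H \<in> borel_measurable borel" using H by simp
      have [measurable]: "cis \<in> borel_measurable borel" 
        by (intro borel_measurable_continuous_onI continuous_intros)
      show "(\<lambda>v. ennreal ((norm (\<integral>t. H t * cis (v * t) \<partial>lborel))\<^sup>2 * gauss \<epsilon> v)) \<in> borel_measurable lborel"
        by measurable
    qed
    also have "\<dots> \<le> ennreal (1 / (2 * pi)\<^sup>2) * (ennreal (2 * pi) * (\<integral>\<^sup>+t. ennreal ((norm (H t))\<^sup>2) \<partial>lborel))"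
      by (intro mult_left_mono fourier_gaussian_mean_square[OF H \<epsilon>]) auto
    also have "\<dots> \<le> ennreal (1 / (2 * pi)\<^sup>2) * (ennreal (2 * pi) * (\<integral>\<^sup>+t. ennreal (exp (\<epsilon>\<^sup>2 * d\<^sup>2)) * ennreal ((norm (F (Complex \<sigma>1 t)))\<^sup>2) \<partial>lborel))"
    proof (intro mult_left_mono nn_integral_mono)
      fix t
      have "norm (H t) = norm (F (Complex \<sigma>1 t)) * (exp (\<epsilon>\<^sup>2 / 2 * d\<^sup>2) * gauss \<epsilon> t)"
        unfolding H_def norm_mult normexp by simp
      also have "\<dots> \<le> norm (F (Complex \<sigma>1 t)) * (exp (\<epsilon>\<^sup>2 / 2 * d\<^sup>2) * 1)"
        by (intro mult_left_mono) auto
      finally have "(norm (H t))\<^sup>2 \<le> (norm (F (Complex \<sigma>1 t)) * exp (\<epsilon>\<^sup>2 / 2 * d\<^sup>2))\<^sup>2"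
        by (intro power_mono) auto
      also have "\<dots> = exp (\<epsilon>\<^sup>2 * d\<^sup>2) * (norm (F (Complex \<sigma>1 t)))\<^sup>2"
        by (simp add: power_mult_distrib flip: exp_double)
      finally show "ennreal ((norm (H t))\<^sup>2) \<le> ennreal (exp (\<epsilon>\<^sup>2 * d\<^sup>2)) * ennreal ((norm (F (Complex \<sigma>1 t)))\<^sup>2)"
        by (simp flip: ennreal_mult)
    qed auto
    also have "(\<integral>\<^sup>+t. ennreal (exp (\<epsilon>\<^sup>2 * d\<^sup>2)) * ennreal ((norm (F (Complex \<sigma>1 t)))\<^sup>2) \<partial>lborel) = ennreal (exp (\<epsilon>\<^sup>2 * d\<^sup>2)) * J"
      unfolding J_def
    proof (rule nn_integral_cmult)
      have "continuous_on UNIV (\<lambda>t. F (Complex \<sigma>1 t))"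
        by (rule continuous_on_compose2[OF holomorphic_on_imp_continuous_on[OF hol]])
           (use le sub in \<open>auto simp: Complex_eq intro!: continuous_intros\<close>)
      from borel_measurable_continuous_onI[OF this]
      have [measurable]: "(\<lambda>t. F (Complex \<sigma>1 t)) \<in> borel_measurable borel" .
      show "(\<lambda>t. ennreal ((norm (F (Complex \<sigma>1 t)))\<^sup>2)) \<in> borel_measurable lborel" by measurable
    qed
    also have "ennreal (1 / (2 * pi)\<^sup>2) * (ennreal (2 * pi) * (ennreal (exp (\<epsilon>\<^sup>2 * d\<^sup>2)) * J)) = ennreal (exp (\<epsilon>\<^sup>2 * d\<^sup>2) / (2 * pi)) * J"
      by (simp add: mult.assoc[symmetric] power2_eq_square flip: ennreal_mult)
    finally show ?thesis .
  qed
  define e where "e = (\<lambda>n. 1 / real (Suc n))"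
  have e: "e n > 0" "e \<longlonglongrightarrow> 0" for n
    unfolding e_def by (simp, rule LIMSEQ_Suc[OF lim_1_over_n])
  define u where "u = (\<lambda>n v. (h (e n) v)\<^sup>2 * exp (2 * d * v) * gauss (e n) v)"
  have [measurable]: "(\<lambda>v. u n v) \<in> borel_measurable lborel" for n unfolding u_def h_def by measurable
  have lim: "AE v in lborel. ennreal ((f v)\<^sup>2 * exp (- (2 * \<sigma>1 * v))) = liminf (\<lambda>n. ennreal (u n v))"
    using cont
  proof eventually_elim
    case (elim v)
    have "isCont g v" unfolding g_def by (intro continuous_intros elim)
    hence hl: "(\<lambda>n. h (e n) v) \<longlonglongrightarrow> g v"
      unfolding h_def by (intro gaussian_convolution_tendsto[OF g _ _ e(2)]) (use bdf in \<open>auto simp: g_def\<close>)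
    have "(\<lambda>n. u n v) \<longlonglongrightarrow> (g v)\<^sup>2 * exp (2 * d * v) * exp (- (0 * v)\<^sup>2 / 2)"
      unfolding u_def by (intro tendsto_intros hl e) auto
    also have "(g v)\<^sup>2 * exp (2 * d * v) * exp (- (0 * v)\<^sup>2 / 2) = (f v)\<^sup>2 * ((exp (- (\<sigma>0 * v)))\<^sup>2 * exp (2 * d * v))"
      by (simp add: g_def power_mult_distrib)
    also have "(exp (- (\<sigma>0 * v)))\<^sup>2 * exp (2 * d * v) = exp (- (2 * \<sigma>1 * v))"
      by (simp add: d_def algebra_simps flip: exp_double exp_add)
    finally have "(\<lambda>n. ennreal (u n v)) \<longlonglongrightarrow> ennreal ((f v)\<^sup>2 * exp (- (2 * \<sigma>1 * v)))"
      by (rule tendsto_ennrealI)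
    thus ?case by (simp add: lim_imp_Liminf)
  qed
  have "(\<integral>\<^sup>+v. ennreal ((f v)\<^sup>2 * exp (- (2 * \<sigma>1 * v))) \<partial>lborel) = (\<integral>\<^sup>+v. liminf (\<lambda>n. ennreal (u n v)) \<partial>lborel)"
    by (rule nn_integral_cong_AE[OF lim])
  also have "\<dots> \<le> liminf (\<lambda>n. \<integral>\<^sup>+v. ennreal (u n v) \<partial>lborel)"
    by (rule nn_integral_liminf) measurable
  also have "\<dots> \<le> liminf (\<lambda>n. ennreal (exp ((e n)\<^sup>2 * d\<^sup>2) / (2 * pi)) * J)"
    unfolding u_def by (intro Liminf_mono always_eventually allI key e(1))
  also have "\<dots> \<le> ennreal (1 / (2 * pi)) * J"
  proof (cases "J = \<infinity>")
    case True
    thus ?thesis by (simp add: ennreal_mult_top)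
  next
    case False
    have "(\<lambda>n. exp ((e n)\<^sup>2 * d\<^sup>2) / (2 * pi)) \<longlonglongrightarrow> exp (0\<^sup>2 * d\<^sup>2) / (2 * pi)"
      by (intro tendsto_intros e) auto
    hence "(\<lambda>n. ennreal (exp ((e n)\<^sup>2 * d\<^sup>2) / (2 * pi))) \<longlonglongrightarrow> ennreal (1 / (2 * pi))"
      by (intro tendsto_ennrealI) simp
    hence "(\<lambda>n. ennreal (exp ((e n)\<^sup>2 * d\<^sup>2) / (2 * pi)) * J) \<longlonglongrightarrow> ennreal (1 / (2 * pi)) * J"
      by (intro tendsto_mult_ennreal tendsto_const) (use False in auto)
    thus ?thesis by (simp add: lim_imp_Liminf)
  qed
  finally show ?thesis by (simp add: J_def)
qed

section \<open>The Laplace transform of the error term of the prime number theorem\<close>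

lemma exp_tail_integral:
  fixes s :: complex
  assumes s: "Re s > 0"
  shows "integrable lborel (\<lambda>v. indicat_real {a..} v * exp (- (Re s * v)))"
    and "(\<integral>v. indicat_real {a..} v * exp (- (Re s * v)) \<partial>lborel) = exp (- (Re s * a)) / Re s"
    and "integrable lborel (\<lambda>v. of_real (indicat_real {a..} v) * exp (- (s * of_real v)))"
    and "(\<integral>v. of_real (indicat_real {a..} v) * exp (- (s * of_real v)) \<partial>lborel) = exp (- (s * of_real a)) / s"
proof -
  have lim: "((\<lambda>v. - exp (- (Re s * v)) / Re s) \<longlongrightarrow> 0) at_top"
    using s by real_asymp
  have "(\<integral>\<^sup>+v\<in>{a..}. ennreal (exp (- (Re s * v))) \<partial>lborel) = ennreal (0 - (- exp (- (Re s * a)) / Re s))"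
    by (rule nn_integral_FTC_atLeast[OF _ _ _ lim]) (use s in \<open>auto intro!: derivative_eq_intros\<close>)
  hence nn: "(\<integral>\<^sup>+v. ennreal (indicat_real {a..} v * exp (- (Re s * v))) \<partial>lborel) = ennreal (exp (- (Re s * a)) / Re s)"
  proof -
    have "ennreal (indicat_real {a..} v * exp (- (Re s * v))) = ennreal (exp (- (Re s * v))) * indicator {a..} v" for v
      by (auto simp: indicator_def)
    thus ?thesis using \<open>_ = ennreal (0 - _)\<close> by (simp only:) simp
  qed
  show 1: "integrable lborel (\<lambda>v. indicat_real {a..} v * exp (- (Re s * v)))"
    by (rule integrableI_nonneg) (auto simp: nn)
  show "(\<integral>v. indicat_real {a..} v * exp (- (Re s * v)) \<partial>lborel) = exp (- (Re s * a)) / Re s"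
    by (subst integral_eq_nn_integral) (use s in \<open>auto simp: nn\<close>)
  show 2: "integrable lborel (\<lambda>v. of_real (indicat_real {a..} v) * exp (- (s * of_real v)))"
    by (rule Bochner_Integration.integrable_bound[OF 1]) (auto simp: norm_mult norm_exp_eq_Re)
  have "(LBINT v=ereal a..\<infinity>. exp (- (s * of_real v))) = 0 - (- exp (- (s * of_real a)) / s)"
  proof (rule interval_integral_FTC_integrable)
    show "((\<lambda>v. - exp (- (s * of_real v)) / s) has_vector_derivative exp (- (s * of_real v))) (at v)" for v :: real
      using s by (auto intro!: derivative_eq_intros has_vector_derivative_real_field)
    show "set_integrable lborel (einterval (ereal a) \<infinity>) (\<lambda>v. exp (- (s * complex_of_real v)))"
      by (rule set_integrable_subset[where A = "{a..}"])
         (use 2 in \<open>auto simp: set_integrable_def scaleR_conv_of_real\<close>)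
    show "(((\<lambda>v. - exp (- (s * complex_of_real v)) / s) \<circ> real_of_ereal) \<longlongrightarrow> - exp (- (s * complex_of_real a)) / s) (at_right (ereal a))"
      unfolding ereal_tendsto_simps using s by (intro tendsto_intros) auto
    have "((\<lambda>v. - exp (- (s * complex_of_real v)) / s) \<longlongrightarrow> 0) at_top"
    proof (rule Lim_null_comparison)
      show "\<forall>\<^sub>F v in at_top. norm (- exp (- (s * complex_of_real v)) / s) \<le> exp (- (Re s * v)) / norm s"
        by (auto simp: norm_divide norm_exp_eq_Re)
      have "norm s > 0" using s by auto
      thus "((\<lambda>v. exp (- (Re s * v)) / norm s) \<longlongrightarrow> 0) at_top" using s by real_asymp
    qed
    thus "(((\<lambda>v. - exp (- (s * complex_of_real v)) / s) \<circ> real_of_ereal) \<longlongrightarrow> 0) (at_left \<infinity>)"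
      unfolding ereal_tendsto_simps .
  qed (auto intro!: continuous_intros)
  hence "(LBINT v:{a<..}. exp (- (s * of_real v))) = exp (- (s * of_real a)) / s"
    by (simp add: interval_integral_to_infinity_eq)
  moreover have "(\<integral>v. of_real (indicat_real {a..} v) * exp (- (s * of_real v)) \<partial>lborel) = (LBINT v:{a<..}. exp (- (s * of_real v)))"
    unfolding set_lebesgue_integral_def
  proof (rule integral_cong_AE)
    have "AE v in lborel. v \<noteq> a" by (rule AE_lborel_singleton)
    thus "AE v in lborel. of_real (indicat_real {a..} v) * exp (- (s * of_real v)) = indicat_real {a<..} v *\<^sub>R exp (- (s * of_real v))"
      by eventually_elim (auto simp: indicator_def)
  qed auto
  ultimately show "(\<integral>v. of_real (indicat_real {a..} v) * exp (- (s * of_real v)) \<partial>lborel) = exp (- (s * of_real a)) / s"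
    by simp
qed

definition chebyshev_psi :: "real \<Rightarrow> real" where
  "chebyshev_psi x = (\<Sum>n | real n \<le> x. mangoldt n)"

abbreviation psi_window_error :: "real \<Rightarrow> real \<Rightarrow> real" where
  "psi_window_error c x \<equiv> chebyshev_psi (x + c * sqrt x) - chebyshev_psi x - c * sqrt x"

lemma finite_nat_le_real [simp]: "finite {n. real n \<le> x}"
  by (rule finite_subset[of _ "{..nat \<lfloor>x\<rfloor>}"]) (auto simp: le_nat_floor)

lemma chebyshev_psi_mono: "mono chebyshev_psi"
  unfolding chebyshev_psi_def by (intro monoI sum_mono2) (auto intro: mangoldt_nonneg)

lemma chebyshev_psi_nonneg: "chebyshev_psi x \<ge> 0"
  unfolding chebyshev_psi_def by (intro sum_nonneg mangoldt_nonneg)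

lemma chebyshev_psi_le:
  assumes "x \<ge> 1" shows "chebyshev_psi x \<le> x * ln x"
proof -
  have "chebyshev_psi x = (\<Sum>n\<in>{1..nat \<lfloor>x\<rfloor>}. mangoldt n)"
    unfolding chebyshev_psi_def
  proof (rule sum.mono_neutral_right)
    show "{1..nat \<lfloor>x\<rfloor>} \<subseteq> {n. real n \<le> x}"
      using of_nat_floor[of x] assms by (auto intro: order_trans[OF of_nat_mono])
    show "\<forall>n\<in>{n. real n \<le> x} - {1..nat \<lfloor>x\<rfloor>}. mangoldt n = (0::real)"
      using le_nat_floor[of _ x] by (auto simp: not_less_eq_eq)
  qed simp
  also have "\<dots> \<le> (\<Sum>n\<in>{1..nat \<lfloor>x\<rfloor>}. ln x)"
  proof (rule sum_mono)
    fix n assume n: "n \<in> {1..nat \<lfloor>x\<rfloor>}"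
    hence "real n \<le> x" using of_nat_floor[of x] assms by (auto intro: order_trans[OF of_nat_mono])
    moreover have "mangoldt n \<le> ln (real n)" using n by (intro mangoldt_le) auto
    ultimately show "mangoldt n \<le> ln x" using n assms by (auto intro: order_trans)
  qed
  also have "\<dots> \<le> x * ln x" using assms by (auto intro!: mult_right_mono)
  finally show ?thesis .
qed

lemma chebyshev_psi_eq_0: "x < 1 \<Longrightarrow> chebyshev_psi x = 0"
  unfolding chebyshev_psi_def
proof (rule sum.neutral, safe)
  fix n assume "x < 1" "real n \<le> x"
  hence "n = 0" by linarith
  thus "mangoldt n = (0::real)" by simp
qed

text \<open>
  Each prime power \<open>n\<close> contributes the exponential tail that begins at \<open>ln n\<close>.
\<close>

lemma chebyshev_psi_laplace:
  assumes s: "Re s > 1"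
  shows "integrable lborel (\<lambda>v. of_real (chebyshev_psi (exp v)) * exp (- (s * of_real v)))"
    and "(\<integral>v. of_real (chebyshev_psi (exp v)) * exp (- (s * of_real v)) \<partial>lborel) = mangoldt_series s / s"
proof -
  define f where "f = (\<lambda>n v. mangoldt n * (of_real (indicat_real {ln (real n)..} v) * exp (- (s * of_real v))) :: complex)"
  have sp: "Re s > 0" using s by simp
  have f_int: "integrable lborel (f n)" for n
    unfolding f_def by (intro integrable_mult_right exp_tail_integral(3) sp)
  have pw: "(\<lambda>n. f n v) sums (of_real (chebyshev_psi (exp v)) * exp (- (s * of_real v)))"
    and pwn: "summable (\<lambda>n. norm (f n v))" for v
  proof -
    have z: "f n v = 0" if "n \<notin> {n. real n \<le> exp v}" for n
    proof -
      have "ln (real n) > v" using that ln_less_cancel_iff[of "exp v" "real n"] exp_gt_zero[of v]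
        by (simp add: not_le del: exp_gt_zero ln_less_cancel_iff)
      thus ?thesis by (simp add: f_def)
    qed
    have "(\<lambda>n. f n v) sums (\<Sum>n | real n \<le> exp v. f n v)"
      by (rule sums_finite) (use z in auto)
    also have "(\<Sum>n | real n \<le> exp v. f n v) = (\<Sum>n | real n \<le> exp v. of_real (mangoldt n) * exp (- (s * of_real v)))"
    proof (rule sum.cong)
      fix n assume n: "n \<in> {n. real n \<le> exp v}"
      show "f n v = of_real (mangoldt n) * exp (- (s * of_real v))"
      proof (cases "n = 0")
        case False
        hence "ln (real n) \<le> v" using n ln_le_cancel_iff[of "real n" "exp v"] by simp
        thus ?thesis by (simp add: f_def)
      qed (simp add: f_def)
    qed simp
    also have "\<dots> = of_real (chebyshev_psi (exp v)) * exp (- (s * of_real v))"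
      unfolding chebyshev_psi_def of_real_sum sum_distrib_right ..
    finally show "(\<lambda>n. f n v) sums (of_real (chebyshev_psi (exp v)) * exp (- (s * of_real v)))" .
    show "summable (\<lambda>n. norm (f n v))"
      by (rule summable_finite[of "{n. real n \<le> exp v}"]) (use z in auto)
  qed
  have nint: "(\<integral>v. norm (f n v) \<partial>lborel) = mangoldt n * real n powr (- Re s) / Re s" for n
  proof (cases "n = 0")
    case False
    have "(\<integral>v. norm (f n v) \<partial>lborel) = (\<integral>v. mangoldt n * (indicat_real {ln (real n)..} v * exp (- (Re s * v))) \<partial>lborel)"
      by (intro Bochner_Integration.integral_cong) (auto simp: f_def norm_mult norm_exp_eq_Re)
    also have "\<dots> = mangoldt n * (exp (- (Re s * ln (real n))) / Re s)"
      using exp_tail_integral(2)[OF sp] by simp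
    finally show ?thesis using False by (simp add: powr_def)
  qed (simp add: f_def)
  have "summable (\<lambda>n. mangoldt n * real n powr (- Re s))"
    using Re_mangoldt_series_sums[of "of_real (Re s)"] s by (simp add: sums_iff)
  hence nsum: "summable (\<lambda>n. \<integral>v. norm (f n v) \<partial>lborel)"
    unfolding nint by (rule summable_divide)
  have eq: "(\<lambda>v. \<Sum>n. f n v) = (\<lambda>v. of_real (chebyshev_psi (exp v)) * exp (- (s * of_real v)))"
    using pw by (auto simp: sums_iff)
  show "integrable lborel (\<lambda>v. of_real (chebyshev_psi (exp v)) * exp (- (s * of_real v)))"
    unfolding eq[symmetric] by (rule integrable_suminf[OF f_int _ nsum]) (use pwn in auto)
  have "(\<lambda>n. integral\<^sup>L lborel (f n)) sums (\<integral>v. (\<Sum>n. f n v) \<partial>lborel)"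
    by (rule sums_integral[OF f_int _ nsum]) (use pwn in auto)
  moreover have "integral\<^sup>L lborel (f n) = mangoldt n * of_nat n powr (- s) / s" for n
  proof (cases "n = 0")
    case False
    have "integral\<^sup>L lborel (f n) = mangoldt n * (exp (- (s * of_real (ln (real n)))) / s)"
      unfolding f_def using exp_tail_integral(4)[OF sp] by simp
    thus ?thesis using False by (simp add: powr_def Ln_of_nat)
  qed (simp add: f_def[abs_def])
  ultimately have "(\<lambda>n. mangoldt n * of_nat n powr (- s) / s) sums (\<integral>v. (\<Sum>n. f n v) \<partial>lborel)" by simp
  moreover have "(\<lambda>n. mangoldt n * of_nat n powr (- s) / s) sums (mangoldt_series s / s)"
    by (intro sums_divide has_sum_imp_sums[OF mangoldt_series_has_sum[OF s]])
  ultimately show "(\<integral>v. of_real (chebyshev_psi (exp v)) * exp (- (s * of_real v)) \<partial>lborel) = mangoldt_series s / s"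
    unfolding eq using sums_unique2 by blast
qed

text \<open>
  The error term of the prime number theorem in the variable \<open>v = ln x\<close>. The main term is
  cut off below \<open>v = 0\<close>, where the integral of its Laplace transform would diverge.
\<close>

definition psi_error :: "real \<Rightarrow> real" where
  "psi_error v = chebyshev_psi (exp v) - (if v \<ge> 0 then exp v else 0)"

abbreviation psi_increment :: "real \<Rightarrow> real \<Rightarrow> real" where
  "psi_increment \<tau> v \<equiv> psi_error (v + \<tau>) - psi_error v"

lemma psi_error_measurable [measurable]: "psi_error \<in> borel_measurable borel"
proof -
  have [measurable]: "chebyshev_psi \<in> borel_measurable borel"
    by (rule borel_measurable_mono[OF chebyshev_psi_mono])
  show ?thesis unfolding psi_error_def by measurable
qed

text \<open>
  A difference of two monotone functions has countably many discontinuities.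
\<close>

lemma psi_error_continuous_AE: "AE v in lborel. isCont psi_error v"
proof -
  have "mono (\<lambda>v. chebyshev_psi (exp v))"
    using chebyshev_psi_mono by (auto simp: mono_def)
  hence c1: "countable {v. \<not> isCont (\<lambda>v. chebyshev_psi (exp v)) v}" by (rule mono_ctble_discont)
  have "mono (\<lambda>v::real. if v \<ge> 0 then exp v else 0)" by (auto simp: mono_def)
  hence c2: "countable {v::real. \<not> isCont (\<lambda>v. if v \<ge> 0 then exp v else 0) v}" by (rule mono_ctble_discont)
  have "{v. \<not> isCont psi_error v} \<subseteq> {v. \<not> isCont (\<lambda>v. chebyshev_psi (exp v)) v} \<union> {v::real. \<not> isCont (\<lambda>v. if v \<ge> 0 then exp v else 0) v}"
    unfolding psi_error_def[abs_def] by (auto intro: continuous_diff)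
  hence "countable {v. \<not> isCont psi_error v}" using c1 c2 by (meson countable_Un countable_subset)
  hence "{v. \<not> isCont psi_error v} \<in> null_sets lborel" by (rule countable_imp_null_set_lborel)
  thus ?thesis by (rule AE_I') auto
qed

lemma psi_error_le: "\<bar>psi_error v\<bar> * exp (- (2 * v)) \<le> 1"
proof (cases "v \<ge> 0")
  case True
  have "chebyshev_psi (exp v) \<le> exp v * v" "psi_error v = chebyshev_psi (exp v) - exp v"
    using chebyshev_psi_le[of "exp v"] True by (auto simp: psi_error_def)
  hence "psi_error v \<le> exp v * v" using exp_gt_zero[of v] by linarith
  also have "v \<le> exp v" using exp_ge_add_one_self[of v] by linarith
  hence "exp v * v \<le> exp v * exp v" by (intro mult_left_mono) auto
  finally have 1: "psi_error v \<le> exp v * exp v" .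
  have "- psi_error v \<le> exp v" using True chebyshev_psi_nonneg[of "exp v"] by (simp add: psi_error_def)
  also have "\<dots> \<le> exp v * exp v" using True by (simp add: mult_le_cancel_left1)
  finally have "\<bar>psi_error v\<bar> \<le> exp v * exp v" using 1 by linarith
  hence "\<bar>psi_error v\<bar> \<le> exp (2 * v)" by (simp flip: exp_add)
  thus ?thesis by (simp add: exp_minus field_simps)
qed (simp add: psi_error_def chebyshev_psi_eq_0)

text \<open>
  The transform \<open>1 / (s - 1)\<close> of the main term cancels the pole of the Dirichlet series. What remains
  is given by \<open>zeta_reg\<close> and continues to every zero-free region.
\<close>

lemma psi_error_laplace:
  assumes s: "Re s > 1"
  shows "integrable lborel (\<lambda>v. of_real (psi_error v) * exp (- (s * of_real v)))"
    and "(\<integral>v. of_real (psi_error v) * exp (- (s * of_real v)) \<partial>lborel) = - (1 + zeta_logderiv s) / s"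
proof -
  have s1: "Re (s - 1) > 0" using s by simp
  have eq: "of_real (psi_error v) * exp (- (s * of_real v)) = 
     of_real (chebyshev_psi (exp v)) * exp (- (s * of_real v)) - of_real (indicat_real {0..} v) * exp (- ((s - 1) * of_real v))" for v
  proof -
    have "exp (of_real v) * exp (- (s * of_real v)) = exp (- ((s - 1) * of_real v))"
      by (simp add: algebra_simps flip: exp_add)
    thus ?thesis by (simp add: psi_error_def left_diff_distrib flip: exp_of_real)
  qed
  show "integrable lborel (\<lambda>v. of_real (psi_error v) * exp (- (s * of_real v)))"
    unfolding eq by (intro Bochner_Integration.integrable_diff chebyshev_psi_laplace(1) exp_tail_integral(3) s s1)
  have "(\<integral>v. of_real (psi_error v) * exp (- (s * of_real v)) \<partial>lborel) = mangoldt_series s / s - 1 / (s - 1)"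
    unfolding eq using chebyshev_psi_laplace[OF s] exp_tail_integral(3,4)[OF s1, of 0]
    by (subst Bochner_Integration.integral_diff) auto
  moreover have nz: "s \<noteq> 0" "s - 1 \<noteq> 0" using s by auto
  moreover have "mangoldt_series s = 1 / (s - 1) - zeta_logderiv s"
    using zeta_reg_logderiv_eq[OF s zeta_nonzero_right[OF s]] by simp
  moreover have alg: "(1 / x - d) / y - 1 / x = - (1 + d) / y" if "x \<noteq> 0" "y \<noteq> 0" "y = x + 1" for x y d :: complex
  proof -
    have "(1 / x - d) / y - 1 / x = (1 / x - d - y / x) / y" using that(1,2) by (simp add: diff_divide_distrib)
    also have "y / x = 1 + 1 / x" unfolding that(3) using that(1) by (simp add: add_divide_distrib)
    finally show ?thesis by simp
  qed
  ultimately show "(\<integral>v. of_real (psi_error v) * exp (- (s * of_real v)) \<partial>lborel) = - (1 + zeta_logderiv s) / s"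
    using alg[of "s - 1" s "zeta_logderiv s"] by simp
qed

lemma psi_error_shift_laplace:
  assumes s: "Re s > 1"
  shows "integrable lborel (\<lambda>v. of_real (psi_increment \<tau> v) * exp (- (s * of_real v)))"
    and "(\<integral>v. of_real (psi_increment \<tau> v) * exp (- (s * of_real v)) \<partial>lborel) =
          - (exp (s * of_real \<tau>) - 1) / s * (1 + zeta_logderiv s)"
proof -
  define f where "f = (\<lambda>v. of_real (psi_error v) * exp (- (s * of_real v)) :: complex)"
  have f: "integrable lborel f" unfolding f_def by (rule psi_error_laplace(1)[OF s])
  have eq: "of_real (psi_increment \<tau> v) * exp (- (s * of_real v)) = exp (s * of_real \<tau>) * f (\<tau> + 1 * v) - f v" for v
    by (simp add: f_def algebra_simps flip: exp_add)
  have i: "integrable lborel (\<lambda>v. f (\<tau> + 1 * v))" by (intro lborel_integrable_real_affine f) auto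
  show "integrable lborel (\<lambda>v. of_real (psi_increment \<tau> v) * exp (- (s * of_real v)))"
    unfolding eq by (intro Bochner_Integration.integrable_diff integrable_mult_right i f)
  have "(\<integral>v. of_real (psi_increment \<tau> v) * exp (- (s * of_real v)) \<partial>lborel) =
      exp (s * of_real \<tau>) * (\<integral>v. f (\<tau> + 1 * v) \<partial>lborel) - (\<integral>v. f v \<partial>lborel)"
    unfolding eq using i f by (subst Bochner_Integration.integral_diff) auto
  also have "(\<integral>v. f (\<tau> + 1 * v) \<partial>lborel) = (\<integral>v. f v \<partial>lborel)"
    using lborel_integral_real_affine[of 1 f \<tau>] by simp
  also have "(\<integral>v. f v \<partial>lborel) = - (1 + zeta_logderiv s) / s"
    unfolding f_def by (rule psi_error_laplace(2)[OF s])
  also have "exp (s * of_real \<tau>) * (- (1 + zeta_logderiv s) / s) - (- (1 + zeta_logderiv s) / s)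
      = - (exp (s * of_real \<tau>) - 1) / s * (1 + zeta_logderiv s)"
  proof -
    have "e * (- d / s) - (- d / s) = - (e - 1) / s * d" for e d :: complex
      by (simp add: diff_divide_distrib algebra_simps)
    thus ?thesis .
  qed
  finally show "(\<integral>v. of_real (psi_increment \<tau> v) * exp (- (s * of_real v)) \<partial>lborel) =
          - (exp (s * of_real \<tau>) - 1) / s * (1 + zeta_logderiv s)" .
qed

section \<open>Mean squares over constant shifts\<close>

lemma norm_exp_minus_one_le:
  fixes z :: complex
  assumes "Re z \<ge> 0" shows "norm (exp z - 1) \<le> exp (Re z) * norm z"
proof -
  have "norm (exp z - exp 0) \<le> exp (Re z) * norm (z - 0)"
  proof (rule field_differentiable_bound[where S = "{w. Re w \<le> Re z}" and f' = exp])
    show "(exp has_field_derivative exp w) (at w within {w. Re w \<le> Re z})" for w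
      by (auto intro!: derivative_eq_intros)
  qed (use assms in \<open>auto simp: norm_exp_eq_Re intro: convex_halfspace_Re_le\<close>)
  thus ?thesis by simp
qed

text \<open>
  The quotient is of order \<open>\<delta>\<close> by the mean value theorem and of order \<open>1 / |Im s|\<close> by the triangle
  inequality. The right-hand side is the smaller of the two up to a constant.
\<close>

lemma difference_kernel_bound:
  assumes \<tau>: "0 \<le> \<tau>" "\<tau> \<le> \<delta>" and \<delta>: "0 < \<delta>" "\<delta> \<le> 1 / 4" and s: "1 / 2 \<le> Re s" "Re s \<le> 2"
  shows "norm ((exp (s * of_real \<tau>) - 1) / s) \<le> 8 * \<delta> / (1 + \<delta> * \<bar>Im s\<bar>)"
proof -
  have ns: "norm s > 0" using s by auto
  have t: "\<bar>Im s\<bar> \<le> norm s" by (rule abs_Im_le_cmod)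
  have "Re s * \<tau> \<le> 2 * (1 / 4)" using \<tau> \<delta> s by (intro mult_mono) auto
  hence "exp (Re s * \<tau>) \<le> exp 1" by simp
  also have "exp 1 \<le> (3::real)" by (rule exp_le)
  finally have e: "exp (Re s * \<tau>) \<le> 3" .
  have "norm (exp (s * of_real \<tau>) - 1) \<le> exp (Re (s * of_real \<tau>)) * norm (s * of_real \<tau>)"
    using \<tau> s by (intro norm_exp_minus_one_le) auto
  also have "\<dots> = exp (Re s * \<tau>) * (norm s * \<tau>)" using \<tau> by (simp add: norm_mult)
  also have "\<dots> \<le> 3 * (norm s * \<delta>)" using e \<tau> by (intro mult_mono) auto
  finally have 0: "norm (exp (s * of_real \<tau>) - 1) \<le> 3 * (norm s * \<delta>)" .
  have 1: "norm ((exp (s * of_real \<tau>) - 1) / s) \<le> 4 * \<delta>"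
  proof -
    have "0 \<le> norm s * \<delta>" using \<delta> by simp
    moreover have "4 * \<delta> * norm s = 4 * (norm s * \<delta>)" by simp
    ultimately have "3 * (norm s * \<delta>) \<le> 4 * \<delta> * norm s" by linarith
    hence "norm (exp (s * of_real \<tau>) - 1) \<le> 4 * \<delta> * norm s" using 0 by linarith
    thus ?thesis using ns by (simp add: norm_divide divide_le_eq)
  qed
  have "norm (exp (s * of_real \<tau>) - 1) \<le> norm (exp (s * of_real \<tau>)) + 1"
    using norm_triangle_ineq4[of "exp (s * of_real \<tau>)" 1] by simp
  also have "\<dots> \<le> 4" using e by (simp add: norm_exp_eq_Re)
  finally have 2: "norm ((exp (s * of_real \<tau>) - 1) / s) \<le> 4 / norm s"
    using ns by (simp add: norm_divide divide_right_mono)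
  show ?thesis
  proof (cases "\<delta> * \<bar>Im s\<bar> \<le> 1")
    case True
    have "4 * \<delta> * (1 + \<delta> * \<bar>Im s\<bar>) \<le> 4 * \<delta> * 2" using True \<delta> by (intro mult_left_mono) auto
    hence "4 * \<delta> \<le> 8 * \<delta> / (1 + \<delta> * \<bar>Im s\<bar>)" using \<delta> by (subst pos_le_divide_eq) (auto intro: add_pos_nonneg)
    thus ?thesis using 1 by linarith
  next
    case False
    have "4 / norm s \<le> 4 / \<bar>Im s\<bar>" using t False ns \<delta> by (intro divide_left_mono) (auto intro!: mult_pos_pos)
    also have "\<dots> = 8 * \<delta> / (\<delta> * \<bar>Im s\<bar> + \<delta> * \<bar>Im s\<bar>)" using \<delta> by simp
    also have "\<dots> \<le> 8 * \<delta> / (1 + \<delta> * \<bar>Im s\<bar>)"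
      using False \<delta> by (intro divide_left_mono) (auto intro!: mult_pos_pos add_pos_nonneg simp: zero_less_mult_iff)
    finally show ?thesis using 2 by linarith
  qed
qed

text \<open>
  In the scaled variable \<open>\<delta> t\<close> the logarithm splits into \<open>ln (1 / \<delta>)\<close> and a term that a small power
  absorbs. With the exponent \<open>1/4\<close> the square of the transform below still decays like the integrable
  function \<open>(1 + \<delta> |t|) powr (- 3/2)\<close>.
\<close>

lemma ln_scaled_bound:
  fixes \<delta> t :: real
  assumes \<delta>: "0 < \<delta>" "\<delta> \<le> 1 / 4"
  shows "ln (\<bar>t\<bar> + 4) \<le> 5 * ln (1 / \<delta>) * (1 + \<delta> * \<bar>t\<bar>) powr (1 / 4)" "ln (1 / \<delta>) \<ge> 1"
proof -
  have p: "1 + \<delta> * \<bar>t\<bar> \<ge> 1" using \<delta> by simp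
  have "4 \<le> 1 / \<delta>" using \<delta> by (simp add: field_simps)
  hence "exp 1 \<le> 1 / \<delta>" using exp_le by linarith
  thus L: "ln (1 / \<delta>) \<ge> 1" using \<delta> by (subst ln_ge_iff) auto
  have "\<bar>t\<bar> + 4 \<le> 1 / \<delta> * (1 + \<delta> * \<bar>t\<bar>)" using \<delta> by (simp add: field_simps)
  hence "ln (\<bar>t\<bar> + 4) \<le> ln (1 / \<delta> * (1 + \<delta> * \<bar>t\<bar>))" by (subst ln_le_cancel_iff) auto
  also have "\<dots> = ln (1 / \<delta>) + ln (1 + \<delta> * \<bar>t\<bar>)" proof -
    have "1 + \<delta> * \<bar>t\<bar> > 0" using p by linarith
    thus ?thesis using \<delta> by (subst ln_mult) auto
  qed
  also have "ln (1 + \<delta> * \<bar>t\<bar>) \<le> (1 + \<delta> * \<bar>t\<bar>) powr (1 / 4) / (1 / 4)"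
    using p by (intro ln_powr_bound) auto
  finally have 1: "ln (\<bar>t\<bar> + 4) \<le> ln (1 / \<delta>) + 4 * (1 + \<delta> * \<bar>t\<bar>) powr (1 / 4)" by simp
  have q: "(1 + \<delta> * \<bar>t\<bar>) powr (1 / 4) \<ge> 1" using p by (intro ge_one_powr_ge_zero) auto
  have "ln (1 / \<delta>) * 1 \<le> ln (1 / \<delta>) * (1 + \<delta> * \<bar>t\<bar>) powr (1 / 4)" using L q by (intro mult_left_mono) auto
  moreover have "1 * (1 + \<delta> * \<bar>t\<bar>) powr (1 / 4) \<le> ln (1 / \<delta>) * (1 + \<delta> * \<bar>t\<bar>) powr (1 / 4)"
    using L by (intro mult_right_mono) auto
  ultimately show "ln (\<bar>t\<bar> + 4) \<le> 5 * ln (1 / \<delta>) * (1 + \<delta> * \<bar>t\<bar>) powr (1 / 4)"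
    using 1 by (simp add: algebra_simps)
qed

lemma nn_integral_even_tail:
  assumes \<delta>: "\<delta> > 0"
  shows "(\<integral>\<^sup>+t. ennreal ((1 + \<delta> * \<bar>t\<bar>) powr (- 3 / 2)) \<partial>lborel) \<le> ennreal (4 / \<delta>)"
proof -
  define f where "f = (\<lambda>t. (1 + \<delta> * \<bar>t\<bar>) powr (- 3 / 2))"
  have [measurable]: "f \<in> borel_measurable borel" unfolding f_def by measurable
  have lim: "((\<lambda>t. - 2 / \<delta> * (1 + \<delta> * t) powr (- 1 / 2)) \<longlongrightarrow> 0) at_top" using \<delta> by real_asymp
  have "(\<integral>\<^sup>+t\<in>{0..}. ennreal (f t) \<partial>lborel) = ennreal (0 - (- 2 / \<delta> * (1 + \<delta> * 0) powr (- 1 / 2)))"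
  proof (rule nn_integral_FTC_atLeast[OF _ _ _ lim])
    show "((\<lambda>t. - 2 / \<delta> * (1 + \<delta> * t) powr (- 1 / 2)) has_real_derivative f t) (at t)" if "0 \<le> t" for t
    proof -
      have "1 + \<delta> * t > 0" using that \<delta> by (intro add_pos_nonneg) auto
      thus ?thesis using that \<delta> unfolding f_def
        by (auto intro!: derivative_eq_intros simp: powr_diff field_simps)
    qed
  qed (auto simp: f_def)
  hence h: "(\<integral>\<^sup>+t\<in>{0..}. ennreal (f t) \<partial>lborel) = ennreal (2 / \<delta>)" by simp
  have "(\<integral>\<^sup>+t. ennreal (f t) \<partial>lborel) \<le> (\<integral>\<^sup>+t. (ennreal (f t) * indicator {0..} t + ennreal (f (- t)) * indicator {0..} (- t)) \<partial>lborel)"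
    by (intro nn_integral_mono) (auto simp: f_def indicator_def)
  also have "\<dots> = (\<integral>\<^sup>+t\<in>{0..}. ennreal (f t) \<partial>lborel) + (\<integral>\<^sup>+t. ennreal (f (- t)) * indicator {0..} (- t) \<partial>lborel)"
    by (intro nn_integral_add) auto
  also have "(\<integral>\<^sup>+t. ennreal (f (- t)) * indicator {0..} (- t) \<partial>lborel) = (\<integral>\<^sup>+t\<in>{0..}. ennreal (f t) \<partial>lborel)"
    using nn_integral_real_affine[of "\<lambda>t. ennreal (f t) * indicator {0..} t" "-1" 0] by simp
  finally have "(\<integral>\<^sup>+t. ennreal (f t) \<partial>lborel) \<le> ennreal (2 / \<delta>) + ennreal (2 / \<delta>)" unfolding h .
  thus ?thesis unfolding f_def using \<delta> by (simp flip: ennreal_plus)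
qed

text \<open>
  A shift by \<open>\<tau>\<close> multiplies the Laplace transform by \<open>exp (s \<tau>) - 1\<close>. On the line \<open>Re s = 1/2 + a\<close> the
  squared modulus of the product is at most a constant times \<open>(\<delta> ln (1 / \<delta>) / a)\<^sup>2 (1 + \<delta> |t|) powr (- 3/2)\<close>, and integration
  over \<open>t\<close> wins back one factor \<open>1 / \<delta>\<close>.
\<close>

theorem RH_psi_error_mean_square:
  assumes RH: Riemann_Hypothesis
  obtains K where "K > 0"
    "\<And>\<delta> a \<tau>. 0 < \<delta> \<Longrightarrow> \<delta> \<le> 1 / 4 \<Longrightarrow> 0 < a \<Longrightarrow> a \<le> 1 \<Longrightarrow> 0 \<le> \<tau> \<Longrightarrow> \<tau> \<le> \<delta> \<Longrightarrow>
      (\<integral>\<^sup>+v. ennreal ((psi_increment \<tau> v)\<^sup>2 * exp (- ((1 + 2 * a) * v))) \<partial>lborel)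
        \<le> ennreal (K * \<delta> * (ln (1 / \<delta>))\<^sup>2 / a\<^sup>2)"
proof -
  obtain C where C: "C > 0"
    "\<And>s. 1 / 2 < Re s \<Longrightarrow> Re s \<le> 2 \<Longrightarrow> norm (zeta_logderiv s) \<le> C * ln (\<bar>Im s\<bar> + 4) / (Re s - 1 / 2)"
    using RH_zeta_reg_logderiv_bound[OF RH] by blast
  define K where "K = 1 / (2 * pi) * (40 * (C + 1))\<^sup>2 * 4"
  have "(\<integral>\<^sup>+v. ennreal ((psi_increment \<tau> v)\<^sup>2 * exp (- ((1 + 2 * a) * v))) \<partial>lborel)
        \<le> ennreal (K * \<delta> * (ln (1 / \<delta>))\<^sup>2 / a\<^sup>2)"
    if \<delta>: "0 < \<delta>" "\<delta> \<le> 1 / 4" and a: "0 < a" "a \<le> 1" and \<tau>: "0 \<le> \<tau>" "\<tau> \<le> \<delta>" for \<delta> a \<tau>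
  proof -
    define F where "F = (\<lambda>s. - (exp (s * of_real \<tau>) - 1) / s * (1 + zeta_logderiv s))"
    define \<sigma>1 where "\<sigma>1 = 1 / 2 + a"
    define L where "L = ln (1 / \<delta>)"
    define w where "w = (\<lambda>t. 1 + \<delta> * \<bar>t\<bar>)"
    have w: "w t \<ge> 1" for t using \<delta> by (simp add: w_def)
    have L: "L \<ge> 1" unfolding L_def by (rule ln_scaled_bound(2)[OF \<delta>])
    have Fle: "norm (F s) \<le> 40 * (C + 1) * \<delta> * L / a * w (Im s) powr (- 3 / 4)"
      if s: "\<sigma>1 \<le> Re s" "Re s \<le> 2" for s
    proof -
      have s': "1 / 2 < Re s" "a \<le> Re s - 1 / 2" using s a by (auto simp: \<sigma>1_def)
      have "exp 1 \<le> \<bar>Im s\<bar> + 4" using exp_le by linarith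
      hence lnge: "ln (\<bar>Im s\<bar> + 4) \<ge> 1" by (subst ln_ge_iff) auto
      have "norm (1 + zeta_logderiv s) \<le> 1 + norm (zeta_logderiv s)"
        using norm_triangle_ineq[of 1 "zeta_logderiv s"] by simp
      also have "norm (zeta_logderiv s) \<le> C * ln (\<bar>Im s\<bar> + 4) / (Re s - 1 / 2)"
        by (rule C(2)) (use s' s in auto)
      also have "\<dots> \<le> C * ln (\<bar>Im s\<bar> + 4) / a" using s' a C(1) lnge by (intro divide_left_mono) auto
      also have "1 \<le> ln (\<bar>Im s\<bar> + 4) / a" using lnge a by (simp add: field_simps)
      finally have "norm (1 + zeta_logderiv s) \<le> (C + 1) * ln (\<bar>Im s\<bar> + 4) / a"
        by (simp add: add_divide_distrib distrib_right)
      also have "\<dots> \<le> (C + 1) * (5 * L * w (Im s) powr (1 / 4)) / a"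
        unfolding L_def w_def using C(1) a ln_scaled_bound(1)[OF \<delta>, of "Im s"] by (intro divide_right_mono mult_left_mono) auto
      finally have 1: "norm (1 + zeta_logderiv s) \<le> (C + 1) * (5 * L * w (Im s) powr (1 / 4)) / a" .
      have "norm (F s) = norm ((exp (s * of_real \<tau>) - 1) / s) * norm (1 + zeta_logderiv s)"
        by (simp add: F_def norm_mult norm_divide norm_minus_commute)
      also have "\<dots> \<le> (8 * \<delta> / w (Im s)) * ((C + 1) * (5 * L * w (Im s) powr (1 / 4)) / a)"
      proof (rule mult_mono[OF _ 1])
        show "norm ((exp (s * of_real \<tau>) - 1) / s) \<le> 8 * \<delta> / w (Im s)"
          unfolding w_def by (rule difference_kernel_bound[OF \<tau> \<delta>]) (use s s' in auto)
      qed (use \<delta> w[of "Im s"] in auto)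
      also have "\<dots> = 40 * (C + 1) * \<delta> * L / a * (w (Im s) powr (1 / 4) / w (Im s) powr 1)"
      proof -
        have "w (Im s) powr 1 = w (Im s)" using w[of "Im s"] by simp
        moreover have "(8 * d / x) * (c * (5 * l * q) / b) = 40 * c * d * l / b * (q / x)" for d x c l q b :: real
          by (simp add: mult_ac)
        ultimately show ?thesis by (simp only:)
      qed
      also have "w (Im s) powr (1 / 4) / w (Im s) powr 1 = w (Im s) powr (- 3 / 4)"
        unfolding powr_diff[symmetric] by simp
      finally show ?thesis .
    qed
    have "(\<integral>\<^sup>+v. ennreal ((psi_increment \<tau> v)\<^sup>2 * exp (- (2 * \<sigma>1 * v))) \<partial>lborel)
       \<le> ennreal (1 / (2 * pi)) * (\<integral>\<^sup>+t. ennreal ((norm (F (Complex \<sigma>1 t)))\<^sup>2) \<partial>lborel)"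
    proof (rule plancherel_inequality_shifted_line[where S = "{s. Re s > 1 / 2}" and ?\<sigma>0.0 = 2 and
          B = "40 * (C + 1) * \<delta> * L / a" and A = 3])
      show "open {s. 1 / 2 < Re s}" "convex {s. 1 / 2 < Re s}"
        by (rule open_halfspace_Re_gt, rule convex_halfspace_Re_gt)
      have h1: "zeta_reg holomorphic_on {s. 1 / 2 < Re s}"
        by (rule holomorphic_on_subset[OF zeta_reg_holomorphic]) auto
      have h2: "deriv zeta_reg holomorphic_on {s. 1 / 2 < Re s}"
        by (rule holomorphic_deriv[OF h1 open_halfspace_Re_gt])
      show "F holomorphic_on {s. 1 / 2 < Re s}"
      proof -
        have nz: "zeta_reg z \<noteq> 0" "z \<noteq> 0" if "z \<in> {s. 1 / 2 < Re s}" for z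
          using that RH_zeta_reg_nonzero[OF RH, of z] by force+
        show ?thesis unfolding F_def
          by (intro holomorphic_on_mult holomorphic_on_divide holomorphic_on_add holomorphic_on_minus
                holomorphic_on_diff holomorphic_on_exp' holomorphic_on_const holomorphic_on_ident h1 h2 nz)
      qed
      show "\<sigma>1 \<le> 2" using a by (simp add: \<sigma>1_def)
      show "s \<in> {s. 1 / 2 < Re s}" if "\<sigma>1 \<le> Re s" for s using that a by (simp add: \<sigma>1_def)
      show "norm (F s) \<le> 40 * (C + 1) * \<delta> * L / a" if "\<sigma>1 \<le> Re s" "Re s \<le> 2" for s
      proof -
        have "w (Im s) powr (- 3 / 4) \<le> w (Im s) powr 0" using w[of "Im s"] by (intro powr_mono) auto
        hence "40 * (C + 1) * \<delta> * L / a * w (Im s) powr (- 3 / 4) \<le> 40 * (C + 1) * \<delta> * L / a * 1"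
          using C(1) \<delta> L a w[of "Im s"] by (intro mult_left_mono) auto
        thus ?thesis using Fle[OF that] by simp
      qed
      show "\<bar>(psi_increment \<tau> v) * exp (- (2 * v))\<bar> \<le> 3" for v
      proof -
        have "\<bar>psi_error (v + \<tau>)\<bar> * exp (- (2 * v)) = (\<bar>psi_error (v + \<tau>)\<bar> * exp (- (2 * (v + \<tau>)))) * exp (2 * \<tau>)"
          by (simp add: mult.assoc algebra_simps flip: exp_add)
        also have "\<dots> \<le> 1 * exp (1 / 2)" using \<tau> \<delta> by (intro mult_mono psi_error_le) auto
        also have "\<dots> \<le> 2" using exp_half_le2 by simp
        finally have "\<bar>psi_error (v + \<tau>)\<bar> * exp (- (2 * v)) \<le> 2" .
        moreover have "\<bar>psi_increment \<tau> v\<bar> * exp (- (2 * v)) \<le> (\<bar>psi_error (v + \<tau>)\<bar> + \<bar>psi_error v\<bar>) * exp (- (2 * v))"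
          by (intro mult_right_mono abs_triangle_ineq4) auto
        ultimately show ?thesis using psi_error_le[of v] by (simp add: abs_mult distrib_right)
      qed
      show "integrable lborel (\<lambda>v. (psi_increment \<tau> v) * exp (- (2 * v)))"
      proof -
        have "integrable lborel (\<lambda>v. complex_of_real ((psi_increment \<tau> v) * exp (- (2 * v))))"
          using psi_error_shift_laplace(1)[of 2 \<tau>] by (simp add: exp_of_real[symmetric])
        thus ?thesis by (simp only: complex_of_real_integrable_eq)
      qed
      show "AE v in lborel. isCont (\<lambda>v. psi_increment \<tau> v) v"
      proof -
        have "AE v in lborel. isCont psi_error (v + \<tau>)"
          using AE_borel_affine[of 1 "\<lambda>v. isCont psi_error v" \<tau>] psi_error_continuous_AE by (simp add: add.commute)
        with psi_error_continuous_AE show ?thesis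
        proof eventually_elim
          case (elim v)
          have "isCont (\<lambda>v. psi_error (v + \<tau>)) v"
            by (rule isCont_o2[where f = "\<lambda>v. v + \<tau>" and g = psi_error]) (use elim in \<open>auto intro!: continuous_intros\<close>)
          thus ?case using elim by (intro continuous_diff) auto
        qed
      qed
      show "F (Complex 2 t) = (\<integral>v. of_real (psi_increment \<tau> v) * exp (- (Complex 2 t * of_real v)) \<partial>lborel)" for t
        unfolding F_def by (rule psi_error_shift_laplace(2)[symmetric]) simp
    qed auto
    also have "(\<integral>\<^sup>+t. ennreal ((norm (F (Complex \<sigma>1 t)))\<^sup>2) \<partial>lborel) \<le> 
       (\<integral>\<^sup>+t. ennreal ((40 * (C + 1) * \<delta> * L / a)\<^sup>2) * ennreal ((1 + \<delta> * \<bar>t\<bar>) powr (- 3 / 2)) \<partial>lborel)"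
    proof (rule nn_integral_mono)
      fix t
      have "(norm (F (Complex \<sigma>1 t)))\<^sup>2 \<le> (40 * (C + 1) * \<delta> * L / a * w t powr (- 3 / 4))\<^sup>2"
        using Fle[of "Complex \<sigma>1 t"] a by (intro power_mono) (auto simp: \<sigma>1_def)
      also have "\<dots> = (40 * (C + 1) * \<delta> * L / a)\<^sup>2 * (w t powr (- 3 / 4))\<^sup>2" by (rule power_mult_distrib)
      also have "(w t powr (- 3 / 4))\<^sup>2 = (1 + \<delta> * \<bar>t\<bar>) powr (- 3 / 2)"
        by (simp add: w_def power2_eq_square flip: powr_add)
      finally show "ennreal ((norm (F (Complex \<sigma>1 t)))\<^sup>2) \<le> ennreal ((40 * (C + 1) * \<delta> * L / a)\<^sup>2) * ennreal ((1 + \<delta> * \<bar>t\<bar>) powr (- 3 / 2))"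
        by (simp flip: ennreal_mult)
    qed
    also have "\<dots> = ennreal ((40 * (C + 1) * \<delta> * L / a)\<^sup>2) * (\<integral>\<^sup>+t. ennreal ((1 + \<delta> * \<bar>t\<bar>) powr (- 3 / 2)) \<partial>lborel)"
      by (rule nn_integral_cmult) measurable
    also have "\<dots> \<le> ennreal ((40 * (C + 1) * \<delta> * L / a)\<^sup>2) * ennreal (4 / \<delta>)"
      by (intro mult_left_mono nn_integral_even_tail \<delta>) auto
    also have "ennreal (1 / (2 * pi)) * (ennreal ((40 * (C + 1) * \<delta> * L / a)\<^sup>2) * ennreal (4 / \<delta>)) = 
       ennreal (1 / (2 * pi) * ((40 * (C + 1) * \<delta> * L / a)\<^sup>2 * (4 / \<delta>)))"
      using \<delta> by (simp flip: ennreal_mult)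
    also have "1 / (2 * pi) * ((40 * (C + 1) * \<delta> * L / a)\<^sup>2 * (4 / \<delta>)) = K * \<delta> * L\<^sup>2 / a\<^sup>2"
      using \<delta> by (simp add: K_def power_mult_distrib power_divide power2_eq_square[of \<delta>])
    finally show ?thesis
      by (simp add: mult_left_mono L_def \<sigma>1_def distrib_left)
  qed
  moreover have "K > 0" using C(1) by (simp add: K_def)
  ultimately show ?thesis using that by blast
qed

section \<open>Mean squares over variable shifts\<close>

text \<open>
  The averaging argument of Saffari and Vaughan. For every \<open>\<tau>\<close> the increment by \<open>\<theta> v\<close> is the difference
  of two others: the one from \<open>v\<close> by \<open>\<tau>\<close>, and the one from \<open>w v = v + \<theta> v\<close> by \<open>\<tau> - \<theta> v\<close>. Average over \<open>\<tau>\<close>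
  between \<open>\<delta>\<close> and \<open>2 \<delta>\<close>, so that \<open>\<tau> - \<theta> v\<close> lies between 0 and \<open>2 \<delta>\<close>; translating \<open>\<tau>\<close> then frees the
  second shift of its dependence on \<open>v\<close>. It remains to substitute \<open>w v\<close>, whose derivative is at least
  \<open>1/2\<close>, for \<open>v\<close>. The two parts contribute 4 and 8 to the constant.
\<close>

lemma variable_shift_mean_square:
  fixes D \<theta> \<theta>' :: "real \<Rightarrow> real"
  assumes D[measurable]: "D \<in> borel_measurable borel" and \<delta>: "0 < \<delta>" "\<delta> \<le> 1" and B: "B \<ge> 0"
    and fixed: "\<And>\<tau>. 0 \<le> \<tau> \<Longrightarrow> \<tau> \<le> 2 * \<delta> \<Longrightarrow>
      (\<integral>\<^sup>+v\<in>{a..a + 2}. ennreal ((D (v + \<tau>) - D v)\<^sup>2) \<partial>lborel) \<le> ennreal B"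
    and \<theta>: "\<And>v. v \<in> {a..a + 1} \<Longrightarrow> 0 \<le> \<theta> v \<and> \<theta> v \<le> \<delta>"
    and deriv: "\<And>v. v \<in> {a..a + 1} \<Longrightarrow> (\<theta> has_real_derivative \<theta>' v) (at v)"
    and cont': "continuous_on {a..a + 1} \<theta>'" and ge: "\<And>v. v \<in> {a..a + 1} \<Longrightarrow> \<theta>' v \<ge> - 1 / 2"
    and [measurable]: "\<theta> \<in> borel_measurable borel"
  shows "(\<integral>\<^sup>+v\<in>{a..a + 1}. ennreal ((D (v + \<theta> v) - D v)\<^sup>2) \<partial>lborel) \<le> ennreal (12 * B)"
proof -
  define S where "S = (\<lambda>\<tau> u. (D (u + \<tau>) - D u)\<^sup>2)"
  define w where "w = (\<lambda>v. v + \<theta> v)"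
  have [measurable]: "w \<in> borel_measurable borel" unfolding w_def by measurable
  have [measurable]: "(\<lambda>p. S (fst p) (snd p)) \<in> borel_measurable (borel \<Otimes>\<^sub>M borel)"
    unfolding S_def by measurable
  have S1[measurable]: "S \<tau> \<in> borel_measurable borel" for \<tau> unfolding S_def by measurable
  have fixedS: "(\<integral>\<^sup>+v\<in>{a..a + 2}. ennreal (S \<tau> v) \<partial>lborel) \<le> ennreal B"
    if "0 \<le> \<tau>" "\<tau> \<le> 2 * \<delta>" for \<tau> using fixed[OF that] by (simp add: S_def)
  have moved: "(\<integral>\<^sup>+v\<in>{a..a + 1}. ennreal (S \<tau> (w v)) \<partial>lborel) \<le> ennreal (2 * B)"
    if \<tau>: "0 \<le> \<tau>" "\<tau> \<le> 2 * \<delta>" for \<tau>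
  proof -
    have "(\<integral>\<^sup>+v\<in>{a..a + 1}. ennreal (S \<tau> (w v)) \<partial>lborel) \<le>
          (\<integral>\<^sup>+v. 2 * ennreal (S \<tau> (w v) * (1 + \<theta>' v) * indicator {a..a + 1} v) \<partial>lborel)"
    proof (rule nn_integral_mono)
      fix v
      show "ennreal (S \<tau> (w v)) * indicator {a..a + 1} v \<le> 2 * ennreal (S \<tau> (w v) * (1 + \<theta>' v) * indicator {a..a + 1} v)"
      proof (cases "v \<in> {a..a + 1}")
        case True
        have "S \<tau> (w v) * 1 \<le> S \<tau> (w v) * (2 * (1 + \<theta>' v))"
          using ge[OF True] by (intro mult_left_mono) (auto simp: S_def)
        hence "ennreal (S \<tau> (w v)) \<le> ennreal (2 * (S \<tau> (w v) * (1 + \<theta>' v)))" by (intro ennreal_leI) (simp add: algebra_simps)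
        also have "\<dots> = 2 * ennreal (S \<tau> (w v) * (1 + \<theta>' v))" by (simp add: ennreal_mult')
        finally show ?thesis using True by simp
      qed simp
    qed
    also have "\<dots> = 2 * (\<integral>\<^sup>+v. ennreal (S \<tau> (w v) * (1 + \<theta>' v) * indicator {a..a + 1} v) \<partial>lborel)"
    proof (rule nn_integral_cmult)
      have "(\<lambda>v. indicator {a..a + 1} v *\<^sub>R \<theta>' v) \<in> borel_measurable borel"
        by (rule borel_measurable_continuous_on_indicator[OF _ cont']) simp
      hence [measurable]: "(\<lambda>v. \<theta>' v * indicator {a..a + 1} v) \<in> borel_measurable borel"
        by (simp add: mult.commute)
      have "(\<lambda>v. ennreal (S \<tau> (w v) * (indicator {a..a + 1} v + \<theta>' v * indicator {a..a + 1} v))) \<in> borel_measurable lborel"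
        by measurable
      thus "(\<lambda>v. ennreal (S \<tau> (w v) * (1 + \<theta>' v) * indicator {a..a + 1} v)) \<in> borel_measurable lborel"
        by (simp add: algebra_simps)
    qed
    also have "(\<integral>\<^sup>+v. ennreal (S \<tau> (w v) * (1 + \<theta>' v) * indicator {a..a + 1} v) \<partial>lborel) =
        (\<integral>\<^sup>+x. ennreal (S \<tau> x * indicator {w a..w (a + 1)} x) \<partial>lborel)"
    proof (rule nn_integral_substitution[symmetric])
      show "set_borel_measurable borel {w a..w (a + 1)} (S \<tau>)" unfolding set_borel_measurable_def by measurable
      show "(w has_real_derivative 1 + \<theta>' v) (at v)" if "v \<in> {a..a + 1}" for v
        unfolding w_def by (intro derivative_intros deriv that)
      show "continuous_on {a..a + 1} (\<lambda>v. 1 + \<theta>' v)" by (intro continuous_intros cont')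
      show "0 \<le> 1 + \<theta>' v" if "v \<in> {a..a + 1}" for v using ge[OF that] by simp
    qed simp
    also have "\<dots> \<le> (\<integral>\<^sup>+x\<in>{a..a + 2}. ennreal (S \<tau> x) \<partial>lborel)"
      using \<theta>[of a] \<theta>[of "a + 1"] \<delta>
      by (intro nn_integral_mono) (auto simp: w_def indicator_def S_def)
    also have "2 * \<dots> \<le> 2 * ennreal B" by (intro mult_left_mono fixedS \<tau>) auto
    also have "2 * ennreal B = ennreal (2 * B)" using B by (simp add: ennreal_mult)
    finally show ?thesis by (simp add: mult_left_mono)
  qed
  define U where "U = (\<lambda>v. \<integral>\<^sup>+\<tau>. 2 * ennreal (S \<tau> v) * indicator {0..2 * \<delta>} \<tau> \<partial>lborel)"
  have [measurable]: "U \<in> borel_measurable borel" unfolding U_def S_def by measurable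
  have pw: "ennreal \<delta> * (ennreal (S (\<theta> v) v) * indicator {a..a + 1} v) \<le> U v * indicator {a..a + 1} v + U (w v) * indicator {a..a + 1} v" for v
  proof (cases "v \<in> {a..a + 1}")
    case True
    have "ennreal \<delta> * ennreal (S (\<theta> v) v) = (\<integral>\<^sup>+\<tau>. ennreal (S (\<theta> v) v) * indicator {\<delta>..2 * \<delta>} \<tau> \<partial>lborel)"
      using \<delta> by (simp add: nn_integral_cmult_indicator mult.commute)
    also have "\<dots> \<le> (\<integral>\<^sup>+\<tau>. (2 * ennreal (S \<tau> v) * indicator {0..2 * \<delta>} \<tau> +
         2 * ennreal (S (- \<theta> v + 1 * \<tau>) (w v)) * indicator {0..2 * \<delta>} (- \<theta> v + 1 * \<tau>)) \<partial>lborel)"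
    proof (rule nn_integral_mono)
      fix \<tau>
      show "ennreal (S (\<theta> v) v) * indicator {\<delta>..2 * \<delta>} \<tau> \<le> 2 * ennreal (S \<tau> v) * indicator {0..2 * \<delta>} \<tau> +
         2 * ennreal (S (- \<theta> v + 1 * \<tau>) (w v)) * indicator {0..2 * \<delta>} (- \<theta> v + 1 * \<tau>)"
      proof (cases "\<tau> \<in> {\<delta>..2 * \<delta>}")
        case t: True
        have ar: "(p - q)\<^sup>2 \<le> 2 * (r - q)\<^sup>2 + 2 * (r - p)\<^sup>2" for p q r :: real
        proof -
          have "0 \<le> ((r - q) + (r - p))\<^sup>2" by simp
          thus ?thesis by (simp add: power2_eq_square algebra_simps)
        qed
        have "w v + (- \<theta> v + 1 * \<tau>) = v + \<tau>" by (simp add: w_def)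
        hence "S (\<theta> v) v \<le> 2 * S \<tau> v + 2 * S (- \<theta> v + 1 * \<tau>) (w v)"
          unfolding S_def using ar[of "D (v + \<theta> v)" "D v" "D (v + \<tau>)"] by (simp add: w_def)
        hence "ennreal (S (\<theta> v) v) \<le> ennreal (2 * S \<tau> v + 2 * S (- \<theta> v + 1 * \<tau>) (w v))" by (rule ennreal_leI)
        also have "\<dots> = 2 * ennreal (S \<tau> v) + 2 * ennreal (S (- \<theta> v + 1 * \<tau>) (w v))"
          by (simp add: S_def ennreal_mult)
        finally show ?thesis using t \<theta>[OF True] \<delta> by simp
      qed simp
    qed
    also have "\<dots> = U v + (\<integral>\<^sup>+\<tau>. 2 * ennreal (S (- \<theta> v + 1 * \<tau>) (w v)) * indicator {0..2 * \<delta>} (- \<theta> v + 1 * \<tau>) \<partial>lborel)"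
      unfolding U_def S_def by (intro nn_integral_add) measurable
    also have "(\<integral>\<^sup>+\<tau>. 2 * ennreal (S (- \<theta> v + 1 * \<tau>) (w v)) * indicator {0..2 * \<delta>} (- \<theta> v + 1 * \<tau>) \<partial>lborel) = U (w v)"
      unfolding U_def S_def
      by (subst nn_integral_real_affine[of "\<lambda>\<tau>. 2 * ennreal ((D (w v + \<tau>) - D (w v))\<^sup>2) * indicator {0..2 * \<delta>} \<tau>" 1 "- \<theta> v"]) auto
    finally show ?thesis using True by simp
  qed simp
  have tonelli: "(\<integral>\<^sup>+v\<in>{a..a + 1}. U (g v) \<partial>lborel) \<le> ennreal (4 * \<delta> * A)"
    if [measurable]: "g \<in> borel_measurable borel" and A: "A \<ge> 0" and
      le: "\<And>\<tau>. 0 \<le> \<tau> \<Longrightarrow> \<tau> \<le> 2 * \<delta> \<Longrightarrow> (\<integral>\<^sup>+v\<in>{a..a + 1}. ennreal (S \<tau> (g v)) \<partial>lborel) \<le> ennreal A" for g A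
  proof -
    have "(\<integral>\<^sup>+v\<in>{a..a + 1}. U (g v) \<partial>lborel) =
      (\<integral>\<^sup>+v. (\<integral>\<^sup>+\<tau>. 2 * ennreal (S \<tau> (g v)) * indicator {0..2 * \<delta>} \<tau> * indicator {a..a + 1} v \<partial>lborel) \<partial>lborel)"
      unfolding U_def S_def by (subst nn_integral_multc) auto
    also have "\<dots> = (\<integral>\<^sup>+\<tau>. (\<integral>\<^sup>+v\<in>{a..a + 1}. 2 * ennreal (S \<tau> (g v)) * indicator {0..2 * \<delta>} \<tau> \<partial>lborel) \<partial>lborel)"
      unfolding S_def by (rule lborel_pair.Fubini') measurable
    also have "\<dots> \<le> (\<integral>\<^sup>+\<tau>. ennreal (2 * A) * indicator {0..2 * \<delta>} \<tau> \<partial>lborel)"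
    proof (rule nn_integral_mono)
      fix \<tau>
      have "(\<integral>\<^sup>+v\<in>{a..a + 1}. 2 * ennreal (S \<tau> (g v)) * indicator {0..2 * \<delta>} \<tau> \<partial>lborel) =
         (\<integral>\<^sup>+v. (2 * indicator {0..2 * \<delta>} \<tau>) * (ennreal (S \<tau> (g v)) * indicator {a..a + 1} v) \<partial>lborel)"
        by (simp add: mult_ac)
      also have "\<dots> = (2 * indicator {0..2 * \<delta>} \<tau>) * (\<integral>\<^sup>+v\<in>{a..a + 1}. ennreal (S \<tau> (g v)) \<partial>lborel)"
        by (rule nn_integral_cmult) measurable
      also have "\<dots> \<le> (2 * indicator {0..2 * \<delta>} \<tau>) * ennreal A"
      proof (cases "\<tau> \<in> {0..2 * \<delta>}")
        case True
        thus ?thesis using le[of \<tau>] by (intro mult_left_mono) auto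
      qed simp
      also have "\<dots> = ennreal (2 * A) * indicator {0..2 * \<delta>} \<tau>" using A by (simp add: ennreal_mult mult_ac)
      finally show "(\<integral>\<^sup>+v\<in>{a..a + 1}. 2 * ennreal (S \<tau> (g v)) * indicator {0..2 * \<delta>} \<tau> \<partial>lborel) \<le>
          ennreal (2 * A) * indicator {0..2 * \<delta>} \<tau>" .
    qed
    also have "\<dots> = ennreal (4 * \<delta> * A)" using \<delta> A by (simp add: nn_integral_cmult_indicator mult_ac flip: ennreal_mult)
    finally show ?thesis .
  qed
  have "ennreal \<delta> * (\<integral>\<^sup>+v\<in>{a..a + 1}. ennreal (S (\<theta> v) v) \<partial>lborel) = 
      (\<integral>\<^sup>+v. ennreal \<delta> * (ennreal (S (\<theta> v) v) * indicator {a..a + 1} v) \<partial>lborel)"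
    by (rule nn_integral_cmult[symmetric]) (simp add: S_def)
  also have "\<dots> \<le> (\<integral>\<^sup>+v. U v * indicator {a..a + 1} v + U (w v) * indicator {a..a + 1} v \<partial>lborel)"
    by (intro nn_integral_mono pw)
  also have "\<dots> = (\<integral>\<^sup>+v\<in>{a..a + 1}. U v \<partial>lborel) + (\<integral>\<^sup>+v\<in>{a..a + 1}. U (w v) \<partial>lborel)"
    by (rule nn_integral_add) measurable
  also have "\<dots> \<le> ennreal (4 * \<delta> * B) + ennreal (4 * \<delta> * (2 * B))"
  proof (intro add_mono tonelli moved)
    show "(\<integral>\<^sup>+v\<in>{a..a + 1}. ennreal (S \<tau> v) \<partial>lborel) \<le> ennreal B" if "0 \<le> \<tau>" "\<tau> \<le> 2 * \<delta>" for \<tau>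
      by (rule order_trans[OF nn_integral_mono fixedS[OF that]]) (auto simp: indicator_def)
  qed (use B in auto)
  also have "\<dots> = ennreal \<delta> * ennreal (12 * B)" using B \<delta> by (simp flip: ennreal_plus ennreal_mult)
  finally have fin: "ennreal \<delta> * (\<integral>\<^sup>+v\<in>{a..a + 1}. ennreal (S (\<theta> v) v) \<partial>lborel) \<le> ennreal \<delta> * ennreal (12 * B)" .
  have "(\<integral>\<^sup>+v\<in>{a..a + 1}. ennreal (S (\<theta> v) v) \<partial>lborel) = 
     ennreal (1 / \<delta>) * (ennreal \<delta> * (\<integral>\<^sup>+v\<in>{a..a + 1}. ennreal (S (\<theta> v) v) \<partial>lborel))"
    using \<delta> by (simp add: mult.assoc[symmetric] flip: ennreal_mult)
  also have "\<dots> \<le> ennreal (1 / \<delta>) * (ennreal \<delta> * ennreal (12 * B))" by (intro mult_left_mono fin) auto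
  also have "\<dots> = ennreal (12 * B)" using \<delta> by (simp add: mult.assoc[symmetric] flip: ennreal_mult)
  finally show ?thesis by (simp add: S_def)
qed

text \<open>
  Take \<open>a = 1 / ln X\<close>. On an interval of length 2 from \<open>ln X\<close> the weight \<open>exp (- (1 + 2 a) v)\<close> is then
  \<open>1 / X\<close> up to a constant, at the price of \<open>1 / a\<^sup>2 = (ln X)\<^sup>2\<close>.
\<close>

lemma RH_psi_error_local_mean_square:
  fixes c :: real
  assumes RH: Riemann_Hypothesis and c: "c > 0"
  obtains K where "K > 0"
    "\<forall>\<^sub>F X in at_top. \<forall>\<tau>. 0 \<le> \<tau> \<and> \<tau> \<le> 2 * c / sqrt X \<longrightarrow>
      (\<integral>\<^sup>+v\<in>{ln X..ln X + 2}. ennreal ((psi_increment \<tau> v)\<^sup>2) \<partial>lborel)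
        \<le> ennreal (K * sqrt X * (ln X) ^ 4)"
proof -
  obtain K where K: "K > 0" and bound:
    "\<And>\<delta> a \<tau>. 0 < \<delta> \<Longrightarrow> \<delta> \<le> 1 / 4 \<Longrightarrow> 0 < a \<Longrightarrow> a \<le> 1 \<Longrightarrow> 0 \<le> \<tau> \<Longrightarrow> \<tau> \<le> \<delta> \<Longrightarrow>
      (\<integral>\<^sup>+v. ennreal ((psi_increment \<tau> v)\<^sup>2 * exp (- ((1 + 2 * a) * v))) \<partial>lborel)
        \<le> ennreal (K * \<delta> * (ln (1 / \<delta>))\<^sup>2 / a\<^sup>2)"
    using RH_psi_error_mean_square[OF RH] by blast
  \<comment> \<open>The constant \<open>exp 8\<close>: for \<open>v \<le> ln X + 2\<close> and \<open>a = 1 / ln X \<le> 1\<close> one has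
    \<open>(1 + 2 a) v \<le> ln X + 4 + 4 a \<le> ln X + 8\<close>.\<close>
  define K' where "K' = exp 8 * K * (2 * c)"
  have "\<forall>\<^sub>F X in at_top. 2 * c / sqrt X \<le> 1 / 4 \<and> sqrt X / (2 * c) \<le> X \<and> ln X \<ge> 1 \<and> X \<ge> 1 \<and> 1 \<le> sqrt X / (2 * c)"
    by (intro eventually_conj; use c in real_asymp)
  hence "\<forall>\<^sub>F X in at_top. \<forall>\<tau>. 0 \<le> \<tau> \<and> \<tau> \<le> 2 * c / sqrt X \<longrightarrow>
      (\<integral>\<^sup>+v\<in>{ln X..ln X + 2}. ennreal ((psi_increment \<tau> v)\<^sup>2) \<partial>lborel)
        \<le> ennreal (K' * sqrt X * (ln X) ^ 4)"
  proof eventually_elim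
    case (elim X)
    show ?case
    proof (intro allI impI)
      fix \<tau> assume \<tau>: "0 \<le> \<tau> \<and> \<tau> \<le> 2 * c / sqrt X"
      define \<delta> where "\<delta> = 2 * c / sqrt X"
      define a where "a = 1 / ln X"
      have X: "X > 0" using elim by simp
      have \<delta>: "0 < \<delta>" "\<delta> \<le> 1 / 4" using elim c by (auto simp: \<delta>_def)
      have "ln X \<ge> 1" using elim by blast
      hence a: "0 < a" "a \<le> 1" unfolding a_def by (simp_all add: divide_le_eq del: ln_gt_zero_iff)
      have "1 / \<delta> = sqrt X / (2 * c)" by (simp add: \<delta>_def)
      hence ln: "0 \<le> ln (1 / \<delta>)" "ln (1 / \<delta>) \<le> ln X" using elim X by auto
      have "(\<integral>\<^sup>+v\<in>{ln X..ln X + 2}. ennreal ((psi_increment \<tau> v)\<^sup>2) \<partial>lborel) \<le>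
         (\<integral>\<^sup>+v. ennreal (exp 8 * X) * ennreal ((psi_increment \<tau> v)\<^sup>2 * exp (- ((1 + 2 * a) * v))) \<partial>lborel)"
      proof (rule nn_integral_mono)
        fix v
        show "ennreal ((psi_increment \<tau> v)\<^sup>2) * indicator {ln X..ln X + 2} v \<le>
          ennreal (exp 8 * X) * ennreal ((psi_increment \<tau> v)\<^sup>2 * exp (- ((1 + 2 * a) * v)))"
        proof (cases "v \<in> {ln X..ln X + 2}")
          case True
          have "(1 + 2 * a) * v \<le> (1 + 2 * a) * (ln X + 2)" using True a by (intro mult_left_mono) auto
          also have "\<dots> = ln X + 2 + 2 * (a * ln X) + 4 * a" by (simp add: algebra_simps)
          also have "a * ln X = 1" using \<open>ln X \<ge> 1\<close> by (simp add: a_def)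
          also have "ln X + 2 + 2 * 1 + 4 * a \<le> ln X + 8" using a by simp
          finally have "exp (- (ln X + 8)) \<le> exp (- ((1 + 2 * a) * v))" by simp
          hence "exp 8 * X * exp (- (ln X + 8)) \<le> exp 8 * X * exp (- ((1 + 2 * a) * v))"
            using X by (intro mult_left_mono) auto
          moreover have "exp 8 * X * exp (- (ln X + 8)) = 1"
          proof -
            have "exp (ln X + 8) = X * exp 8" using X by (simp add: exp_add)
            thus ?thesis using X by (simp only: exp_minus) (simp add: field_simps)
          qed
          ultimately have "1 \<le> exp 8 * X * exp (- ((1 + 2 * a) * v))" by linarith
          hence "(psi_increment \<tau> v)\<^sup>2 * 1 \<le> (psi_increment \<tau> v)\<^sup>2 * (exp 8 * X * exp (- ((1 + 2 * a) * v)))"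
            by (intro mult_left_mono) auto
          thus ?thesis using True X by (simp add: mult_ac flip: ennreal_mult)
        qed simp
      qed
      also have "\<dots> = ennreal (exp 8 * X) * (\<integral>\<^sup>+v. ennreal ((psi_increment \<tau> v)\<^sup>2 * exp (- ((1 + 2 * a) * v))) \<partial>lborel)"
        by (rule nn_integral_cmult) measurable
      also have "\<dots> \<le> ennreal (exp 8 * X) * ennreal (K * \<delta> * (ln (1 / \<delta>))\<^sup>2 / a\<^sup>2)"
        by (intro mult_left_mono bound \<delta> a) (use \<tau> in \<open>auto simp: \<delta>_def\<close>)
      also have "\<dots> = ennreal (exp 8 * X * (K * \<delta> * (ln (1 / \<delta>))\<^sup>2 / a\<^sup>2))"
        using K \<delta> X by (simp flip: ennreal_mult)
      also have "exp 8 * X * (K * \<delta> * (ln (1 / \<delta>))\<^sup>2 / a\<^sup>2) \<le> exp 8 * X * (K * \<delta> * (ln X)\<^sup>2 / a\<^sup>2)"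
        using K \<delta> X ln by (intro mult_left_mono divide_right_mono power_mono) auto
      also have "\<dots> = exp 8 * K * (2 * c) * (X / sqrt X) * ((ln X)\<^sup>2 * (ln X)\<^sup>2)"
        using elim by (simp add: \<delta>_def a_def power_divide)
      also have "X / sqrt X = sqrt X" using X by (simp add: real_div_sqrt)
      also have "(ln X)\<^sup>2 * (ln X)\<^sup>2 = (ln X) ^ 4" by (simp flip: power_add)
      finally show "(\<integral>\<^sup>+v\<in>{ln X..ln X + 2}. ennreal ((psi_increment \<tau> v)\<^sup>2) \<partial>lborel)
          \<le> ennreal (K' * sqrt X * (ln X) ^ 4)" by (simp add: K'_def ennreal_leI)
    qed
  qed
  moreover have "K' > 0" using K c by (simp add: K'_def)
  ultimately show ?thesis using that by blast
qed

text \<open>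
  In the variable \<open>v = ln x\<close> the end \<open>x + c sqrt x\<close> of the window is \<open>v + \<theta> v\<close> with
  \<open>\<theta> v = ln (1 + c exp (- v / 2))\<close>, because \<open>sqrt x = exp (v / 2)\<close>. This shift is at most \<open>c / sqrt X\<close>,
  and its derivative is between \<open>- 1/2\<close> and 0.
\<close>

theorem RH_psi_window_mean_square:
  fixes c :: real
  assumes RH: Riemann_Hypothesis and c: "c > 0"
  obtains K where "K > 0"
    "\<forall>\<^sub>F X in at_top. 
      (\<integral>\<^sup>+x\<in>{X..2 * X}. ennreal ((psi_window_error c x)\<^sup>2) \<partial>lborel)
        \<le> ennreal (K * (X * sqrt X) * (ln X) ^ 4)"
proof -
  obtain K where K: "K > 0" and bound: 
    "\<forall>\<^sub>F X in at_top. \<forall>\<tau>. 0 \<le> \<tau> \<and> \<tau> \<le> 2 * c / sqrt X \<longrightarrow>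
      (\<integral>\<^sup>+v\<in>{ln X..ln X + 2}. ennreal ((psi_increment \<tau> v)\<^sup>2) \<partial>lborel)
        \<le> ennreal (K * sqrt X * (ln X) ^ 4)"
    using RH_psi_error_local_mean_square[OF RH c] by blast
  define \<theta> where "\<theta> = (\<lambda>v. ln (1 + c * exp (- v / 2)))"
  define \<theta>' where "\<theta>' = (\<lambda>v. - (c * exp (- v / 2) / 2) / (1 + c * exp (- v / 2)))"
  have pos: "1 + c * exp (- v / 2) > 0" for v using c by (intro add_pos_pos) auto
  have "\<forall>\<^sub>F X in at_top. c / sqrt X \<le> 1 \<and> X \<ge> 1"
    by (intro eventually_conj; use c in real_asymp)
  with bound have "\<forall>\<^sub>F X in at_top. 
      (\<integral>\<^sup>+x\<in>{X..2 * X}. ennreal ((psi_window_error c x)\<^sup>2) \<partial>lborel)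
        \<le> ennreal ((24 * K) * (X * sqrt X) * (ln X) ^ 4)"
  proof eventually_elim
    case (elim X)
    define B where "B = K * sqrt X * (ln X) ^ 4"
    have X: "X \<ge> 1" using elim by simp
    have B: "B \<ge> 0" using K X by (simp add: B_def)
    define f where "f = (\<lambda>x. (psi_window_error c x)\<^sup>2)"
    have [measurable]: "chebyshev_psi \<in> borel_measurable borel"
      by (rule borel_measurable_mono[OF chebyshev_psi_mono])
    have [measurable]: "f \<in> borel_measurable borel" unfolding f_def by measurable
    have main: "(\<integral>\<^sup>+v\<in>{ln X..ln X + 1}. ennreal ((psi_increment (\<theta> v) v)\<^sup>2) \<partial>lborel) \<le> ennreal (12 * B)"
    proof (rule variable_shift_mean_square[where \<delta> = "c / sqrt X" and \<theta>' = \<theta>'])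
      show "0 < c / sqrt X" "c / sqrt X \<le> 1" using elim c by auto
      show "(\<integral>\<^sup>+v\<in>{ln X..ln X + 2}. ennreal ((psi_increment \<tau> v)\<^sup>2) \<partial>lborel) \<le> ennreal B"
        if "0 \<le> \<tau>" "\<tau> \<le> 2 * (c / sqrt X)" for \<tau>
        using elim that unfolding B_def by auto
      show "0 \<le> \<theta> v \<and> \<theta> v \<le> c / sqrt X" if "v \<in> {ln X..ln X + 1}" for v
      proof
        show "0 \<le> \<theta> v" unfolding \<theta>_def using c by (intro ln_ge_zero) auto
        have "\<theta> v \<le> c * exp (- v / 2)" unfolding \<theta>_def using c by (intro ln_add_one_self_le_self) auto
        also have "exp (- v / 2) \<le> exp (- (ln X / 2))" using that by simp
        also have "exp (- (ln X / 2)) = 1 / sqrt X"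
          using X by (simp add: exp_minus powr_half_sqrt[symmetric] powr_def field_simps)
        finally show "\<theta> v \<le> c / sqrt X" using c by simp
      qed
      show "(\<theta> has_real_derivative \<theta>' v) (at v)" for v
        unfolding \<theta>_def \<theta>'_def using pos[of v]
        by (auto intro!: derivative_eq_intros simp: field_simps)
      have "1 + c * exp (- v / 2) \<noteq> 0" for v using pos[of v] by simp
      thus "continuous_on {ln X..ln X + 1} \<theta>'" unfolding \<theta>'_def by (intro continuous_intros) auto
      show "- 1 / 2 \<le> \<theta>' v" for v
        unfolding \<theta>'_def using pos[of v] by (simp add: field_simps)
      show "\<theta> \<in> borel_measurable borel" unfolding \<theta>_def by measurable
    qed (use B in auto)
    have "(\<integral>\<^sup>+x\<in>{X..2 * X}. ennreal (f x) \<partial>lborel) = (\<integral>\<^sup>+x. ennreal (f x * indicator {exp (ln X)..exp (ln (2 * X))} x) \<partial>lborel)"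
      using X by (intro nn_integral_cong) (auto simp: indicator_def)
    also have "\<dots> = (\<integral>\<^sup>+v. ennreal (f (exp v) * exp v * indicator {ln X..ln (2 * X)} v) \<partial>lborel)"
    proof (rule nn_integral_substitution)
      show "set_borel_measurable borel {exp (ln X)..exp (ln (2 * X))} f" unfolding set_borel_measurable_def by measurable
    qed (use X in \<open>auto intro!: derivative_eq_intros continuous_intros\<close>)
    also have "\<dots> \<le> (\<integral>\<^sup>+v. ennreal (2 * X) * (ennreal ((psi_increment (\<theta> v) v)\<^sup>2) * indicator {ln X..ln X + 1} v) \<partial>lborel)"
    proof (rule nn_integral_mono)
      fix v
      show "ennreal (f (exp v) * exp v * indicator {ln X..ln (2 * X)} v) \<le> 
         ennreal (2 * X) * (ennreal ((psi_increment (\<theta> v) v)\<^sup>2) * indicator {ln X..ln X + 1} v)"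
      proof (cases "v \<in> {ln X..ln (2 * X)}")
        case True
        have "ln (2 * X) = ln 2 + ln X" using X by (subst ln_mult) auto
        also have "\<dots> \<le> ln X + 1" using ln_2_less_1 by simp
        finally have v: "v \<in> {ln X..ln X + 1}" "v \<ge> 0" using True X by auto
          (use ln_ge_zero[of X] in linarith)
        have \<theta>: "\<theta> v \<ge> 0" unfolding \<theta>_def using c by (intro ln_ge_zero) auto
        have "exp (v + \<theta> v) = exp v + c * (exp v * exp (- v / 2))"
          using pos[of v] by (simp add: exp_add \<theta>_def algebra_simps)
        also have "exp v * exp (- v / 2) = sqrt (exp v)"
        proof -
          have "sqrt (exp v) = sqrt ((exp (v / 2))\<^sup>2)" by (simp flip: exp_double)
          also have "\<dots> = exp (v / 2)" by (simp del: exp_double)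
          finally show ?thesis by (simp flip: exp_add)
        qed
        finally have e: "exp (v + \<theta> v) = exp v + c * sqrt (exp v)" .
        have "psi_increment (\<theta> v) v = psi_window_error c (exp v)"
          using v \<theta> unfolding psi_error_def e by (simp add: e)
        hence fv: "f (exp v) = (psi_increment (\<theta> v) v)\<^sup>2" by (simp add: f_def)
        have "exp v \<le> exp (ln (2 * X))" using True by simp
        hence "exp v \<le> 2 * X" using X by simp
        hence "f (exp v) * exp v \<le> (psi_increment (\<theta> v) v)\<^sup>2 * (2 * X)"
          unfolding fv by (intro mult_left_mono) auto
        hence "ennreal (f (exp v) * exp v) \<le> ennreal ((psi_increment (\<theta> v) v)\<^sup>2 * (2 * X))"
          by (rule ennreal_leI)
        also have "\<dots> = ennreal (2 * X) * ennreal ((psi_increment (\<theta> v) v)\<^sup>2)"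
          using X by (subst ennreal_mult) (auto simp: mult.commute)
        finally show ?thesis using True v by simp
      qed simp
    qed
    also have "\<dots> = ennreal (2 * X) * (\<integral>\<^sup>+v\<in>{ln X..ln X + 1}. ennreal ((psi_increment (\<theta> v) v)\<^sup>2) \<partial>lborel)"
      by (rule nn_integral_cmult) (simp add: \<theta>_def)
    also have "\<dots> \<le> ennreal (2 * X) * ennreal (12 * B)" by (intro mult_left_mono main) auto
    also have "\<dots> = ennreal ((24 * K) * (X * sqrt X) * (ln X) ^ 4)"
      using X B by (simp add: B_def mult_ac flip: ennreal_mult)
    finally show ?case by (simp add: f_def)
  qed
  thus ?thesis using K that[of "24 * K"] by simp
qed

section \<open>From prime powers to primes in a window\<close>

lemma card_nat_interval_le:
  assumes "h \<ge> 0" shows "real (card {n. x < real n \<and> real n \<le> x + h}) \<le> h + 1"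
    and "finite {n. x < real n \<and> real n \<le> x + h}"
proof -
  have sub: "int ` {n. x < real n \<and> real n \<le> x + h} \<subseteq> {\<lfloor>x\<rfloor> + 1..\<lfloor>x + h\<rfloor>}"
  proof safe
    fix n :: nat assume "x < real n" "real n \<le> x + h"
    thus "int n \<in> {\<lfloor>x\<rfloor> + 1..\<lfloor>x + h\<rfloor>}" by (auto; linarith)
  qed
  show fin: "finite {n. x < real n \<and> real n \<le> x + h}"
    using finite_subset[OF sub] by (auto dest: finite_imageD)
  have "card {n. x < real n \<and> real n \<le> x + h} = card (int ` {n. x < real n \<and> real n \<le> x + h})"
    by (rule card_image[symmetric]) auto
  also have "\<dots> \<le> card {\<lfloor>x\<rfloor> + 1..\<lfloor>x + h\<rfloor>}" by (intro card_mono sub) auto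
  also have "\<dots> = nat (\<lfloor>x + h\<rfloor> - \<lfloor>x\<rfloor>)" by simp
  finally have "real (card {n. x < real n \<and> real n \<le> x + h}) \<le> real (nat (\<lfloor>x + h\<rfloor> - \<lfloor>x\<rfloor>))" by (rule of_nat_mono)
  also have "\<dots> \<le> h + 1" using assms by linarith
  finally show "real (card {n. x < real n \<and> real n \<le> x + h}) \<le> h + 1" .
qed

text \<open>
  Beyond \<open>x\<close> two different \<open>k\<close>-th powers are at least \<open>sqrt x\<close> apart, since
  \<open>m ^ (k - 1) \<ge> sqrt (m ^ k)\<close> for \<open>k \<ge> 2\<close>. The bases of those in the window thus lie in an interval of
  length \<open>c\<close>.
\<close>

lemma card_perfect_powers_window:
  assumes c: "c \<ge> 0" and x: "x \<ge> 1" and k: "k \<ge> 2"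
  shows "finite {m::nat. x < real m ^ k \<and> real m ^ k \<le> x + c * sqrt x}"
    and "real (card {m::nat. x < real m ^ k \<and> real m ^ k \<le> x + c * sqrt x}) \<le> c + 1"
proof -
  define M where "M = {m::nat. x < real m ^ k \<and> real m ^ k \<le> x + c * sqrt x}"
  have gap: "real m' - real m \<le> c" if "m \<in> M" "m' \<in> M" "m \<le> m'" for m m'
  proof -
    have m1: "real m' \<ge> 1"
    proof -
      have "m' \<noteq> 0"
      proof
        assume "m' = 0"
        hence "real m' ^ k = 0" using k by simp
        moreover have "x < real m' ^ k" using that(2) by (simp only: M_def mem_Collect_eq)
        ultimately show False using x by linarith
      qed
      thus ?thesis by simp
    qed
    have "x \<le> real m' ^ k" using that by (simp add: M_def)
    also have "\<dots> \<le> real m' ^ (2 * (k - 1))" using m1 k by (intro power_increasing) auto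
    also have "\<dots> = (real m' ^ (k - 1))\<^sup>2" by (simp add: power_mult[symmetric] mult.commute)
    finally have "sqrt x \<le> real m' ^ (k - 1)" by (simp add: real_le_lsqrt)
    hence "(real m' - real m) * sqrt x \<le> (real m' - real m) * real m' ^ (k - 1)"
      using that by (intro mult_left_mono) auto
    also have "\<dots> = real m' ^ k - real m * real m' ^ (k - 1)"
      using k by (cases k) (auto simp: algebra_simps)
    also have "\<dots> \<le> real m' ^ k - real m * real m ^ (k - 1)"
      using that by (intro diff_left_mono mult_left_mono power_mono) auto
    also have "real m * real m ^ (k - 1) = real m ^ k" using k by (cases k) auto
    also have "real m' ^ k - real m ^ k \<le> c * sqrt x" using that by (auto simp: M_def)
    finally show ?thesis using x by simp
  qed
  have "finite M \<and> real (card M) \<le> c + 1"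
  proof (cases "M = {}")
    case False
    define m0 where "m0 = (LEAST m. m \<in> M)"
    have m0: "m0 \<in> M" "\<And>m. m \<in> M \<Longrightarrow> m0 \<le> m"
      unfolding m0_def using False by (auto intro: LeastI Least_le)
    have sub: "M \<subseteq> {m0..m0 + nat \<lfloor>c\<rfloor>}"
    proof
      fix m assume m: "m \<in> M"
      hence "real m - real m0 \<le> c" by (intro gap m0)
      thus "m \<in> {m0..m0 + nat \<lfloor>c\<rfloor>}" using m0(2)[OF m] by (auto; linarith)
    qed
    have "card M \<le> nat \<lfloor>c\<rfloor> + 1" using card_mono[OF _ sub] by simp
    hence "real (card M) \<le> c + 1" using c by linarith
    thus ?thesis using finite_subset[OF sub] by simp
  qed (use c in auto)
  thus "finite {m::nat. x < real m ^ k \<and> real m ^ k \<le> x + c * sqrt x}"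
    and "real (card {m::nat. x < real m ^ k \<and> real m ^ k \<le> x + c * sqrt x}) \<le> c + 1" by (auto simp: M_def)
qed

text \<open>
  The exponents are at most \<open>log 2 y\<close>, each of them occurs for at most \<open>c + 1\<close> bases, and every prime
  power weighs at most \<open>ln y\<close>.
\<close>

lemma mangoldt_proper_powers_window:
  assumes c: "c \<ge> 0" and x: "x \<ge> 1"
  defines "y \<equiv> x + c * sqrt x"
  shows "(\<Sum>n | x < real n \<and> real n \<le> y \<and> \<not> prime n. mangoldt n) \<le> (c + 1) / ln 2 * (ln y)\<^sup>2"
proof -
  define A where "A = {n. x < real n \<and> real n \<le> y \<and> \<not> prime n}"
  define Q where "Q = {n \<in> A. primepow n}"
  define K where "K = nat \<lfloor>log 2 y\<rfloor>"
  have "c * sqrt x \<ge> 0" using x c by simp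
  hence y: "y \<ge> 1" using x unfolding y_def by linarith
  have finA: "finite A"
    by (rule finite_subset[OF _ card_nat_interval_le(2)[of "c * sqrt x" x]]) (use c x in \<open>auto simp: A_def y_def\<close>)
  have sub: "Q \<subseteq> (\<Union>k\<in>{2..K}. (\<lambda>m. m ^ k) ` {m::nat. x < real m ^ k \<and> real m ^ k \<le> x + c * sqrt x})"
  proof
    fix n assume n: "n \<in> Q"
    then obtain p k where pk: "prime p" "k > 0" "n = p ^ k" by (auto simp: Q_def primepow_def)
    have "k \<noteq> 1" using n pk by (auto simp: Q_def A_def)
    hence k2: "k \<ge> 2" using pk by simp
    have ny: "real p ^ k \<le> y" "x < real p ^ k" using n pk by (auto simp: Q_def A_def)
    have "2 ^ k \<le> real p ^ k" using prime_ge_2_nat[OF pk(1)] by (intro power_mono) auto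
    hence "2 powr real k \<le> y" using ny by (simp add: powr_realpow)
    hence "real k \<le> log 2 y" using y by (subst le_log_iff) auto
    hence "k \<le> K" by (simp add: K_def le_nat_floor)
    thus "n \<in> (\<Union>k\<in>{2..K}. (\<lambda>m. m ^ k) ` {m::nat. x < real m ^ k \<and> real m ^ k \<le> x + c * sqrt x})"
      using k2 ny pk by (auto simp: y_def)
  qed
  have "real (card Q) \<le> real (card (\<Union>k\<in>{2..K}. (\<lambda>m. m ^ k) ` {m::nat. x < real m ^ k \<and> real m ^ k \<le> x + c * sqrt x}))"
    by (intro of_nat_mono card_mono sub finite_UN_I finite_imageI card_perfect_powers_window(1) c x) auto
  also have "\<dots> \<le> real (\<Sum>k\<in>{2..K}. card ((\<lambda>m. m ^ k) ` {m::nat. x < real m ^ k \<and> real m ^ k \<le> x + c * sqrt x}))"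
    by (intro of_nat_mono card_UN_le) auto
  also have "\<dots> \<le> (\<Sum>k\<in>{2..K}. c + 1)"
    unfolding of_nat_sum
  proof (rule sum_mono)
    fix k assume k: "k \<in> {2..K}"
    have "real (card ((\<lambda>m. m ^ k) ` {m::nat. x < real m ^ k \<and> real m ^ k \<le> x + c * sqrt x})) \<le>
          real (card {m::nat. x < real m ^ k \<and> real m ^ k \<le> x + c * sqrt x})"
      by (intro of_nat_mono card_image_le card_perfect_powers_window(1) c x) (use k in auto)
    also have "\<dots> \<le> c + 1" by (intro card_perfect_powers_window(2) c x) (use k in auto)
    finally show "real (card ((\<lambda>m. m ^ k) ` {m::nat. x < real m ^ k \<and> real m ^ k \<le> x + c * sqrt x})) \<le> c + 1" .
  qed
  also have "\<dots> = real (card {2..K}) * (c + 1)" by simp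
  also have "\<dots> \<le> log 2 y * (c + 1)"
  proof (rule mult_right_mono)
    have "log 2 y \<ge> 0" using y by simp
    hence "real K \<le> log 2 y" unfolding K_def by (rule of_nat_floor)
    thus "real (card {2..K}) \<le> log 2 y" using \<open>log 2 y \<ge> 0\<close> by simp
  qed (use c in auto)
  finally have cardQ: "real (card Q) \<le> log 2 y * (c + 1)" .
  have "(\<Sum>n\<in>A. mangoldt n) = (\<Sum>n\<in>Q. mangoldt n :: real)"
    by (rule sum.mono_neutral_right) (use finA in \<open>auto simp: Q_def mangoldt_def\<close>)
  also have "\<dots> \<le> (\<Sum>n\<in>Q. ln y)"
  proof (rule sum_mono)
    fix n assume "n \<in> Q"
    hence n: "n > 0" "real n \<le> y" using x by (auto simp: Q_def A_def intro!: Nat.gr0I)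
    have "mangoldt n \<le> ln (real n)" using n by (intro mangoldt_le)
    also have "\<dots> \<le> ln y" using n by simp
    finally show "mangoldt n \<le> ln y" .
  qed
  also have "\<dots> = real (card Q) * ln y" by simp
  also have "\<dots> \<le> (log 2 y * (c + 1)) * ln y" using y by (intro mult_right_mono cardQ) auto
  also have "\<dots> = (c + 1) / ln 2 * (ln y)\<^sup>2" by (simp add: log_def power2_eq_square)
  finally show ?thesis by (simp add: A_def)
qed

text \<open>
  Over the window \<open>ln t\<close> varies by at most \<open>h / x\<close>, so that the integral differs from \<open>h / ln x\<close> by
  at most \<open>h * (h / x) / ln x\<close>; and \<open>h\<^sup>2 / x = c\<^sup>2\<close>.
\<close>

lemma expected_count_approx:
  assumes c: "c > 0" and x: "x > 1" "ln x \<ge> 1"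
  shows "\<bar>c * sqrt x - expected_count c x * ln x\<bar> \<le> c\<^sup>2"
proof -
  define h where "h = c * sqrt x"
  define y where "y = x + h"
  have h: "h > 0" using c x by (simp add: h_def)
  have y: "y > x" "ln y > ln x" using h x by (auto simp: y_def)
  have "sqrt x * sqrt x = x" using x by simp
  hence "h * h = c\<^sup>2 * x" unfolding h_def power2_eq_square by (metis mult.assoc mult.commute)
  hence hh: "h * h / x = c\<^sup>2" using x by simp
  have cont: "continuous_on {x..y} (\<lambda>t. 1 / ln t)"
    using x by (intro continuous_intros) auto
  hence int: "(\<lambda>t. 1 / ln t) integrable_on {x..y}" by (rule integrable_continuous_interval)
  have ex: "expected_count c x = integral {x..y} (\<lambda>t. 1 / ln t)"
    by (simp add: expected_count_def y_def h_def)
  have "integral {x..y} (\<lambda>t. 1 / ln y) \<le> expected_count c x" unfolding ex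
    using x by (intro integral_le int integrable_const_ivl) (auto intro!: divide_left_mono mult_pos_pos)
  hence lo: "h / ln y \<le> expected_count c x" using y by (simp add: y_def)
  have "expected_count c x \<le> integral {x..y} (\<lambda>t. 1 / ln x)" unfolding ex
    using x by (intro integral_le int integrable_const_ivl) (auto intro!: divide_left_mono mult_pos_pos)
  hence hi: "expected_count c x \<le> h / ln x" using y by (simp add: y_def)
  have up: "expected_count c x * ln x \<le> h" using hi x by (simp add: pos_le_divide_eq)
  have "ln y - ln x = ln (1 + h / x)"
  proof -
    have "1 + h / x = y / x" using x by (simp add: y_def add_divide_distrib)
    thus ?thesis using x y by (simp add: ln_div)
  qed
  also have "\<dots> \<le> h / x" using h x by (intro ln_add_one_self_le_self) auto
  finally have d: "ln y - ln x \<le> h / x" .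
  have l: "ln y \<ge> 1" "ln y > 0" using y(2) x(2) by linarith+
  have "h - expected_count c x * ln x \<le> h - h / ln y * ln x"
    using lo x by (intro diff_left_mono mult_right_mono) auto
  also have "\<dots> = h * (ln y - ln x) / ln y" using x y by (simp add: field_simps)
  also have "\<dots> \<le> h * (h / x) / ln y" using d h x y by (intro divide_right_mono mult_left_mono) auto
  also have "\<dots> \<le> h * (h / x) / 1" using h x l by (intro divide_left_mono) auto
  also have "\<dots> = c\<^sup>2" using hh by simp
  finally show ?thesis using up by (simp add: h_def abs_le_iff)
qed

text \<open>
  Replacing \<open>ln p\<close> by \<open>ln x\<close> for the primes of the window and the expected count by \<open>h / ln x\<close> costs a
  bounded amount. The proper prime powers account for the term \<open>(ln x)\<^sup>2\<close>.
\<close>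

lemma layer_count_approx_psi:
  assumes c: "c > 0"
  obtains C where "C > 0" "\<forall>\<^sub>F x in at_top. 
     \<bar>real (layer_count c x) - expected_count c x\<bar> * ln x \<le>
       \<bar>psi_window_error c x\<bar> + C * (ln x)\<^sup>2"
proof -
  define C where "C = 2 * c\<^sup>2 + c + (c + 1) / ln 2 * 4"
  have "\<forall>\<^sub>F x in at_top. x > 1 \<and> ln x \<ge> 1 \<and> ln (x + c * sqrt x) \<le> 2 * ln x"
    by (intro eventually_conj; use c in real_asymp)
  hence "\<forall>\<^sub>F x in at_top. 
     \<bar>real (layer_count c x) - expected_count c x\<bar> * ln x \<le>
       \<bar>psi_window_error c x\<bar> + C * (ln x)\<^sup>2"
  proof eventually_elim
    case (elim x)
    define h where "h = c * sqrt x"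
    define y where "y = x + h"
    have x: "x > 1" "ln x \<ge> 1" and lny: "ln y \<le> 2 * ln x" using elim by (auto simp: y_def h_def)
    have h: "h > 0" using c x by (simp add: h_def)
    define A where "A = {n. x < real n \<and> real n \<le> y}"
    define P where "P = {p \<in> A. prime p}"
    have finA: "finite A" and cardA: "real (card A) \<le> h + 1"
      unfolding A_def y_def using card_nat_interval_le[of h x] h by auto
    have PA: "P \<subseteq> A" by (auto simp: P_def)
    have N: "layer_count c x = card P"
      unfolding layer_count_def P_def A_def y_def h_def by (rule arg_cong[where f = card]) auto
    have "chebyshev_psi y = chebyshev_psi x + (\<Sum>n\<in>A. mangoldt n)"
    proof -
      have "{n. real n \<le> y} = {n. real n \<le> x} \<union> A" using h by (auto simp: A_def y_def)
      moreover have "{n. real n \<le> x} \<inter> A = {}" by (auto simp: A_def)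
      ultimately show ?thesis unfolding chebyshev_psi_def using finA by (simp add: sum.union_disjoint)
    qed
    also have "(\<Sum>n\<in>A. mangoldt n) = (\<Sum>n\<in>P. mangoldt n) + (\<Sum>n\<in>A - P. mangoldt n :: real)"
      using sum.subset_diff[OF PA finA, of "mangoldt :: nat \<Rightarrow> real"] by simp
    also have "(\<Sum>n\<in>P. mangoldt n :: real) = (\<Sum>p\<in>P. ln (real p))"
      by (intro sum.cong) (auto simp: P_def)
    finally have psi: "chebyshev_psi y - chebyshev_psi x = (\<Sum>p\<in>P. ln (real p)) + (\<Sum>n\<in>A - P. mangoldt n)" by simp
    have "A - P = {n. x < real n \<and> real n \<le> y \<and> \<not> prime n}" by (auto simp: A_def P_def)
    hence "(\<Sum>n\<in>A - P. mangoldt n) \<le> (c + 1) / ln 2 * (ln y)\<^sup>2"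
      using mangoldt_proper_powers_window[of c x] c x by (simp add: y_def h_def)
    also have "\<dots> \<le> (c + 1) / ln 2 * (2 * ln x)\<^sup>2"
      using lny c x h by (intro mult_left_mono power_mono) (auto simp: y_def)
    also have "\<dots> = (c + 1) / ln 2 * 4 * (ln x)\<^sup>2"
      unfolding power_mult_distrib by (simp only: mult.assoc) simp
    finally have pp: "(\<Sum>n\<in>A - P. mangoldt n) \<le> (c + 1) / ln 2 * 4 * (ln x)\<^sup>2" .
    have pp0: "(\<Sum>n\<in>A - P. mangoldt n) \<ge> (0::real)" by (intro sum_nonneg mangoldt_nonneg)
    have lnp: "0 \<le> ln (real p) - ln x \<and> ln (real p) - ln x \<le> h / x" if "p \<in> P" for p
    proof -
      have p: "x < real p" "real p \<le> y" using that by (auto simp: P_def A_def)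
      have "ln (real p) - ln x = ln (real p / x)" using p x by (simp add: ln_div)
      also have "\<dots> \<le> real p / x - 1" using p x by (intro ln_le_minus_one) auto
      also have "\<dots> = (real p - x) / x" using x by (simp add: diff_divide_distrib)
      also have "\<dots> \<le> h / x" using p x by (intro divide_right_mono) (auto simp: y_def)
      finally show ?thesis using p x by simp
    qed
    have eqs: "(\<Sum>p\<in>P. ln (real p)) - real (card P) * ln x = (\<Sum>p\<in>P. ln (real p) - ln x)"
      by (simp add: sum_subtractf)
    have lo: "0 \<le> (\<Sum>p\<in>P. ln (real p) - ln x)" using lnp by (intro sum_nonneg) auto
    have "(\<Sum>p\<in>P. ln (real p) - ln x) \<le> (\<Sum>p\<in>P. h / x)" using lnp by (intro sum_mono) auto
    also have "\<dots> = real (card P) * (h / x)" by simp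
    also have "\<dots> \<le> (h + 1) * (h / x)"
      using card_mono[OF finA PA] cardA h x by (intro mult_right_mono) auto
    also have "\<dots> = h * h / x + h / x" by (simp add: algebra_simps add_divide_distrib)
    also have "h * h / x = c\<^sup>2"
    proof -
      have "sqrt x * sqrt x = x" using x by simp
      hence "h * h = c\<^sup>2 * x" unfolding h_def power2_eq_square by (metis mult.assoc mult.commute)
      thus ?thesis using x by simp
    qed
    also have "h / x \<le> c"
    proof -
      have "sqrt x \<le> sqrt (x * x)" using x by (subst real_sqrt_le_iff) simp
      hence "sqrt x \<le> x" using x by simp
      hence "c * sqrt x \<le> c * x" using c by (intro mult_left_mono) auto
      thus ?thesis using x by (simp add: h_def divide_le_eq)
    qed
    finally have hi: "(\<Sum>p\<in>P. ln (real p) - ln x) \<le> c\<^sup>2 + c" by simp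
    have ex: "\<bar>h - expected_count c x * ln x\<bar> \<le> c\<^sup>2"
      unfolding h_def by (rule expected_count_approx[OF c x])
    have "\<bar>real (card P) - expected_count c x\<bar> * ln x = \<bar>(real (card P) - expected_count c x) * ln x\<bar>"
      using x by (simp add: abs_mult)
    also have "(real (card P) - expected_count c x) * ln x = 
       (chebyshev_psi y - chebyshev_psi x - h) - (\<Sum>p\<in>P. ln (real p) - ln x) - (\<Sum>n\<in>A - P. mangoldt n) + (h - expected_count c x * ln x)"
      unfolding psi eqs[symmetric] by (simp add: algebra_simps)
    also have "\<bar>\<dots>\<bar> \<le> \<bar>chebyshev_psi y - chebyshev_psi x - h\<bar> + (c\<^sup>2 + c) + (c + 1) / ln 2 * 4 * (ln x)\<^sup>2 + c\<^sup>2"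
      using lo hi pp pp0 ex by linarith
    also have "\<dots> = \<bar>chebyshev_psi y - chebyshev_psi x - h\<bar> + ((2 * c\<^sup>2 + c) * 1 + (c + 1) / ln 2 * 4 * (ln x)\<^sup>2)" by simp
    also have "(2 * c\<^sup>2 + c) * 1 \<le> (2 * c\<^sup>2 + c) * (ln x)\<^sup>2"
      using c x by (intro mult_left_mono one_le_power) auto
    finally show ?case unfolding N by (simp add: C_def y_def h_def algebra_simps)
  qed
  moreover have "C > 0" unfolding C_def using c by (intro add_nonneg_pos mult_pos_pos divide_pos_pos) auto
  ultimately show ?thesis using that by blast
qed

section \<open>The footprint\<close>

text \<open>
  The integral of a function that is not integrable is 0 by convention, and then the bound is trivial.
  Otherwise \<open>g\<close> dominates the integrand.
\<close>

lemma RMS_le_of_nn_integral: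
  fixes f g :: "real \<Rightarrow> real"
  assumes X: "X > 0" and [measurable]: "g \<in> borel_measurable borel" and g: "\<And>x. g x \<ge> 0"
    and le: "\<And>x. x \<in> {X..2 * X} \<Longrightarrow> (f x)\<^sup>2 \<le> g x"
    and bound: "(\<integral>\<^sup>+x\<in>{X..2 * X}. ennreal (g x) \<partial>lborel) \<le> ennreal B" and B: "B \<ge> 0"
  shows "RMS f X \<le> sqrt (B / X)"
proof -
  have "integral {X..2 * X} (\<lambda>x. (f x)\<^sup>2) \<le> B"
  proof (cases "(\<lambda>x. (f x)\<^sup>2) integrable_on {X..2 * X}")
    case True
    have nn: "(\<integral>\<^sup>+x. ennreal (indicator {X..2 * X} x * g x) \<partial>lborel) \<le> ennreal B"
    proof -
      have "ennreal (indicator {X..2 * X} x * g x) = ennreal (g x) * indicator {X..2 * X} x" for x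
        by (auto simp: indicator_def)
      thus ?thesis using bound by simp
    qed
    have int: "integrable lborel (\<lambda>x. indicator {X..2 * X} x * g x)"
      by (rule integrableI_nonneg) (use g nn in \<open>auto intro: order.strict_trans1\<close>)
    hence sint: "set_integrable lborel {X..2 * X} g" by (simp add: set_integrable_def)
    have "integral {X..2 * X} (\<lambda>x. (f x)\<^sup>2) \<le> integral {X..2 * X} g"
      by (rule integral_le[OF True set_borel_integral_eq_integral(1)[OF sint]]) (use le in auto)
    also have "\<dots> = (\<integral>x. indicator {X..2 * X} x * g x \<partial>lborel)"
      using set_borel_integral_eq_integral(2)[OF sint] by (simp add: set_lebesgue_integral_def)
    also have "\<dots> \<le> B"
    proof -
      have "ennreal (\<integral>x. indicator {X..2 * X} x * g x \<partial>lborel) \<le> ennreal B"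
        using nn nn_integral_eq_integral[OF int] g by simp
      thus ?thesis using B by simp
    qed
    finally show ?thesis .
  qed (use B in \<open>simp add: not_integrable_integral\<close>)
  thus ?thesis unfolding RMS_def using X by (intro real_sqrt_le_mono) (simp add: divide_right_mono)
qed

text \<open>
  The mean square of the weighted error over the window is of order \<open>sqrt X * (ln X) ^ 4\<close> and
  outweighs the square \<open>(ln X) ^ 4\<close> of the cost of passing to primes. Dividing by \<open>(ln X)\<^sup>2\<close> for the
  weights, taking the root and dividing by \<open>sqrt X / ln X\<close> gives \<open>X powr (- 1/4) * (ln X)\<^sup>2\<close>.
\<close>

lemma RH_zeta_footprint_bound:
  fixes c :: real
  assumes RH: Riemann_Hypothesis and c: "c > 0"
  obtains K where "K > 0"
    "\<forall>\<^sub>F X in at_top. zeta_footprint c X \<le> K * (X powr (- 1 / 4) * (ln X)\<^sup>2)"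
proof -
  obtain K where K: "K > 0" and window: "\<forall>\<^sub>F X in at_top. 
      (\<integral>\<^sup>+x\<in>{X..2 * X}. ennreal ((psi_window_error c x)\<^sup>2) \<partial>lborel)
        \<le> ennreal (K * (X * sqrt X) * (ln X) ^ 4)"
    using RH_psi_window_mean_square[OF RH c] by blast
  obtain C where C: "C > 0" and approx: "\<forall>\<^sub>F x in at_top. 
     \<bar>real (layer_count c x) - expected_count c x\<bar> * ln x \<le>
       \<bar>psi_window_error c x\<bar> + C * (ln x)\<^sup>2"
    using layer_count_approx_psi[OF c] by blast
  obtain x0 where x0: "\<And>x. x \<ge> x0 \<Longrightarrow> 
     \<bar>real (layer_count c x) - expected_count c x\<bar> * ln x \<le>
       \<bar>psi_window_error c x\<bar> + C * (ln x)\<^sup>2"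
    using approx unfolding eventually_at_top_linorder by blast
  define K' where "K' = 2 * K + 32 * C\<^sup>2"
  have K': "K' > 0" using K C by (simp add: K'_def add_pos_nonneg)
  have "\<forall>\<^sub>F X in at_top. X \<ge> x0 \<and> X > 1 \<and> ln X \<ge> 1 \<and> ln (2 * X) \<le> 2 * ln X \<and> 1 \<le> sqrt X"
    by (intro eventually_conj eventually_ge_at_top eventually_gt_at_top; real_asymp)
  with window have "\<forall>\<^sub>F X in at_top. zeta_footprint c X \<le> sqrt K' * (X powr (- 1 / 4) * (ln X)\<^sup>2)"
  proof eventually_elim
    case (elim X)
    hence X: "X \<ge> x0" "X > 1" "ln X \<ge> 1" "ln (2 * X) \<le> 2 * ln X" "1 \<le> sqrt X" by auto
    define E where "E = (\<lambda>x. psi_window_error c x)"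
    have [measurable]: "chebyshev_psi \<in> borel_measurable borel"
      by (rule borel_measurable_mono[OF chebyshev_psi_mono])
    have [measurable]: "E \<in> borel_measurable borel" unfolding E_def by measurable
    define R where "R = 16 * C\<^sup>2 * (ln X) ^ 4"
    define g where "g = (\<lambda>x. (2 * (E x)\<^sup>2 + 2 * R) / (ln X)\<^sup>2)"
    define B where "B = (2 * (K * (X * sqrt X) * (ln X) ^ 4) + 2 * (R * X)) / (ln X)\<^sup>2"
    have R: "R \<ge> 0" by (simp add: R_def)
    have "RMS (\<lambda>x. real (layer_count c x) - expected_count c x) X \<le> sqrt (B / X)"
    proof (rule RMS_le_of_nn_integral[where g = g])
      show "(real (layer_count c x) - expected_count c x)\<^sup>2 \<le> g x" if x: "x \<in> {X..2 * X}" for x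
      proof -
        have lnx: "ln X \<le> ln x" "ln x \<le> 2 * ln X" 
        proof -
          have "ln x \<le> ln (2 * X)" using x X by simp
          thus "ln x \<le> 2 * ln X" using X by linarith
        qed (use x X in simp)
        have "\<bar>real (layer_count c x) - expected_count c x\<bar> * ln X \<le> \<bar>real (layer_count c x) - expected_count c x\<bar> * ln x"
          using lnx by (intro mult_left_mono) auto
        also have "\<dots> \<le> \<bar>E x\<bar> + C * (ln x)\<^sup>2" unfolding E_def using x X by (intro x0) auto
        also have "C * (ln x)\<^sup>2 \<le> C * (2 * ln X)\<^sup>2" using lnx X C by (intro mult_left_mono power_mono) auto
        finally have "(\<bar>real (layer_count c x) - expected_count c x\<bar> * ln X)\<^sup>2 \<le> (\<bar>E x\<bar> + C * (2 * ln X)\<^sup>2)\<^sup>2"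
          using X by (intro power_mono) auto
        also have "\<dots> \<le> 2 * \<bar>E x\<bar>\<^sup>2 + 2 * (C * (2 * ln X)\<^sup>2)\<^sup>2"
          using sum_squares_bound[of "\<bar>E x\<bar>" "C * (2 * ln X)\<^sup>2"] by (simp add: power2_sum)
        also have "(C * (2 * ln X)\<^sup>2)\<^sup>2 = R" by (simp add: R_def power_mult_distrib flip: power_mult)
        finally have "(real (layer_count c x) - expected_count c x)\<^sup>2 * (ln X)\<^sup>2 \<le> 2 * (E x)\<^sup>2 + 2 * R"
          by (simp add: power_mult_distrib)
        thus ?thesis unfolding g_def using X by (simp add: pos_le_divide_eq)
      qed
      have "(\<integral>\<^sup>+x\<in>{X..2 * X}. ennreal (g x) \<partial>lborel) =
        (\<integral>\<^sup>+x. ennreal (2 / (ln X)\<^sup>2) * (ennreal ((E x)\<^sup>2) * indicator {X..2 * X} x) + ennreal (2 / (ln X)\<^sup>2 * R) * indicator {X..2 * X} x \<partial>lborel)"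
      proof (rule nn_integral_cong)
        fix x
        have "g x = 2 / (ln X)\<^sup>2 * (E x)\<^sup>2 + 2 / (ln X)\<^sup>2 * R" by (simp add: g_def add_divide_distrib)
        hence "ennreal (g x) = ennreal (2 / (ln X)\<^sup>2) * ennreal ((E x)\<^sup>2) + ennreal (2 / (ln X)\<^sup>2 * R)"
          using R by (simp flip: ennreal_mult ennreal_plus)
        thus "ennreal (g x) * indicator {X..2 * X} x = ennreal (2 / (ln X)\<^sup>2) * (ennreal ((E x)\<^sup>2) * indicator {X..2 * X} x) + ennreal (2 / (ln X)\<^sup>2 * R) * indicator {X..2 * X} x"
          by (simp add: distrib_right mult.assoc)
      qed
      also have "\<dots> = ennreal (2 / (ln X)\<^sup>2) * (\<integral>\<^sup>+x\<in>{X..2 * X}. ennreal ((E x)\<^sup>2) \<partial>lborel) + ennreal (2 / (ln X)\<^sup>2 * R) * ennreal X"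
        using X by (subst nn_integral_add) (auto simp: nn_integral_cmult nn_integral_cmult_indicator)
      also have "\<dots> \<le> ennreal (2 / (ln X)\<^sup>2) * ennreal (K * (X * sqrt X) * (ln X) ^ 4) + ennreal (2 / (ln X)\<^sup>2 * R) * ennreal X"
        using elim unfolding E_def by (intro add_mono mult_left_mono) auto
      also have "\<dots> = ennreal (2 / (ln X)\<^sup>2 * (K * (X * sqrt X) * (ln X) ^ 4) + 2 / (ln X)\<^sup>2 * R * X)"
        using X K R by (simp flip: ennreal_mult ennreal_plus)
      also have "2 / (ln X)\<^sup>2 * (K * (X * sqrt X) * (ln X) ^ 4) + 2 / (ln X)\<^sup>2 * R * X = B"
        by (simp add: B_def add_divide_distrib)
      finally show "(\<integral>\<^sup>+x\<in>{X..2 * X}. ennreal (g x) \<partial>lborel) \<le> ennreal B" .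
      show "g \<in> borel_measurable borel" unfolding g_def by measurable
    qed (use X K R in \<open>auto simp: g_def B_def\<close>)
    also have "B / X = (2 * K * sqrt X + 32 * C\<^sup>2) * (ln X)\<^sup>2"
    proof -
      have p4: "(ln X) ^ 4 = (ln X)\<^sup>2 * (ln X)\<^sup>2" by (simp flip: power_add)
      show ?thesis unfolding B_def R_def p4 using X by (simp add: field_simps)
    qed
    also have "\<dots> \<le> (K' * sqrt X) * (ln X)\<^sup>2"
    proof (rule mult_right_mono)
      have "32 * C\<^sup>2 * 1 \<le> 32 * C\<^sup>2 * sqrt X" using X by (intro mult_left_mono) auto
      thus "2 * K * sqrt X + 32 * C\<^sup>2 \<le> K' * sqrt X" by (simp add: K'_def algebra_simps)
    qed auto
    finally have rms: "RMS (\<lambda>x. real (layer_count c x) - expected_count c x) X \<le> sqrt ((K' * sqrt X) * (ln X)\<^sup>2)"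
      by (simp add: real_sqrt_le_mono)
    have "sqrt ((K' * sqrt X) * (ln X)\<^sup>2) = sqrt K' * sqrt (sqrt X) * ln X"
      using X by (simp add: real_sqrt_mult)
    with rms have "zeta_footprint c X \<le> sqrt K' * sqrt (sqrt X) * ln X / (sqrt X / ln X)"
      unfolding zeta_footprint_def using X by (intro divide_right_mono) auto
    also have "\<dots> = sqrt K' * (sqrt (sqrt X) / sqrt X * (ln X)\<^sup>2)"
      by (simp add: power2_eq_square)
    also have "sqrt (sqrt X) / sqrt X = X powr (- 1 / 4)"
      using X by (simp add: powr_half_sqrt[symmetric] powr_powr flip: powr_diff)
    finally show ?case .
  qed
  thus ?thesis using K' that[of "sqrt K'"] by simp
qed

text \<open>
  Between \<open>a X\<close> and \<open>b X\<close> the power changes by a bounded factor, and \<open>ln X \<le> 2 ln (a X)\<close> as soon as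
  \<open>X\<close> is large.
\<close>

lemma footprint_gauge_comparable:
  fixes a b :: real
  assumes a: "0 < a"
  shows "\<forall>\<^sub>F X in at_top. \<forall>p::real. a * X \<le> p \<and> p \<le> b * X \<longrightarrow>
     X powr (- 1 / 4) * (ln X)\<^sup>2 \<le> 4 * b powr (1 / 4) * (p powr (- 1 / 4) * (ln p)\<^sup>2)"
proof -
  have "\<forall>\<^sub>F X in at_top. X > 1 \<and> ln X \<le> 2 * ln (a * X) \<and> a * X > 1"
    by (intro eventually_conj; use a in real_asymp)
  thus ?thesis
  proof eventually_elim
    case (elim X)
    show ?case
    proof (intro allI impI)
      fix p assume p: "a * X \<le> p \<and> p \<le> b * X"
      have p1: "p > 1" using elim p by linarith
      have "b * X > 0" using p p1 by linarith
      hence b: "b > 0" using elim by (simp add: zero_less_mult_iff)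
      have "p powr (1 / 4) \<le> (b * X) powr (1 / 4)" using p p1 by (intro powr_mono2) auto
      also have "\<dots> = b powr (1 / 4) * X powr (1 / 4)" using b elim by (simp add: powr_mult)
      finally have "p powr (1 / 4) \<le> b powr (1 / 4) * X powr (1 / 4)" .
      hence 1: "X powr (- 1 / 4) \<le> b powr (1 / 4) * p powr (- 1 / 4)"
        using p1 elim by (simp add: powr_minus field_simps)
      have "ln (a * X) \<le> ln p" using elim p by (subst ln_le_cancel_iff) auto
      hence "ln X \<le> 2 * ln p" using elim by linarith
      hence "(ln X)\<^sup>2 \<le> (2 * ln p)\<^sup>2" using elim by (intro power_mono) auto
      hence 2: "(ln X)\<^sup>2 \<le> 4 * (ln p)\<^sup>2" by (simp add: power_mult_distrib)
      have "X powr (- 1 / 4) * (ln X)\<^sup>2 \<le> (b powr (1 / 4) * p powr (- 1 / 4)) * (4 * (ln p)\<^sup>2)"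
        using 1 2 by (intro mult_mono) auto
      thus "X powr (- 1 / 4) * (ln X)\<^sup>2 \<le> 4 * b powr (1 / 4) * (p powr (- 1 / 4) * (ln p)\<^sup>2)"
        by (simp add: mult_ac)
    qed
  qed
qed

theorem theorem1p6:
  fixes c :: real
  assumes "Riemann_Hypothesis" and "c > 0"
  shows "(\<lambda>X. zeta_footprint c X) \<in> O[at_top](\<lambda>X. X powr (- 1 / 4) * (ln X)\<^sup>2) \<and>
    (\<forall>a b. 0 < a \<and> a \<le> b \<longrightarrow>
      (\<exists>C. \<forall>\<^sub>F X in at_top. \<forall>p::nat. prime p \<and> a * X \<le> real p \<and> real p \<le> b * X \<longrightarrow>
         zeta_footprint c X \<le> C * (real p powr (- 1 / 4) * (ln (real p))\<^sup>2)))"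
proof -
  obtain K where K: "K > 0"
    and bound: "\<forall>\<^sub>F X in at_top. zeta_footprint c X \<le> K * (X powr (- 1 / 4) * (ln X)\<^sup>2)"
    using RH_zeta_footprint_bound[OF assms] by blast
  have nonneg: "\<forall>\<^sub>F X in at_top. zeta_footprint c X \<ge> 0"
    using eventually_gt_at_top[of 1]
  proof eventually_elim
    case (elim X)
    have "0 \<le> integral {X..2 * X} (\<lambda>x. (real (layer_count c x) - expected_count c x)\<^sup>2)"
      by (cases "(\<lambda>x. (real (layer_count c x) - expected_count c x)\<^sup>2) integrable_on {X..2 * X}")
         (auto intro: Henstock_Kurzweil_Integration.integral_nonneg simp: not_integrable_integral)
    thus ?case using elim by (simp add: zeta_footprint_def RMS_def)
  qed
  have "(\<lambda>X. zeta_footprint c X) \<in> O[at_top](\<lambda>X. X powr (- 1 / 4) * (ln X)\<^sup>2)"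
  proof (rule bigoI)
    show "\<forall>\<^sub>F X in at_top. norm (zeta_footprint c X) \<le> K * norm (X powr (- 1 / 4) * (ln X)\<^sup>2)"
      using bound nonneg by eventually_elim simp
  qed
  moreover have "\<exists>C. \<forall>\<^sub>F X in at_top. \<forall>p::nat. prime p \<and> a * X \<le> real p \<and> real p \<le> b * X \<longrightarrow>
         zeta_footprint c X \<le> C * (real p powr (- 1 / 4) * (ln (real p))\<^sup>2)"
    if "0 < a \<and> a \<le> b" for a b :: real
  proof (intro exI)
    have "0 < a" using that by simp
    from bound footprint_gauge_comparable[OF this, of b]
    show "\<forall>\<^sub>F X in at_top. \<forall>p::nat. prime p \<and> a * X \<le> real p \<and> real p \<le> b * X \<longrightarrow>
         zeta_footprint c X \<le> (K * (4 * b powr (1 / 4))) * (real p powr (- 1 / 4) * (ln (real p))\<^sup>2)"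
    proof eventually_elim
      case (elim X)
      show ?case
      proof (intro allI impI)
        fix p :: nat assume p: "prime p \<and> a * X \<le> real p \<and> real p \<le> b * X"
        have "zeta_footprint c X \<le> K * (X powr (- 1 / 4) * (ln X)\<^sup>2)" by (rule elim(1))
        also have "\<dots> \<le> K * (4 * b powr (1 / 4) * (real p powr (- 1 / 4) * (ln (real p))\<^sup>2))"
          using elim(2) p K by (intro mult_left_mono) auto
        finally show "zeta_footprint c X \<le> (K * (4 * b powr (1 / 4))) * (real p powr (- 1 / 4) * (ln (real p))\<^sup>2)"
          by (simp add: mult_ac)
      qed
    qed
  qed
  ultimately show ?thesis by blast
qed

end
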